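(* (i) Let $0<\alpha<1/2$. Then $$P\big(\Lambda(\omega)\text{ is interpolating for }\mathcal{D}_\alpha\big)=1\quad\text{if and only if}\quad \sum_n 2^{-n}N_n^2<\infty,$$ and $$P\big(\Lambda(\omega)\text{ is interpolating for }\mathcal{D}_\alpha\big)=0\quad\text{if and only if}\quad \sum_n 2^{-n}N_n^2=\infty.$$ (ii) Let $1/2\le\alpha<1$. Then $$P\big(\Lambda(\omega)\text{ is interpolating for }\mathcal{D}_\alpha\big)=1\quad\text{if and only if}\quad \sum_n 2^{-(1-\alpha)n}N_n<\infty,$$ and $$P\big(\Lambda(\omega)\text{ is interpolating for }\mathcal{D}_\alpha\big)=0\quad\text{if and only if}\quad \sum_n 2^{-(1-\alpha)n}N_n=\infty.$$
   Context: $\mathbb{D}$ is the open unit disk. Random sequence: $(\rho_n)\subset[0,1)$ is a fixed (deterministic) sequence of radii, $(\theta_n(\omega))$ is a sequence of independent random variables, all uniformly distributed on $[0,2\pi]$, and $\Lambda(\omega)=\{\lambda_n\}$ is the set of points $\lambda_n=\rho_n e^{i\theta_n(\omega)}$. For $n=0,1,2,\ldots$, $N_n=\#\{\lambda\in\Lambda(\omega): 1-2^{-n}\le|\lambda|<1-2^{-n-1}\}$; almost surely this depends only on the radii. Sums over $n$ run over $n\ge0$. The weighted Dirichlet space $\mathcal{D}_\alpha$ is the space of analytic functions $f$ on $\mathbb{D}$ with $\|f\|_\alpha^2=|f(0)|^2+\int_{\mathbb{D}}|f'(z)|^2(1-|z|^2)^{1-\alpha}\,dA(z)<\infty$, where $dA=dx\,dy/\pi$.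 For $0\le\alpha<1$ its reproducing kernel (for an equivalent norm) is $k_z(w)=(1-\bar z w)^{-(1-\alpha)}$, and $\|k_\lambda\|_\alpha^2=k_\lambda(\lambda)=(1-|\lambda|^2)^{-(1-\alpha)}$. "Interpolating" always means universal interpolating: a set $\Lambda$ of distinct points of $\mathbb{D}$ is (universal) interpolating for $\mathcal{D}_\alpha$ if the map $R_\Lambda: f\mapsto (f(\lambda)/\|k_\lambda\|_\alpha)_{\lambda\in\Lambda}$ is well defined from $\mathcal{D}_\alpha$ into $\ell^2(\Lambda)$ and is onto $\ell^2(\Lambda)$. *)

theory Defs
  imports "HOL-Complex_Analysis.Complex_Analysis" "HOL-Probability.Probability"
begin

section \<open>Weighted Dirichlet spaces\<close>

definition dirichlet_norm_sq :: "real \<Rightarrow> (complex \<Rightarrow> complex) \<Rightarrow> ennreal" where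
  "dirichlet_norm_sq \<alpha> f = ennreal ((norm (f 0))\<^sup>2) +
     (\<integral>\<^sup>+z\<in>ball 0 1. ennreal ((norm (deriv f z))\<^sup>2 * (1 - (norm z)\<^sup>2) powr (1 - \<alpha>) / pi) \<partial>lborel)"

text \<open>Members are total functions on the plane; only their values on the unit disk matter.\<close>

definition dirichlet_space :: "real \<Rightarrow> (complex \<Rightarrow> complex) set" where
  "dirichlet_space \<alpha> = {f. f holomorphic_on ball 0 1 \<and> dirichlet_norm_sq \<alpha> f < \<infinity>}"

text \<open>Reproducing kernel for a norm equivalent to the one above (for \<open>0 \<le> \<alpha> < 1\<close>). The principal
  branch is the right one, since \<open>1 - cnj z * w\<close> has positive real part on the disk.\<close>

definition dirichlet_kernel :: "real \<Rightarrow> complex \<Rightarrow> complex \<Rightarrow> complex" where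
  "dirichlet_kernel \<alpha> z w = (1 - cnj z * w) powr complex_of_real (- (1 - \<alpha>))"

definition kernel_norm :: "real \<Rightarrow> complex \<Rightarrow> real" where
  "kernel_norm \<alpha> z = sqrt (Re (dirichlet_kernel \<alpha> z z))"

lemma dirichlet_kernel_diag:
  assumes "norm z < 1"
  shows "dirichlet_kernel \<alpha> z z = of_real ((1 - (norm z)\<^sup>2) powr (- (1 - \<alpha>)))"
proof -
  have "1 - cnj z * z = of_real (1 - (norm z)\<^sup>2)"
    by (simp only: of_real_diff of_real_1 complex_norm_square mult.commute)
  moreover have "(norm z)\<^sup>2 \<le> 1"
    using assms by (simp add: power_le_one)
  ultimately show ?thesis
    unfolding dirichlet_kernel_def by (subst powr_of_real[symmetric]) auto
qed

lemma kernel_norm_sq: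
  assumes "norm z < 1"
  shows "(kernel_norm \<alpha> z)\<^sup>2 = (1 - (norm z)\<^sup>2) powr (- (1 - \<alpha>))"
  using assms by (simp add: kernel_norm_def dirichlet_kernel_diag)


section \<open>Universal interpolation\<close>

definition ell2_on :: "complex set \<Rightarrow> (complex \<Rightarrow> complex) set" where
  "ell2_on \<Lambda> = {c \<in> extensional \<Lambda>. (\<lambda>x. (norm (c x))\<^sup>2) summable_on \<Lambda>}"

definition restriction_map :: "real \<Rightarrow> complex set \<Rightarrow> (complex \<Rightarrow> complex) \<Rightarrow> complex \<Rightarrow> complex" where
  "restriction_map \<alpha> \<Lambda> f = (\<lambda>x\<in>\<Lambda>. f x / of_real (kernel_norm \<alpha> x))"

definition interpolating :: "real \<Rightarrow> complex set \<Rightarrow> bool" where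
  "interpolating \<alpha> \<Lambda> \<longleftrightarrow> \<Lambda> \<subseteq> ball 0 1 \<and>
     restriction_map \<alpha> \<Lambda> \<in> dirichlet_space \<alpha> \<rightarrow> ell2_on \<Lambda> \<and>
     ell2_on \<Lambda> \<subseteq> restriction_map \<alpha> \<Lambda> ` dirichlet_space \<alpha>"


section \<open>Random point sets\<close>

definition random_set :: "(nat \<Rightarrow> real) \<Rightarrow> (nat \<Rightarrow> 'a \<Rightarrow> real) \<Rightarrow> 'a \<Rightarrow> complex set" where
  "random_set \<rho> \<theta> \<omega> = range (\<lambda>k. complex_of_real (\<rho> k) * cis (\<theta> k \<omega>))"

definition dyadic_shell :: "nat \<Rightarrow> real set" where
  "dyadic_shell n = {1 - (1/2) ^ n ..< 1 - (1/2) ^ Suc n}"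

text \<open>The number of points of \<open>\<Lambda>\<close> with modulus in the \<open>n\<close>-th shell, possibly \<open>\<infinity>\<close>.\<close>

definition shell_count :: "complex set \<Rightarrow> nat \<Rightarrow> ennreal" where
  "shell_count \<Lambda> n = emeasure (count_space UNIV) {x \<in> \<Lambda>. norm x \<in> dyadic_shell n}"

text \<open>The almost sure value of \<open>shell_count\<close> on the random set, see \<open>AE_shell_count\<close>: one point for
  each radius in the shell, except that all indices with radius \<open>0\<close> give the same point, so that
  only the first of them is counted.\<close>

definition radial_count :: "(nat \<Rightarrow> real) \<Rightarrow> nat \<Rightarrow> ennreal" where
  "radial_count \<rho> n = emeasure (count_space UNIV)
     {k. \<rho> k \<in> dyadic_shell n \<and> (\<rho> k = 0 \<longrightarrow> (\<forall>j<k. \<rho> j \<noteq> 0))}"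

lemma countable_cis_eq: "countable {y. cis y = cis x}"
proof (rule countable_subset)
  show "{y. cis y = cis x} \<subseteq> range (\<lambda>n::int. x + 2 * pi * of_int n)"
  proof
    fix y assume "y \<in> {y. cis y = cis x}"
    then have "sin y = sin x" "cos y = cos x"
      by (auto simp: complex_eq_iff)
    then obtain n :: int where "y = x + 2 * pi * of_int n"
      using sin_cos_eq_iff[of y x] by auto
    then show "y \<in> range (\<lambda>n::int. x + 2 * pi * of_int n)" by blast
  qed
qed auto

lemma (in prob_space) AE_cis_neq:
  assumes indep: "indep_vars (\<lambda>_. borel) \<theta> UNIV"
    and unif: "\<And>k. distributed M lborel (\<theta> k)
                (\<lambda>x. indicator {0..2*pi} x / measure lborel {0..2*pi})"
    and "j \<noteq> k"
  shows "AE \<omega> in M. cis (\<theta> k \<omega>) \<noteq> cis (\<theta> j \<omega>)"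
proof -
  define D where "D = distr M borel (\<theta> k)"
  define E where "E = distr M borel (\<theta> j)"
  have iv: "indep_var borel (\<theta> j) borel (\<theta> k)"
  proof -
    have "indep_var (PiM {j} (\<lambda>_. borel)) (\<lambda>\<omega>. \<lambda>i\<in>{j}. \<theta> i \<omega>)
                    (PiM {k} (\<lambda>_. borel)) (\<lambda>\<omega>. \<lambda>i\<in>{k}. \<theta> i \<omega>)"
      by (rule indep_var_restrict[OF indep]) (use \<open>j \<noteq> k\<close> in auto)
    then have "indep_var borel ((\<lambda>f. f j) \<circ> (\<lambda>\<omega>. \<lambda>i\<in>{j}. \<theta> i \<omega>))
                         borel ((\<lambda>f. f k) \<circ> (\<lambda>\<omega>. \<lambda>i\<in>{k}. \<theta> i \<omega>))"
      by (rule indep_var_compose) (auto intro!: measurable_component_singleton)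
    then show ?thesis by (simp add: comp_def)
  qed
  have rv: "random_variable borel (\<theta> j)" "random_variable borel (\<theta> k)"
    using iv by (auto simp: indep_var_eq)
  have joint: "E \<Otimes>\<^sub>M D = distr M (borel \<Otimes>\<^sub>M borel) (\<lambda>\<omega>. (\<theta> j \<omega>, \<theta> k \<omega>))"
    using iv by (simp add: indep_var_distribution_eq D_def E_def)
  interpret D: prob_space D unfolding D_def by (rule prob_space_distr) (rule rv)
  interpret E: prob_space E unfolding E_def by (rule prob_space_distr) (rule rv)
  interpret pair_prob_space E D ..
  have sD: "sets D = sets borel" "sets E = sets borel" "space E = UNIV" "space D = UNIV"
    by (auto simp: D_def E_def)
  have "distr M lborel (\<theta> k) = D" unfolding D_def by (intro distr_cong) auto
  then have Dd: "D = density lborel (\<lambda>x. indicator {0..2*pi} x / measure lborel {0..2*pi})"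
    using distributed_distr_eq_density[OF unif[of k]] by simp
  have mf: "(\<lambda>x. indicator {0..2*pi} x / measure lborel {0..2*pi} :: ennreal) \<in> borel_measurable lborel"
    using unif[of k] by (simp add: distributed_def)
  have ae: "AE y in D. cis y \<noteq> cis x" for x
  proof -
    have "AE y in lborel. y \<notin> {y. cis y = cis x}"
      by (rule AE_not_in, rule countable_imp_null_set_lborel, rule countable_cis_eq)
    then show ?thesis
      unfolding Dd by (subst AE_density[OF mf]) auto
  qed
  have cl: "{p::real\<times>real. cis (snd p) \<noteq> cis (fst p)} \<in> sets borel"
    by (intro borel_open open_Collect_neq continuous_intros)
  have cl': "{p::real\<times>real. cis (snd p) \<noteq> cis (fst p)} \<in> sets (borel \<Otimes>\<^sub>M borel)"
    using cl by (simp only: borel_prod)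
  have sp: "sets (E \<Otimes>\<^sub>M D) = sets (borel \<Otimes>\<^sub>M borel)"
    by (intro sets_pair_measure_cong sD)
  have "AE p in E \<Otimes>\<^sub>M D. cis (snd p) \<noteq> cis (fst p)"
    by (rule AE_pair_measure) (use cl' ae in \<open>auto simp: sp space_pair_measure sD\<close>)
  then show ?thesis
    unfolding joint by (subst (asm) AE_distr_iff) (use rv cl' in \<open>auto simp: space_pair_measure\<close>)
qed

lemma (in prob_space) AE_shell_count:
  assumes indep: "indep_vars (\<lambda>_. borel) \<theta> UNIV"
    and unif: "\<And>k. distributed M lborel (\<theta> k)
                (\<lambda>x. indicator {0..2*pi} x / measure lborel {0..2*pi})"
    and rho: "\<And>k. \<rho> k \<in> {0..<1}"
  shows "AE \<omega> in M. \<forall>n. shell_count (random_set \<rho> \<theta> \<omega>) n = radial_count \<rho> n"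
proof -
  have "AE \<omega> in M. \<forall>j k. j \<noteq> k \<longrightarrow> cis (\<theta> k \<omega>) \<noteq> cis (\<theta> j \<omega>)"
    unfolding AE_all_countable using AE_cis_neq[OF indep unif] by auto
  then show ?thesis
  proof (eventually_elim, intro allI)
    fix \<omega> n assume neq: "\<forall>j k. j \<noteq> k \<longrightarrow> cis (\<theta> k \<omega>) \<noteq> cis (\<theta> j \<omega>)"
    define p where "p k = complex_of_real (\<rho> k) * cis (\<theta> k \<omega>)" for k
    define A where "A = {k. \<rho> k \<in> dyadic_shell n \<and> (\<rho> k = 0 \<longrightarrow> (\<forall>j<k. \<rho> j \<noteq> 0))}"
    define B where "B = {x \<in> random_set \<rho> \<theta> \<omega>. norm x \<in> dyadic_shell n}"
    have np: "norm (p k) = \<rho> k" for k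
      using rho[of k] by (simp add: p_def norm_mult)
    have inj: "inj_on p A"
    proof (rule inj_onI)
      fix j k assume jk: "j \<in> A" "k \<in> A" "p j = p k"
      then have r: "\<rho> j = \<rho> k" by (metis np)
      show "j = k"
      proof (cases "\<rho> k = 0")
        case True
        then show ?thesis using jk r unfolding A_def by (metis (mono_tags, lifting) linorder_neqE_nat mem_Collect_eq)
      next
        case False
        then have "cis (\<theta> j \<omega>) = cis (\<theta> k \<omega>)" using jk(3) r by (simp add: p_def)
        then show ?thesis using neq by metis
      qed
    qed
    have "p ` A = B"
    proof
      show "p ` A \<subseteq> B"
        by (auto simp: B_def A_def np) (auto simp: random_set_def p_def)
      show "B \<subseteq> p ` A"
      proof
        fix x assume "x \<in> B"
        then obtain k where k: "x = p k" "\<rho> k \<in> dyadic_shell n"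
          by (auto simp: B_def random_set_def p_def[symmetric] np)
        show "x \<in> p ` A"
        proof (cases "\<rho> k = 0")
          case True
          define m where "m = (LEAST m. \<rho> m = 0)"
          have m: "\<rho> m = 0" unfolding m_def using True by (rule LeastI)
          have "\<forall>j<m. \<rho> j \<noteq> 0" unfolding m_def using not_less_Least by blast
          then have "m \<in> A" using m k True by (auto simp: A_def)
          moreover have "x = p m" using k m True by (simp add: p_def)
          ultimately show ?thesis by blast
        next
          case False
          then show ?thesis using k by (auto simp: A_def)
        qed
      qed
    qed
    then have bij: "bij_betw p A B" using inj by (simp add: bij_betw_def)
    have "emeasure (count_space UNIV) A = emeasure (count_space UNIV) B"
      using bij_betw_finite[OF bij] bij_betw_same_card[OF bij] by (simp add: emeasure_count_space)
    then show "shell_count (random_set \<rho> \<theta> \<omega>) n = radial_count \<rho> n"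
      by (simp add: shell_count_def radial_count_def A_def B_def)
  qed
qed

end

theory Submission
  imports Defs
begin

text \<open>The idea is to study the Gram matrix of the normalized reproducing kernels at the random points. Write \<open>s = 1 - \<alpha>\<close>.

  \<^bold>\<open>Interpolation and Gram matrices.\<close> Expanding in Taylor series, the Dirichlet norm is equivalent to a weighted
  \<open>\<ell>\<^sup>2\<close> norm whose reproducing kernel is \<open>(1 - cnj z * w) powr -s\<close> (\<open>dirichlet_norm_sq_coeff_bounds\<close>). The Gram
  matrix of the normalized kernels is identity plus an off-diagonal part \<open>A\<close>. If \<open>\<parallel>A\<parallel> \<le> 1/2\<close>, it is bounded and
  invertible, and the points are interpolating (\<open>interpolating_of_small_gram\<close>). Adding finitely many points preserves
  interpolation, so it suffices that \<open>A\<close> becomes small on tails; for this it is enough that \<open>A\<^sup>T A\<close> be Hilbert-Schmidt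
  (\<open>interpolating_of_gram_square_summable\<close>).

  \<^bold>\<open>Sufficiency.\<close> An entry of \<open>A\<close> is a product of two radial weights and \<open>|1 - r * cis t| powr -s\<close> with a uniform angle \<open>t\<close>. For
  \<open>\<alpha> < 1/2\<close> the expected squared Hilbert-Schmidt norm of \<open>A\<close> is governed by pairs of points in nearby shells and is at most
  a multiple of \<open>\<Sum>n. 2 powr -n * (N n)\<^sup>2\<close> (\<open>hilbert_schmidt_sum_finite\<close>). For \<open>\<alpha> > 1/2\<close> the squared entries would have
  bounded angular means, but at \<open>\<alpha> = 1/2\<close> these means are logarithmic; looking at the fourth moment instead,
  that is at \<open>A\<^sup>T A\<close>, covers all \<open>\<alpha> \<ge> 1/2\<close> at once under the
  condition that \<open>\<Sum>n. 2 powr (- s * n) * N n\<close> is finite (\<open>AE_gram_square_finite_of_summable\<close>).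

  \<^bold>\<open>Necessity.\<close> Since the constant function \<open>1\<close> is in the space, an interpolating set satisfies
  \<open>\<Sum>(1 - |\<lambda>|\<^sup>2) powr s < \<infinity>\<close>, which is a condition on the radii alone. This settles \<open>\<alpha> \<ge> 1/2\<close>. For \<open>\<alpha> < 1/2\<close>,
  suppose that \<open>\<Sum>n. 2 powr -n * (N n)\<^sup>2\<close> diverges while the previous sum converges. Cut shell \<open>n\<close> into boxes of diameter comparable to
  \<open>2 powr -n\<close>: up to constants the divergent sum is the expected number of pairs sharing a box. These collisions are
  pairwise independent, so by Chebyshev's inequality they do occur, at every scale (\<open>AE_close_pair\<close>), and
  Cauchy's estimate excludes interpolation at points that are too close (\<open>not_interpolating_of_close_pairs\<close>).

  In each range of \<open>\<alpha>\<close> convergence of the sum implies almost sure interpolation and divergence implies almost sure failure. As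
  both events cannot be almost sure, the two equivalences follow.\<close>

section \<open>Area integrals of power series over the disc\<close>

text \<open>Lebesgue measure on \<open>\<complex>\<close> in real coordinates; Tonelli then turns area integrals into iterated
  integrals.\<close>

lemma lborel_complex_eq_distr:
  "(lborel :: complex measure) = distr (lborel \<Otimes>\<^sub>M lborel) borel (\<lambda>p. Complex (fst p) (snd p))"
proof (rule lborel_eqI)
  have meas: "(\<lambda>p::real\<times>real. Complex (fst p) (snd p)) \<in> borel_measurable (lborel \<Otimes>\<^sub>M lborel)"
    by (simp add: borel_measurable_complex_iff)
  fix l u :: complex
  assume lu: "\<And>b. b \<in> Basis \<Longrightarrow> l \<bullet> b \<le> u \<bullet> b"
  have le: "Re l \<le> Re u" "Im l \<le> Im u"
    using lu[of 1] lu[of \<i>] by (auto simp: Basis_complex_def)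
  have eq: "(\<lambda>p. Complex (fst p) (snd p)) -` box l u \<inter> space (lborel \<Otimes>\<^sub>M lborel)
      = {Re l<..<Re u} \<times> {Im l<..<Im u}"
    by (auto simp: box_def Basis_complex_def space_pair_measure)
  have "emeasure (distr (lborel \<Otimes>\<^sub>M lborel) borel (\<lambda>p. Complex (fst p) (snd p))) (box l u)
      = emeasure (lborel \<Otimes>\<^sub>M lborel) ({Re l<..<Re u} \<times> {Im l<..<Im u})"
    by (subst emeasure_distr[OF meas]) (auto simp: eq)
  also have "\<dots> = ennreal (Re u - Re l) * ennreal (Im u - Im l)"
    using le by (subst lborel.emeasure_pair_measure_Times) auto
  also have "\<dots> = ennreal ((Re u - Re l) * (Im u - Im l))"
    using le by (simp add: ennreal_mult)
  also have "(Re u - Re l) * (Im u - Im l) = (\<Prod>b\<in>Basis. (u - l) \<bullet> b)"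
    by (simp add: Basis_complex_def complex_eq_iff)
  finally show "emeasure (distr (lborel \<Otimes>\<^sub>M lborel) borel (\<lambda>p. Complex (fst p) (snd p))) (box l u)
      = ennreal (\<Prod>b\<in>Basis. (u - l) \<bullet> b)" .
qed simp

lemma nn_integral_complex_iterated:
  assumes [measurable]: "h \<in> borel_measurable borel"
  shows "(\<integral>\<^sup>+z. h z \<partial>lborel) = (\<integral>\<^sup>+y. \<integral>\<^sup>+x. h (Complex x y) \<partial>lborel \<partial>lborel)"
    and "(\<integral>\<^sup>+z. h z \<partial>lborel) = (\<integral>\<^sup>+x. \<integral>\<^sup>+y. h (Complex x y) \<partial>lborel \<partial>lborel)"
proof -
  have meas: "(\<lambda>p::real\<times>real. Complex (fst p) (snd p)) \<in> borel_measurable (lborel \<Otimes>\<^sub>M lborel)"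
    by (simp add: borel_measurable_complex_iff)
  then have hm: "(\<lambda>p. h (Complex (fst p) (snd p))) \<in> borel_measurable (lborel \<Otimes>\<^sub>M lborel)"
    by measurable
  have "(\<integral>\<^sup>+z. h z \<partial>lborel) = (\<integral>\<^sup>+p. h (Complex (fst p) (snd p)) \<partial>(lborel \<Otimes>\<^sub>M lborel))"
    by (subst lborel_complex_eq_distr, subst nn_integral_distr[OF meas]) auto
  then show "(\<integral>\<^sup>+z. h z \<partial>lborel) = (\<integral>\<^sup>+y. \<integral>\<^sup>+x. h (Complex x y) \<partial>lborel \<partial>lborel)"
    and "(\<integral>\<^sup>+z. h z \<partial>lborel) = (\<integral>\<^sup>+x. \<integral>\<^sup>+y. h (Complex x y) \<partial>lborel \<partial>lborel)"
    using lborel_pair.nn_integral_snd[OF hm] lborel.nn_integral_fst[OF hm] by simp_all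
qed

lemma nn_integral_shift_real:
  fixes h :: "real \<Rightarrow> ennreal"
  assumes [measurable]: "h \<in> borel_measurable borel"
  shows "(\<integral>\<^sup>+x. h (c + x) \<partial>lborel) = (\<integral>\<^sup>+x. h x \<partial>lborel)"
  by (subst (2) lborel_distr_plus[of c, symmetric], subst nn_integral_distr) auto

text \<open>A shear moves every horizontal (or vertical) line along itself, so after Tonelli only the
  translation invariance of one-dimensional Lebesgue measure is needed.\<close>

lemma nn_integral_shear:
  fixes h :: "complex \<Rightarrow> ennreal"
  assumes h[measurable]: "h \<in> borel_measurable borel"
  shows "(\<integral>\<^sup>+z. h (Complex (a * Im z + Re z) (Im z)) \<partial>lborel) = (\<integral>\<^sup>+z. h z \<partial>lborel)"
    and "(\<integral>\<^sup>+z. h (Complex (Re z) (a * Re z + Im z)) \<partial>lborel) = (\<integral>\<^sup>+z. h z \<partial>lborel)"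
proof -
  have [measurable]: "(\<lambda>x. Complex (f x) (g x)) \<in> borel_measurable borel"
    if "f \<in> borel_measurable borel" "g \<in> borel_measurable borel" for f g :: "'b::topological_space \<Rightarrow> real"
    using that by (simp add: borel_measurable_complex_iff)
  have "(\<integral>\<^sup>+z. h (Complex (a * Im z + Re z) (Im z)) \<partial>lborel)
      = (\<integral>\<^sup>+y. \<integral>\<^sup>+x. h (Complex (a * y + x) y) \<partial>lborel \<partial>lborel)"
    by (subst nn_integral_complex_iterated(1)) auto
  also have "\<dots> = (\<integral>\<^sup>+z. h z \<partial>lborel)"
    by (subst nn_integral_complex_iterated(1), simp) (subst nn_integral_shift_real[of "\<lambda>x. h (Complex x _)"], auto)
  finally show "(\<integral>\<^sup>+z. h (Complex (a * Im z + Re z) (Im z)) \<partial>lborel) = (\<integral>\<^sup>+z. h z \<partial>lborel)" .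
  have "(\<integral>\<^sup>+z. h (Complex (Re z) (a * Re z + Im z)) \<partial>lborel)
      = (\<integral>\<^sup>+x. \<integral>\<^sup>+y. h (Complex x (a * x + y)) \<partial>lborel \<partial>lborel)"
    by (subst nn_integral_complex_iterated(2)) auto
  also have "\<dots> = (\<integral>\<^sup>+z. h z \<partial>lborel)"
    by (subst nn_integral_complex_iterated(2), simp) (subst nn_integral_shift_real[of "\<lambda>x. h (Complex _ x)"], auto)
  finally show "(\<integral>\<^sup>+z. h (Complex (Re z) (a * Re z + Im z)) \<partial>lborel) = (\<integral>\<^sup>+z. h z \<partial>lborel)" .
qed

text \<open>A rotation is a product of three shears,
  with parameters \<open>- tan (t/2)\<close>, \<open>sin t\<close> and \<open>- tan (t/2)\<close>, and each shear preserves area.\<close>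

lemma nn_integral_rotate:
  fixes h :: "complex \<Rightarrow> ennreal"
  assumes h[measurable]: "h \<in> borel_measurable borel"
  shows "(\<integral>\<^sup>+z. h (cis t * z) \<partial>lborel) = (\<integral>\<^sup>+z. h z \<partial>lborel)"
proof -
  have [measurable]: "(\<lambda>x. Complex (f x) (g x)) \<in> borel_measurable borel"
    if "f \<in> borel_measurable borel" "g \<in> borel_measurable borel" for f g :: "complex \<Rightarrow> real"
    using that by (simp add: borel_measurable_complex_iff)
  have main: "(\<integral>\<^sup>+z. g (cis (2 * u) * z) \<partial>lborel) = (\<integral>\<^sup>+z. g z \<partial>lborel)"
    if c: "cos u \<noteq> 0" and [measurable]: "g \<in> borel_measurable borel" for u and g :: "complex \<Rightarrow> ennreal"
  proof -
    define a where "a = - tan u"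
    define b where "b = sin (2 * u)"
    have e1: "1 + a * b = cos (2 * u)"
      using c by (simp add: a_def b_def tan_def sin_double cos_double_sin power2_eq_square)
    have e2: "a * (1 + (1 + a * b)) = - sin (2 * u)"
      using c unfolding e1 by (simp add: a_def tan_def sin_double cos_double_cos power2_eq_square)
    define f1 where "f1 z = Complex (a * Im z + Re z) (Im z)" for z
    define f2 where "f2 z = Complex (Re z) (b * Re z + Im z)" for z
    have [measurable]: "f1 \<in> borel_measurable borel" "f2 \<in> borel_measurable borel"
      unfolding f1_def f2_def by measurable
    have "cis (2 * u) * z = f1 (f2 (f1 z))" for z
    proof -
      have "Re (f1 (f2 (f1 z))) = (1 + a * b) * Re z + a * (1 + (1 + a * b)) * Im z"
        by (simp add: f1_def f2_def algebra_simps)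
      moreover have "Im (f1 (f2 (f1 z))) = b * Re z + (1 + a * b) * Im z"
        by (simp add: f1_def f2_def algebra_simps)
      ultimately show ?thesis
        unfolding e2 unfolding e1 by (simp add: complex_eq_iff b_def)
    qed
    then have "(\<integral>\<^sup>+z. g (cis (2 * u) * z) \<partial>lborel) = (\<integral>\<^sup>+z. g (f1 (f2 (f1 z))) \<partial>lborel)" by simp
    also have "\<dots> = (\<integral>\<^sup>+z. g (f1 (f2 z)) \<partial>lborel)"
      using nn_integral_shear(1)[of "\<lambda>z. g (f1 (f2 z))" a] by (simp add: f1_def)
    also have "\<dots> = (\<integral>\<^sup>+z. g (f1 z) \<partial>lborel)"
      using nn_integral_shear(2)[of "\<lambda>z. g (f1 z)" b] by (simp add: f2_def)
    also have "\<dots> = (\<integral>\<^sup>+z. g z \<partial>lborel)"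
      using nn_integral_shear(1)[of "\<lambda>z. g z" a] by (simp add: f1_def)
    finally show ?thesis .
  qed
  show ?thesis
  proof (cases "cos (t / 2) = 0")
    case False
    then show ?thesis using main[of "t/2" h] by simp
  next
    case True
    \<comment> \<open>For a half turn \<open>tan (t/2)\<close> is infinite; it is composed of two rotations by \<open>t/2\<close>.\<close>
    have "cos (t / 2) = 2 * (cos (t / 4))\<^sup>2 - 1"
      using cos_double_cos[of "t / 4"] by simp
    then have c: "cos (t / 4) \<noteq> 0" using True by auto
    have "(\<integral>\<^sup>+z. h (cis t * z) \<partial>lborel) = (\<integral>\<^sup>+z. h (cis (2 * (t/4)) * (cis (2 * (t/4)) * z)) \<partial>lborel)"
      by (simp add: mult.assoc[symmetric] cis_mult)
    also have "\<dots> = (\<integral>\<^sup>+z. h (cis (2 * (t/4)) * z) \<partial>lborel)"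
      by (rule main[OF c]) measurable
    also have "\<dots> = (\<integral>\<^sup>+z. h z \<partial>lborel)"
      by (rule main[OF c]) measurable
    finally show ?thesis .
  qed
qed

text \<open>The discs \<open>|z|\<^sup>2 \<le> x\<close> have area \<open>pi * x\<close>, so \<open>|z|\<^sup>2\<close> is uniformly
  distributed on \<open>[0,1]\<close>. This replaces polar coordinates: two finite measures on the line with the same
  distribution function are equal.\<close>

lemma nn_integral_disc_radial:
  fixes h :: "real \<Rightarrow> ennreal"
  assumes [measurable]: "h \<in> borel_measurable borel"
  shows "(\<integral>\<^sup>+z\<in>ball 0 1. h ((norm z)\<^sup>2) \<partial>(lborel::complex measure)) = pi * (\<integral>\<^sup>+t\<in>{0..1}. h t \<partial>lborel)"
proof -
  define N where "N = distr (restrict_space lborel (ball (0::complex) 1)) borel (\<lambda>z. (norm z)\<^sup>2)"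
  define R where "R = density lborel (\<lambda>t. ennreal pi * indicator {0..1::real} t)"
  have m: "(\<lambda>z::complex. (norm z)\<^sup>2) \<in> borel_measurable (restrict_space lborel (ball (0::complex) 1))"
    by (rule measurable_restrict_space1) auto
  have ball: "emeasure lborel (ball (0::complex) r) = ennreal (pi * r\<^sup>2)" if "r \<ge> 0" for r
    using emeasure_ball[of r "0::complex"] that by (simp add: unit_ball_vol_2)
  have cball: "emeasure lborel (cball (0::complex) r) = ennreal (pi * r\<^sup>2)" if "r \<ge> 0" for r
    using emeasure_cball[of r "0::complex"] that by (simp add: unit_ball_vol_2)
  have eN: "emeasure N {..x} = ennreal (pi * (if x < 0 then 0 else if x < 1 then x else 1))" for x
  proof -
    have "emeasure N {..x} = emeasure (restrict_space lborel (ball (0::complex) 1))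
        ((\<lambda>z. (norm z)\<^sup>2) -` {..x} \<inter> space (restrict_space lborel (ball (0::complex) 1)))"
      unfolding N_def by (rule emeasure_distr[OF m]) auto
    also have "(\<lambda>z. (norm z)\<^sup>2) -` {..x} \<inter> space (restrict_space lborel (ball (0::complex) 1))
       = {z\<in>ball 0 1. (norm z)\<^sup>2 \<le> x}" by (auto simp: space_restrict_space)
    also have "emeasure (restrict_space lborel (ball (0::complex) 1)) \<dots> = emeasure lborel {z\<in>ball (0::complex) 1. (norm z)\<^sup>2 \<le> x}"
      by (rule emeasure_restrict_space) auto
    also have "{z\<in>ball (0::complex) 1. (norm z)\<^sup>2 \<le> x} =
       (if x < 0 then {} else if x < 1 then cball 0 (sqrt x) else ball 0 1)"
    proof -
      have "norm z < 1" if "x < 1" "norm z \<le> sqrt x" for z :: complex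
        using that real_sqrt_lt_1_iff[of x] by linarith
      moreover have "(norm z)\<^sup>2 \<le> x" if "1 \<le> x" "norm z < 1" for z :: complex
        using that power_le_one[of "norm z" 2] by simp
      moreover have "(norm z)\<^sup>2 \<le> x \<longleftrightarrow> norm z \<le> sqrt x" if "x \<ge> 0" for z :: complex
        using that real_sqrt_le_iff[of "(norm z)\<^sup>2" x] by (simp del: real_sqrt_le_iff)
      moreover have "\<not> (norm z)\<^sup>2 \<le> x" if "x < 0" for z :: complex
        using that zero_le_power2[of "norm z"] by linarith
      ultimately show ?thesis by (auto simp: not_less)
    qed
    also have "emeasure lborel \<dots> = ennreal (pi * (if x < 0 then 0 else if x < 1 then x else 1))"
      using ball[of 1] cball[of "sqrt x"] by simp
    finally show ?thesis .
  qed
  have eR: "emeasure R {..x} = ennreal (pi * (if x < 0 then 0 else if x < 1 then x else 1))" for x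
  proof -
    have "emeasure R {..x} = (\<integral>\<^sup>+t. ennreal pi * indicator {0..1} t * indicator {..x} t \<partial>lborel)"
      unfolding R_def by (subst emeasure_density) auto
    also have "\<dots> = (\<integral>\<^sup>+t. ennreal pi * indicator ({0..1} \<inter> {..x}) t \<partial>lborel)"
      by (intro nn_integral_cong) (auto split: split_indicator)
    also have "\<dots> = ennreal pi * emeasure lborel ({0..1} \<inter> {..x})"
      by (subst nn_integral_cmult_indicator) auto
    also have "{0..1} \<inter> {..x} = (if x < 0 then {} else if x < 1 then {0..x} else {0..1::real})"
      by auto
    finally show ?thesis by (auto simp: ennreal_mult)
  qed
  have fin: "finite_borel_measure N" "finite_borel_measure R"
  proof -
    have "emeasure N UNIV = emeasure (restrict_space lborel (ball (0::complex) 1)) (space (restrict_space lborel (ball (0::complex) 1)))"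
      unfolding N_def by (subst emeasure_distr[OF m]) auto
    also have "\<dots> = emeasure lborel (ball (0::complex) 1)"
      by (subst emeasure_restrict_space) (auto simp: space_restrict_space)
    finally have "emeasure N (space N) \<noteq> \<infinity>"
      using ball[of 1] by (simp add: N_def)
    then show "finite_borel_measure N"
      by (intro finite_borel_measure.intro finite_borel_measure_axioms.intro finite_measureI) (auto simp: N_def)
    have "emeasure R UNIV = (\<integral>\<^sup>+t. ennreal pi * indicator {0..1::real} t \<partial>lborel)"
      unfolding R_def by (subst emeasure_density) auto
    also have "\<dots> = ennreal pi"
      by (subst nn_integral_cmult_indicator) auto
    finally have "emeasure R (space R) \<noteq> \<infinity>"
      by (simp add: R_def)
    then show "finite_borel_measure R"
      by (intro finite_borel_measure.intro finite_borel_measure_axioms.intro finite_measureI) (auto simp: R_def)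
  qed
  have NR: "N = R"
    by (rule cdf_unique'[OF fin]) (auto simp: cdf_def measure_def eN eR fun_eq_iff)
  have "(\<integral>\<^sup>+z\<in>ball 0 1. h ((norm z)\<^sup>2) \<partial>(lborel::complex measure)) = (\<integral>\<^sup>+z. h ((norm z)\<^sup>2) \<partial>restrict_space lborel (ball (0::complex) 1))"
    by (subst nn_integral_restrict_space) auto
  also have "\<dots> = (\<integral>\<^sup>+t. h t \<partial>N)"
    unfolding N_def by (subst nn_integral_distr[OF m]) auto
  also have "\<dots> = (\<integral>\<^sup>+t. ennreal pi * (h t * indicator {0..1} t) \<partial>lborel)"
    unfolding NR R_def by (subst nn_integral_density) (auto simp: mult_ac)
  also have "\<dots> = pi * (\<integral>\<^sup>+t\<in>{0..1}. h t \<partial>lborel)"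
    by (subst nn_integral_cmult) auto
  finally show ?thesis .
qed

lemma has_integral_cis_int:
  fixes m :: int
  shows "((\<lambda>t. cis (of_int m * t)) has_integral (if m = 0 then of_real (2 * pi) else 0)) {0..2*pi}"
proof (cases "m = 0")
  case True
  have "((\<lambda>t::real. 1::complex) has_integral of_real (2 * pi)) {0..2*pi}"
    using has_integral_const_real[of "1::complex" 0 "2*pi"] by (simp add: scaleR_conv_of_real)
  then show ?thesis using True by simp
next
  case False
  have "((\<lambda>t. cis (of_int m * t)) has_integral
      (cis (of_int m * (2 * pi)) / (\<i> * of_int m) - cis (of_int m * 0) / (\<i> * of_int m))) {0..2*pi}"
    by (rule fundamental_theorem_of_calculus)
       (use False in \<open>auto intro!: derivative_eq_intros has_vector_derivative_real_field simp: cis_conv_exp has_real_derivative_iff_has_vector_derivative[symmetric] field_simps\<close>)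
  moreover have "cis (of_int m * (2 * pi)) = 1"
    by (metis cis_multiple_2pi mult.commute Ints_of_int mult.left_commute)
  ultimately show ?thesis using False by simp
qed

text \<open>Expand the square; orthogonality of the characters kills the mixed terms.\<close>

lemma nn_integral_trig_polynomial:
  fixes \<beta> :: "nat \<Rightarrow> complex"
  shows "(\<integral>\<^sup>+t\<in>{0..2*pi}. ennreal ((norm (\<Sum>n<N. \<beta> n * cis (real n * t)))\<^sup>2) \<partial>lborel)
    = ennreal (2 * pi * (\<Sum>n<N. (norm (\<beta> n))\<^sup>2))"
proof -
  let ?g = "\<lambda>t. \<Sum>n<N. \<beta> n * cis (real n * t)"
  have eq: "complex_of_real ((norm (?g t))\<^sup>2) = (\<Sum>n<N. \<Sum>m<N. \<beta> n * cnj (\<beta> m) * cis (of_int (int n - int m) * t))" for t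
  proof -
    have *: "\<beta> n * cis (real n * t) * cnj (\<beta> m * cis (real m * t)) = \<beta> n * cnj (\<beta> m) * cis (of_int (int n - int m) * t)" for n m
    proof -
      have "cis (real n * t) * cnj (cis (real m * t)) = cis (of_int (int n - int m) * t)"
        by (simp add: cis_cnj cis_mult left_diff_distrib)
      then show ?thesis by (metis complex_cnj_mult mult.assoc mult.left_commute)
    qed
    then show ?thesis
      unfolding complex_norm_square cnj_sum sum_product by (intro sum.cong refl *)
  qed
  have "((\<lambda>t. complex_of_real ((norm (?g t))\<^sup>2)) has_integral
      (\<Sum>n<N. \<Sum>m<N. \<beta> n * cnj (\<beta> m) * (if int n - int m = 0 then of_real (2 * pi) else 0))) {0..2*pi}"
    unfolding eq by (intro has_integral_sum has_integral_mult_right has_integral_cis_int) auto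
  also have "(\<Sum>n<N. \<Sum>m<N. \<beta> n * cnj (\<beta> m) * (if int n - int m = 0 then of_real (2 * pi) else 0))
     = (\<Sum>n<N. \<Sum>m<N. if m = n then \<beta> n * cnj (\<beta> m) * of_real (2 * pi) else 0)"
    by (intro sum.cong refl) auto
  also have "\<dots> = complex_of_real (2 * pi * (\<Sum>n<N. (norm (\<beta> n))\<^sup>2))"
    by (simp add: sum.delta' complex_norm_square[symmetric] sum_distrib_left mult.commute flip: of_real_power)
  finally have "((\<lambda>t. Re (complex_of_real ((norm (?g t))\<^sup>2))) has_integral Re (complex_of_real (2 * pi * (\<Sum>n<N. (norm (\<beta> n))\<^sup>2)))) {0..2*pi}"
    by (rule has_integral_Re)
  then have "((\<lambda>t. (norm (?g t))\<^sup>2) has_integral (2 * pi * (\<Sum>n<N. (norm (\<beta> n))\<^sup>2))) {0..2*pi}"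
    unfolding Re_complex_of_real .
  from nn_integral_has_integral_lebesgue[OF _ this]
  have I: "(\<integral>\<^sup>+t. ennreal (indicator {0..2*pi} t * (norm (?g t))\<^sup>2) \<partial>lborel) = ennreal (2 * pi * (\<Sum>n<N. (norm (\<beta> n))\<^sup>2))" by simp
  show ?thesis unfolding I[symmetric]
    by (intro nn_integral_cong) (auto split: split_indicator)
qed

text \<open>Absolute summability bounds all partial sums by one constant, so the identity for
  trigonometric polynomials passes to the limit by dominated convergence.\<close>

lemma parseval:
  fixes \<beta> :: "nat \<Rightarrow> complex"
  assumes sm: "summable (\<lambda>n. norm (\<beta> n))"
  shows "(\<integral>\<^sup>+t\<in>{0..2*pi}. ennreal ((norm (\<Sum>n. \<beta> n * cis (real n * t)))\<^sup>2) \<partial>lborel)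
    = 2 * pi * (\<Sum>n. ennreal ((norm (\<beta> n))\<^sup>2))"
proof -
  define g where "g N t = (\<Sum>n<N. \<beta> n * cis (real n * t))" for N t
  define B where "B = (\<Sum>n. norm (\<beta> n))"
  have smt: "summable (\<lambda>n. \<beta> n * cis (real n * t))" for t
    by (rule summable_norm_cancel) (simp add: norm_mult sm)
  have gm: "g N \<in> borel_measurable borel" for N
    unfolding g_def by (intro borel_measurable_continuous_onI continuous_intros)
  have lim: "(\<lambda>N. g N t) \<longlonglongrightarrow> (\<Sum>n. \<beta> n * cis (real n * t))" for t
    unfolding g_def using smt by (rule summable_LIMSEQ)
  have bnd: "norm (g N t) \<le> B" for N t
  proof -
    have "norm (g N t) \<le> (\<Sum>n<N. norm (\<beta> n))"
      unfolding g_def by (rule order_trans[OF norm_sum]) (simp add: norm_mult)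
    also have "\<dots> \<le> B" unfolding B_def by (rule sum_le_suminf[OF sm]) auto
    finally show ?thesis .
  qed
  have "(\<lambda>N. \<integral>\<^sup>+t. ennreal ((norm (g N t))\<^sup>2) * indicator {0..2*pi} t \<partial>lborel) \<longlonglongrightarrow>
      (\<integral>\<^sup>+t\<in>{0..2*pi}. ennreal ((norm (\<Sum>n. \<beta> n * cis (real n * t)))\<^sup>2) \<partial>lborel)"
  proof (rule nn_integral_dominated_convergence[where w = "\<lambda>t. ennreal (B\<^sup>2) * indicator {0..2*pi} t"])
    show "(\<lambda>t. ennreal ((norm (g N t))\<^sup>2) * indicator {0..2*pi} t) \<in> borel_measurable lborel" for N
      using gm[of N] by measurable
    have "(\<lambda>t. \<Sum>n. \<beta> n * cis (real n * t)) \<in> borel_measurable borel"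
      by (rule borel_measurable_LIMSEQ_metric[OF gm lim])
    then show "(\<lambda>t. ennreal ((norm (\<Sum>n. \<beta> n * cis (real n * t)))\<^sup>2) * indicator {0..2*pi} t) \<in> borel_measurable lborel"
      by measurable
    show "(\<integral>\<^sup>+t. ennreal (B\<^sup>2) * indicator {0..2*pi} t \<partial>lborel) < \<infinity>"
      by (subst nn_integral_cmult_indicator) (auto simp: ennreal_mult_less_top)
    show "AE t in lborel. ennreal ((norm (g N t))\<^sup>2) * indicator {0..2*pi} t \<le> ennreal (B\<^sup>2) * indicator {0..2*pi} t" for N
      by (intro AE_I2 mult_right_mono ennreal_leI power_mono bnd) auto
    show "AE t in lborel. (\<lambda>N. ennreal ((norm (g N t))\<^sup>2) * indicator {0..2*pi} t) \<longlonglongrightarrow>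
      ennreal ((norm (\<Sum>n. \<beta> n * cis (real n * t)))\<^sup>2) * indicator {0..2*pi} t"
      by (intro AE_I2, rename_tac t, case_tac "t \<in> {0..2*pi}")
         (auto intro!: tendsto_ennrealI tendsto_intros lim)
  qed measurable
  moreover have "(\<lambda>N. \<integral>\<^sup>+t. ennreal ((norm (g N t))\<^sup>2) * indicator {0..2*pi} t \<partial>lborel) \<longlonglongrightarrow> 2 * pi * (\<Sum>n. ennreal ((norm (\<beta> n))\<^sup>2))"
  proof -
    have "(\<integral>\<^sup>+t. ennreal ((norm (g N t))\<^sup>2) * indicator {0..2*pi} t \<partial>lborel) = ennreal (2 * pi) * (\<Sum>n<N. ennreal ((norm (\<beta> n))\<^sup>2))" for N
      unfolding g_def nn_integral_trig_polynomial by (subst sum_ennreal) (auto simp: ennreal_mult sum_nonneg)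
    moreover have "(\<lambda>N. ennreal (2 * pi) * (\<Sum>n<N. ennreal ((norm (\<beta> n))\<^sup>2))) \<longlonglongrightarrow> ennreal (2 * pi) * (\<Sum>n. ennreal ((norm (\<beta> n))\<^sup>2))"
      by (intro ennreal_tendsto_cmult summable_LIMSEQ) auto
    ultimately show ?thesis by simp
  qed
  ultimately show ?thesis by (rule LIMSEQ_unique)
qed

text \<open>Since both the weight and the area measure are rotation invariant, the integral does not
  change when the integrand is averaged over all rotations. The average over each circle is given by Parseval, and what
  remains is a radial integral.\<close>

lemma nn_integral_disc_power_series:
  fixes b :: "nat \<Rightarrow> complex" and w :: "real \<Rightarrow> ennreal"
  assumes sm: "\<And>z. norm z < 1 \<Longrightarrow> summable (\<lambda>n. b n * z ^ n)"
    and w[measurable]: "w \<in> borel_measurable borel"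
  shows "(\<integral>\<^sup>+z\<in>ball 0 1. ennreal ((norm (\<Sum>n. b n * z ^ n))\<^sup>2) * w ((norm z)\<^sup>2) \<partial>lborel)
    = pi * (\<Sum>n. ennreal ((norm (b n))\<^sup>2) * (\<integral>\<^sup>+t\<in>{0..1}. ennreal (t ^ n) * w t \<partial>lborel))"
proof -
  define F where "F z = ennreal ((norm (\<Sum>n. b n * z ^ n))\<^sup>2) * w ((norm z)\<^sup>2) * indicator (ball 0 1) z" for z :: complex
  have ball[measurable]: "ball (0::complex) 1 \<in> sets borel" by simp
  have Fm[measurable]: "F \<in> borel_measurable borel" unfolding F_def by measurable
  have Fm2[measurable]: "(\<lambda>(t, z). F (cis t * z)) \<in> borel_measurable (lborel \<Otimes>\<^sub>M lborel)"
  proof -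
    have "(\<lambda>p::real \<times> complex. cis (fst p) * snd p) \<in> borel_measurable borel"
      by (intro borel_measurable_continuous_onI continuous_intros)
    then have "(\<lambda>p::real \<times> complex. cis (fst p) * snd p) \<in> borel_measurable (lborel \<Otimes>\<^sub>M lborel)"
      by (simp add: lborel_prod)
    then show ?thesis by (simp add: case_prod_beta')
  qed
  \<comment> \<open>Average over all rotations.\<close>
  have "2 * pi * (\<integral>\<^sup>+z. F z \<partial>lborel) = (\<integral>\<^sup>+t. (\<integral>\<^sup>+z. F z \<partial>lborel) * indicator {0..2*pi} t \<partial>lborel)"
    by (subst nn_integral_cmult_indicator) (auto simp: mult.commute)
  also have "\<dots> = (\<integral>\<^sup>+t. (\<integral>\<^sup>+z. F (cis t * z) * indicator {0..2*pi} t \<partial>lborel) \<partial>lborel)"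
    by (subst nn_integral_multc) (auto simp: nn_integral_rotate)
  also have "\<dots> = (\<integral>\<^sup>+z. (\<integral>\<^sup>+t. F (cis t * z) * indicator {0..2*pi} t \<partial>lborel) \<partial>lborel)"
    by (rule lborel_pair.Fubini') measurable
  also have "\<dots> = (\<integral>\<^sup>+z. 2 * pi * ((\<Sum>n. ennreal ((norm (b n))\<^sup>2) * ennreal (((norm z)\<^sup>2) ^ n)) * w ((norm z)\<^sup>2) * indicator (ball 0 1) z) \<partial>(lborel::complex measure))"
  proof (rule nn_integral_cong)
    fix z :: complex
    show "(\<integral>\<^sup>+t. F (cis t * z) * indicator {0..2*pi} t \<partial>lborel) =
      2 * pi * ((\<Sum>n. ennreal ((norm (b n))\<^sup>2) * ennreal (((norm z)\<^sup>2) ^ n)) * w ((norm z)\<^sup>2) * indicator (ball 0 1) z)"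
    proof (cases "norm z < 1")
      case True
      define r where "r = (norm z + 1) / 2"
      have r: "norm z < r" "r < 1" "r > 0" using True by (auto simp: r_def intro: add_nonneg_pos)
      have abs: "summable (\<lambda>n. norm (b n * z ^ n))"
        by (rule powser_insidea[of _ "of_real r"]) (use sm r in auto)
      have "(\<integral>\<^sup>+t. F (cis t * z) * indicator {0..2*pi} t \<partial>lborel)
        = (\<integral>\<^sup>+t. w ((norm z)\<^sup>2) * (ennreal ((norm (\<Sum>n. (b n * z ^ n) * cis (real n * t)))\<^sup>2) * indicator {0..2*pi} t) \<partial>lborel)"
      proof (rule nn_integral_cong)
        fix t
        have "(\<lambda>n. b n * (cis t * z) ^ n) = (\<lambda>n. (b n * z ^ n) * cis (real n * t))"
          unfolding power_mult_distrib Complex.DeMoivre by (simp only: mult_ac)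
        then show "F (cis t * z) * indicator {0..2*pi} t =
            w ((norm z)\<^sup>2) * (ennreal ((norm (\<Sum>n. (b n * z ^ n) * cis (real n * t)))\<^sup>2) * indicator {0..2*pi} t)"
          using True by (simp add: F_def norm_mult mult_ac)
      qed
      also have "\<dots> = w ((norm z)\<^sup>2) * (\<integral>\<^sup>+t. (ennreal ((norm (\<Sum>n. (b n * z ^ n) * cis (real n * t)))\<^sup>2) * indicator {0..2*pi} t) \<partial>lborel)"
      proof (rule nn_integral_cmult)
        have [measurable]: "(\<lambda>t. cis (real n * t)) \<in> borel_measurable borel" for n
          by (intro borel_measurable_continuous_onI continuous_intros)
        show "(\<lambda>t. ennreal ((norm (\<Sum>n. b n * z ^ n * cis (real n * t)))\<^sup>2) * indicator {0..2*pi} t) \<in> borel_measurable lborel"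
          by measurable
      qed
      also have "\<dots> = w ((norm z)\<^sup>2) * (2 * pi * (\<Sum>n. ennreal ((norm (b n * z ^ n))\<^sup>2)))"
        by (simp add: parseval[OF abs])
      also have "(\<lambda>n. ennreal ((norm (b n * z ^ n))\<^sup>2)) = (\<lambda>n. ennreal ((norm (b n))\<^sup>2) * ennreal (((norm z)\<^sup>2) ^ n))"
        by (simp add: norm_mult norm_power power_mult_distrib ennreal_mult power_mult[symmetric] mult.commute)
      finally show ?thesis using True by (simp add: mult_ac)
    qed (simp add: F_def norm_mult)
  qed
  also have "\<dots> = 2 * pi * (\<integral>\<^sup>+z\<in>ball 0 1. (\<Sum>n. ennreal ((norm (b n))\<^sup>2) * ennreal (((norm z)\<^sup>2) ^ n)) * w ((norm z)\<^sup>2) \<partial>(lborel::complex measure))"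
    by (rule nn_integral_cmult) measurable
  finally have "(\<integral>\<^sup>+z. F z \<partial>lborel) = (\<integral>\<^sup>+z\<in>ball 0 1. (\<Sum>n. ennreal ((norm (b n))\<^sup>2) * ennreal (((norm z)\<^sup>2) ^ n)) * w ((norm z)\<^sup>2) \<partial>(lborel :: complex measure))"
    by (simp add: ennreal_mult_cancel_left ennreal_mult_eq_top_iff)
  also have "\<dots> = pi * (\<integral>\<^sup>+t\<in>{0..1}. (\<Sum>n. ennreal ((norm (b n))\<^sup>2) * ennreal (t ^ n)) * w t \<partial>lborel)"
    by (rule nn_integral_disc_radial[of "\<lambda>t. (\<Sum>n. ennreal ((norm (b n))\<^sup>2) * ennreal (t ^ n)) * w t"]) measurable
  also have "(\<integral>\<^sup>+t\<in>{0..1}. (\<Sum>n. ennreal ((norm (b n))\<^sup>2) * ennreal (t ^ n)) * w t \<partial>lborel)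
     = (\<integral>\<^sup>+t. (\<Sum>n. ennreal ((norm (b n))\<^sup>2) * (ennreal (t ^ n) * w t * indicator {0..1} t)) \<partial>lborel)"
    by (simp add: mult_ac flip: ennreal_suminf_cmult)
  also have "\<dots> = (\<Sum>n. ennreal ((norm (b n))\<^sup>2) * (\<integral>\<^sup>+t\<in>{0..1}. ennreal (t ^ n) * w t \<partial>lborel))"
    by (subst nn_integral_suminf, measurable) (subst nn_integral_cmult, auto)
  finally show ?thesis by (simp add: F_def)
qed
text \<open>The moments \<open>B(m, s+1)\<close> of the weight are, up to the harmless rational factor on the right,
  the reciprocals of the Taylor coefficients of \<open>(1 - w) powr -s\<close>. This is why
  the kernel \<open>(1 - cnj z * w) powr -s\<close> reproduces an equivalent norm.\<close>

lemma Beta_eq_kernel_coeff: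
  fixes s :: real
  assumes s: "s > 0" and m: "m \<ge> 1"
  shows "(real m)\<^sup>2 * Beta (real m) (s + 1) * (pochhammer s m / fact m) = real m * s / (real m + s)"
  using m
proof (induction m rule: dec_induct)
  case base
  have ns: "s + 1 \<notin> \<int>\<^sub>\<le>\<^sub>0" using s by (auto elim!: nonpos_Ints_cases')
  have "Gamma (1 + (s + 1)) = (s + 1) * Gamma (s + 1)" using Gamma_plus1[OF ns] by (simp add: add.commute)
  moreover have "Gamma (s + 1) > 0" using s by (intro Gamma_real_pos) auto
  ultimately have "Beta 1 (s + 1) = 1 / (s + 1)"
    using s unfolding Beta_def by (simp add: less_imp_neq[symmetric])
  then show ?case using s by (simp add: add.commute)
next
  case (step m)
  define P where "P = Beta (real m) (s + 1) * (pochhammer s m / fact m)"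
  have m: "real m > 0" using step by simp
  have "real m \<notin> \<int>\<^sub>\<le>\<^sub>0" using m by (auto elim!: nonpos_Ints_cases')
  from Beta_plus1_left[OF this, of "s + 1"]
  have B: "Beta (real m + 1) (s + 1) = real m / (real m + s + 1) * Beta (real m) (s + 1)"
    using s m by (simp add: field_simps)
  have ph: "pochhammer s (Suc m) / fact (Suc m) = (pochhammer s m / fact m) * (s + real m) / (real m + 1)"
    by (simp add: pochhammer_Suc field_simps)
  have P: "P = s / (real m * (real m + s))"
  proof -
    have "(real m)\<^sup>2 * P = real m * s / (real m + s)"
      using step.IH by (simp only: P_def mult.assoc)
    then have "P = (real m * s / (real m + s)) / (real m)\<^sup>2"
      using m by (metis nonzero_mult_div_cancel_left power_not_zero less_irrefl)
    then show ?thesis using m by (simp add: power2_eq_square)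
  qed
  have "(real (Suc m))\<^sup>2 * Beta (real (Suc m)) (s + 1) * (pochhammer s (Suc m) / fact (Suc m))
     = (real m + 1)\<^sup>2 * (real m / (real m + s + 1)) * ((s + real m) / (real m + 1)) * P"
    unfolding ph P_def by (simp add: B add.commute[of 1] mult_ac)
  also have "\<dots> = real (Suc m) * s / (real (Suc m) + s)"
    unfolding P using m s by (simp add: divide_simps power2_eq_square) (simp add: algebra_simps)
  finally show ?case .
qed

text \<open>Apply the power series integral to the derivative and evaluate the radial integrals as Beta
  functions. The norm is thus a weighted \<open>\<ell>\<^sup>2\<close> norm of the Taylor coefficients.\<close>

theorem dirichlet_norm_sq_power_series:
  fixes a :: "nat \<Rightarrow> complex"
  assumes s: "0 < 1 - \<alpha>" and f: "\<And>z. norm z < 1 \<Longrightarrow> (\<lambda>n. a n * z ^ n) sums f z"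
  shows "dirichlet_norm_sq \<alpha> f = ennreal ((norm (a 0))\<^sup>2) +
    (\<Sum>n. ennreal ((norm (a (Suc n)))\<^sup>2 * (real (Suc n) * (1 - \<alpha>) / (real (Suc n) + (1 - \<alpha>))) / (pochhammer (1 - \<alpha>) (Suc n) / fact (Suc n))))"
proof -
  define s where "s = 1 - \<alpha>"
  define b where "b n = of_nat (Suc n) * a (Suc n)" for n
  have "s > 0" using assms by (simp add: s_def)
  have b: "(\<lambda>n. b n * z ^ n) sums deriv f z" if z: "norm z < 1" for z
  proof -
    have sm: "\<And>z. norm z < 1 \<Longrightarrow> summable (\<lambda>n. a n * z ^ n)" using f sums_summable by blast
    have "((\<lambda>z. \<Sum>n. a n * z ^ n) has_field_derivative (\<Sum>n. diffs a n * z ^ n)) (at z)"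
      by (rule termdiffs_strong'[OF sm z])
    then have "(f has_field_derivative (\<Sum>n. diffs a n * z ^ n)) (at z)"
      by (rule has_field_derivative_transform_within_open[of _ _ _ "ball 0 1"])
         (use z f in \<open>auto simp: sums_iff\<close>)
    from termdiffs_sums_strong[OF f this z] DERIV_imp_deriv[OF this] show ?thesis
      by (simp add: diffs_def b_def)
  qed
  have [measurable]: "ball (0::complex) 1 \<in> sets borel" by simp
  have "(\<integral>\<^sup>+z\<in>ball 0 1. ennreal ((norm (deriv f z))\<^sup>2 * (1 - (norm z)\<^sup>2) powr s / pi) \<partial>lborel)
     = (\<integral>\<^sup>+z\<in>ball 0 1. ennreal ((norm (\<Sum>n. b n * z ^ n))\<^sup>2) * (\<lambda>t. ennreal ((1 - t) powr s / pi)) ((norm z)\<^sup>2) \<partial>lborel)"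
  proof (rule nn_integral_cong)
    fix z :: complex
    show "ennreal ((norm (deriv f z))\<^sup>2 * (1 - (norm z)\<^sup>2) powr s / pi) * indicator (ball 0 1) z
       = ennreal ((norm (\<Sum>n. b n * z ^ n))\<^sup>2) * (\<lambda>t. ennreal ((1 - t) powr s / pi)) ((norm z)\<^sup>2) * indicator (ball 0 1) z"
      using b[of z] by (auto simp: sums_iff indicator_def ennreal_mult[symmetric])
  qed
  also have "\<dots> = pi * (\<Sum>n. ennreal ((norm (b n))\<^sup>2) * (\<integral>\<^sup>+t\<in>{0..1}. ennreal (t ^ n) * ennreal ((1 - t) powr s / pi) \<partial>lborel))"
    by (rule nn_integral_disc_power_series) (use b in \<open>auto simp: sums_iff\<close>)
  also have "\<dots> = (\<Sum>n. ennreal ((norm (a (Suc n)))\<^sup>2 * (real (Suc n) * s / (real (Suc n) + s)) / (pochhammer s (Suc n) / fact (Suc n))))"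
    unfolding ennreal_suminf_cmult[symmetric]
  proof (rule suminf_cong)
    fix n
    have "((\<lambda>t. t powr (real (Suc n) - 1) * (1 - t) powr ((s + 1) - 1)) has_integral Beta (real (Suc n)) (s + 1)) {0..1}"
      by (rule has_integral_Beta_real) (use \<open>s > 0\<close> in auto)
    then have "((\<lambda>t. 1 / pi * (t powr (real (Suc n) - 1) * (1 - t) powr ((s + 1) - 1))) has_integral 1 / pi * Beta (real (Suc n)) (s + 1)) {0..1}"
      by (rule has_integral_mult_right)
    then have "((\<lambda>t. t ^ n * ((1 - t) powr s / pi)) has_integral 1 / pi * Beta (real (Suc n)) (s + 1)) {0..1}"
      by (rule has_integral_spike[where S = "{0}", rotated 2]) (auto simp: powr_realpow)
    then have I: "((\<lambda>t. t ^ n * ((1 - t) powr s / pi)) has_integral Beta (real (Suc n)) (s + 1) / pi) {0..1}"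
      by simp
    have "(\<integral>\<^sup>+t\<in>{0..1}. ennreal (t ^ n) * ennreal ((1 - t) powr s / pi) \<partial>lborel)
       = (\<integral>\<^sup>+t. ennreal (indicator {0..1} t * (t ^ n * ((1 - t) powr s / pi))) \<partial>lborel)"
      by (intro nn_integral_cong) (auto simp: indicator_def ennreal_mult[symmetric])
    also have "\<dots> = ennreal (Beta (real (Suc n)) (s + 1) / pi)"
      by (rule nn_integral_has_integral_lebesgue[OF _ I]) auto
    finally have J: "(\<integral>\<^sup>+t\<in>{0..1}. ennreal (t ^ n) * ennreal ((1 - t) powr s / pi) \<partial>lborel) = ennreal (Beta (real (Suc n)) (s + 1) / pi)" .
    have Bpos: "Beta (real (Suc n)) (s + 1) \<ge> 0"
      using has_integral_nonneg[OF I] pi_gt_zero by (auto simp: zero_le_divide_iff)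
    have cpos: "pochhammer s (Suc n) / fact (Suc n) > 0"
      using \<open>s > 0\<close> by (intro divide_pos_pos pochhammer_pos) auto
    have "(norm (b n))\<^sup>2 * Beta (real (Suc n)) (s + 1) = (norm (a (Suc n)))\<^sup>2 * ((real (Suc n))\<^sup>2 * Beta (real (Suc n)) (s + 1))"
      by (simp add: b_def norm_mult power_mult_distrib del: of_nat_Suc)
    also have "(real (Suc n))\<^sup>2 * Beta (real (Suc n)) (s + 1) = real (Suc n) * s / (real (Suc n) + s) / (pochhammer s (Suc n) / fact (Suc n))"
      using Beta_eq_kernel_coeff[OF \<open>s > 0\<close>, of "Suc n"] cpos by (subst eq_divide_eq) auto
    finally have K: "(norm (b n))\<^sup>2 * Beta (real (Suc n)) (s + 1) = (norm (a (Suc n)))\<^sup>2 * (real (Suc n) * s / (real (Suc n) + s)) / (pochhammer s (Suc n) / fact (Suc n))"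
      by (simp del: of_nat_Suc)
    show "ennreal pi * (ennreal ((norm (b n))\<^sup>2) * (\<integral>\<^sup>+t\<in>{0..1}. ennreal (t ^ n) * ennreal ((1 - t) powr s / pi) \<partial>lborel))
      = ennreal ((norm (a (Suc n)))\<^sup>2 * (real (Suc n) * s / (real (Suc n) + s)) / (pochhammer s (Suc n) / fact (Suc n)))"
      unfolding J K[symmetric] using Bpos by (simp add: ennreal_mult[symmetric] del: of_nat_Suc)
  qed
  finally show ?thesis
    using f[of 0] by (simp add: dirichlet_norm_sq_def s_def sums_iff)
qed

section \<open>The Dirichlet space as a weighted sequence space\<close>

lemma suminf_ennreal_lt_top_iff:
  fixes f :: "nat \<Rightarrow> real"
  assumes "\<And>n. 0 \<le> f n"
  shows "(\<Sum>n. ennreal (f n)) < \<infinity> \<longleftrightarrow> summable f"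
proof
  assume "(\<Sum>n. ennreal (f n)) < \<infinity>"
  then have "(\<Sum>n. ennreal (f n)) \<noteq> top" by simp
  then show "summable f" by (rule summable_suminf_not_top[OF assms])
next
  assume "summable f"
  then have "(\<Sum>n. ennreal (f n)) \<noteq> top" by (rule ennreal_suminf_neq_top[OF _ assms])
  then show "(\<Sum>n. ennreal (f n)) < \<infinity>" by (simp add: less_top)
qed

lemma suminf_swap_ennreal:
  fixes f :: "nat \<Rightarrow> nat \<Rightarrow> ennreal"
  shows "(\<Sum>i. \<Sum>j. f i j) = (\<Sum>j. \<Sum>i. f i j)"
proof -
  have "(\<Sum>i. \<Sum>j. f i j) = (\<Sum>i. \<integral>\<^sup>+j. f i j \<partial>count_space UNIV)"
    by (simp add: nn_integral_count_space_nat)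
  also have "\<dots> = (\<integral>\<^sup>+j. (\<Sum>i. f i j) \<partial>count_space UNIV)"
    by (rule nn_integral_suminf[symmetric]) simp
  also have "\<dots> = (\<Sum>j. \<Sum>i. f i j)"
    by (simp add: nn_integral_count_space_nat)
  finally show ?thesis .
qed

lemma Cauchy_Schwarz_suminf_ennreal:
  fixes f g :: "nat \<Rightarrow> ennreal"
  shows "(\<Sum>n. f n * g n)\<^sup>2 \<le> (\<Sum>n. (f n)\<^sup>2) * (\<Sum>n. (g n)\<^sup>2)"
  using Cauchy_Schwarz_nn_integral[of f "count_space UNIV" g] by (simp add: nn_integral_count_space_nat)

lemma infsum_nat_eq_suminf:
  fixes g :: "nat \<Rightarrow> 'a :: banach"
  assumes "summable (\<lambda>n. norm (g n))"
  shows "infsum g UNIV = suminf g"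
  by (rule infsumI[OF norm_summable_imp_has_sum[OF assms summable_sums[OF summable_norm_cancel[OF assms]]]])

text \<open>Fubini for double series, in a form where absolute summability is checked by one extended
  nonnegative sum.\<close>

lemma suminf_swap:
  fixes f :: "nat \<Rightarrow> nat \<Rightarrow> complex"
  assumes fin: "(\<Sum>i. \<Sum>j. ennreal (norm (f i j))) < \<infinity>"
  shows "\<And>i. summable (\<lambda>j. norm (f i j))" "\<And>j. summable (\<lambda>i. norm (f i j))"
    and "summable (\<lambda>i. norm (\<Sum>j. f i j))"
    and "(\<Sum>i. \<Sum>j. f i j) = (\<Sum>j. \<Sum>i. f i j)"
proof -
  have rows: "summable (\<lambda>j. norm (g i j))" "summable (\<lambda>i. \<Sum>j. norm (g i j))"
    if fin: "(\<Sum>i. \<Sum>j. ennreal (norm (g i j))) < \<infinity>" for g :: "nat \<Rightarrow> nat \<Rightarrow> complex" and i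
  proof -
    have row: "(\<Sum>j. ennreal (norm (g i j))) < \<infinity>" for i
    proof -
      have "(\<Sum>j. ennreal (norm (g i j))) = (\<Sum>i'\<in>{i}. \<Sum>j. ennreal (norm (g i' j)))" by simp
      also have "\<dots> \<le> (\<Sum>i. \<Sum>j. ennreal (norm (g i j)))" by (rule sum_le_suminf) auto
      finally show ?thesis using fin by (rule le_less_trans)
    qed
    then show s: "summable (\<lambda>j. norm (g i j))" for i
      by (subst suminf_ennreal_lt_top_iff[symmetric]) auto
    have "(\<Sum>j. ennreal (norm (g i j))) = ennreal (\<Sum>j. norm (g i j))" for i
      by (rule suminf_ennreal_eq) (use s in auto)
    then show "summable (\<lambda>i. \<Sum>j. norm (g i j))"
      using fin by (subst suminf_ennreal_lt_top_iff[symmetric]) (auto intro!: suminf_nonneg s)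
  qed
  have fin': "(\<Sum>j. \<Sum>i. ennreal (norm (f i j))) < \<infinity>"
    using fin by (subst suminf_swap_ennreal)
  note r = rows[of f, OF fin] and c = rows[of "\<lambda>j i. f i j", OF fin']
  show "summable (\<lambda>j. norm (f i j))" for i by (rule r)
  show "summable (\<lambda>i. norm (f i j))" for j by (rule c)
  have sr: "summable (\<lambda>i. norm (\<Sum>j. f i j))"
    by (rule summable_comparison_test'[OF r(2)]) (simp add: summable_norm r(1))
  then show "summable (\<lambda>i. norm (\<Sum>j. f i j))" .
  have sc: "summable (\<lambda>j. norm (\<Sum>i. f i j))"
    by (rule summable_comparison_test'[OF c(2)]) (simp add: summable_norm c(1))
  have "Infinite_Sum.abs_summable_on (\<lambda>(i, j). f i j) (UNIV \<times> UNIV)"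
  proof (subst Infinite_Sum.abs_summable_on_Sigma_iff, intro conjI ballI)
    fix i
    show "(\<lambda>j. norm (case (i, j) of (i, j) \<Rightarrow> f i j)) summable_on UNIV"
      unfolding prod.case
      by (rule summable_on_UNIV_nonneg_real_iff[THEN iffD2, OF norm_ge_zero r(1)])
  next
    have "summable (\<lambda>j. norm (norm (f i j)))" for i
      unfolding real_norm_def abs_norm_cancel by (rule r(1))
    from infsum_nat_eq_suminf[OF this]
    have e: "infsum (\<lambda>j. norm (case (i, j) of (i, j) \<Rightarrow> f i j)) UNIV = (\<Sum>j. norm (f i j))" for i
      by simp
    have "0 \<le> (\<Sum>j. norm (f i j))" for i
      by (rule suminf_nonneg[OF r(1)]) simp
    then have "norm (\<Sum>j. norm (f i j)) = (\<Sum>j. norm (f i j))" for i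
      by (simp only: real_norm_def abs_of_nonneg)
    then show "(\<lambda>i. norm (infsum (\<lambda>j. norm (case (i, j) of (i, j) \<Rightarrow> f i j)) UNIV)) summable_on UNIV"
      unfolding e by (simp only: summable_on_UNIV_nonneg_real_iff[OF \<open>\<And>i. 0 \<le> (\<Sum>j. norm (f i j))\<close>] r(2))
  qed
  then have "infsum (\<lambda>i. infsum (\<lambda>j. f i j) UNIV) UNIV = infsum (\<lambda>j. infsum (\<lambda>i. f i j) UNIV) UNIV"
    by (rule infsum_swap_banach[OF Infinite_Sum.abs_summable_summable])
  then have "infsum (\<lambda>i. \<Sum>j. f i j) UNIV = infsum (\<lambda>j. \<Sum>i. f i j) UNIV"
    by (simp only: infsum_nat_eq_suminf[OF r(1)] infsum_nat_eq_suminf[OF c(1)])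
  then show "(\<Sum>i. \<Sum>j. f i j) = (\<Sum>j. \<Sum>i. f i j)"
    by (simp only: infsum_nat_eq_suminf[OF sr] infsum_nat_eq_suminf[OF sc])
qed

text \<open>The Taylor coefficients of \<open>(1 - w) powr -s\<close>.\<close>

definition kernel_coeff :: "real \<Rightarrow> nat \<Rightarrow> real" where
  "kernel_coeff s n = pochhammer s n / fact n"

lemma kernel_coeff_pos: "s > 0 \<Longrightarrow> kernel_coeff s n > 0"
  by (simp add: kernel_coeff_def pochhammer_pos)

lemma kernel_coeff_0 [simp]: "kernel_coeff s 0 = 1"
  by (simp add: kernel_coeff_def)

lemma kernel_coeff_Suc: "kernel_coeff s (Suc n) = kernel_coeff s n * ((s + real n) / real (Suc n))"
  by (simp add: kernel_coeff_def pochhammer_Suc field_simps)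

lemma kernel_coeff_sums:
  fixes w :: complex
  assumes "norm w < 1"
  shows "(\<lambda>n. of_real (kernel_coeff s n) * w ^ n) sums ((1 - w) powr (of_real (- s)))"
proof -
  have "(\<lambda>n. ((of_real (- s)) gchoose n) * (- w) ^ n) sums ((1 + (- w)) powr (of_real (- s)))"
    by (rule gen_binomial_complex) (use assms in simp)
  moreover have "((of_real (- s)) gchoose n) * (- w) ^ n = of_real (kernel_coeff s n) * w ^ n" for n
  proof -
    have "(- w) ^ n = (-1) ^ n * w ^ n" by (rule power_minus)
    moreover have "complex_of_real (pochhammer s n) = pochhammer (of_real s) n"
      by (simp add: pochhammer_of_real)
    ultimately show ?thesis
      by (simp add: gbinomial_pochhammer kernel_coeff_def mult.assoc[symmetric] power_mult_distrib[symmetric])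
  qed
  ultimately show ?thesis by simp
qed

lemma kernel_coeff_sums_real:
  fixes r :: real
  assumes "0 \<le> r" "r < 1"
  shows "(\<lambda>n. kernel_coeff s n * r ^ n) sums ((1 - r) powr (- s))"
proof -
  have "(\<lambda>n. ((- s) gchoose n) * (- r) ^ n) sums ((1 + (- r)) powr (- s))"
    by (rule gen_binomial_real) (use assms in simp)
  moreover have "((- s) gchoose n) * (- r) ^ n = kernel_coeff s n * r ^ n" for n
  proof -
    have "(- r) ^ n = (-1) ^ n * r ^ n" by (rule power_minus)
    then show ?thesis
      by (simp add: gbinomial_pochhammer kernel_coeff_def mult.assoc[symmetric] power_mult_distrib[symmetric])
  qed
  ultimately show ?thesis by simp
qed

text \<open>The square of the norm for which \<open>(1 - cnj z * w) powr -s\<close> is the exact reproducing kernel: pairing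
  with \<open>kernel_coeff s n * cnj z ^ n\<close> in this weighted sequence space gives \<open>\<Sum>n. a n * z ^ n\<close>.\<close>

definition coeff_norm_sq :: "real \<Rightarrow> (nat \<Rightarrow> complex) \<Rightarrow> ennreal" where
  "coeff_norm_sq s a = (\<Sum>n. ennreal ((norm (a n))\<^sup>2 / kernel_coeff s n))"

text \<open>The two weights differ by the factor \<open>m * s / (m + s)\<close> for \<open>m \<ge> 1\<close>, which lies between
  \<open>s / (1 + s)\<close> and \<open>1\<close>.\<close>

lemma dirichlet_norm_sq_coeff_bounds:
  assumes \<alpha>: "\<alpha> < 1" "0 \<le> \<alpha>" and f: "\<And>z. norm z < 1 \<Longrightarrow> (\<lambda>n. a n * z ^ n) sums f z"
  shows "dirichlet_norm_sq \<alpha> f \<le> coeff_norm_sq (1 - \<alpha>) a"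
    and "coeff_norm_sq (1 - \<alpha>) a \<le> ennreal ((2 - \<alpha>) / (1 - \<alpha>)) * dirichlet_norm_sq \<alpha> f"
proof -
  define s where "s = 1 - \<alpha>"
  have s: "0 < s" "s \<le> 1" using \<alpha> by (auto simp: s_def)
  let ?c = "kernel_coeff s"
  define r where "r n = real (Suc n) * s / (real (Suc n) + s)" for n
  have r: "0 \<le> r n" "r n \<le> 1" "1 \<le> (1 + s) / s * r n" for n
  proof -
    show "0 \<le> r n" using s by (simp add: r_def)
    have "real (Suc n) * s \<le> real (Suc n) * 1" using s by (intro mult_left_mono) auto
    also have "\<dots> \<le> real (Suc n) + s" using s by simp
    finally have "real (Suc n) * s \<le> real (Suc n) + s" .
    then show "r n \<le> 1" unfolding r_def using s by (subst divide_le_eq_1_pos) auto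
    have "(1 + s) / s * r n = (1 + s) * real (Suc n) / (real (Suc n) + s)"
      using s by (simp add: r_def del: of_nat_Suc)
    also have "\<dots> \<ge> 1" using s by (simp add: le_divide_eq algebra_simps)
    finally show "1 \<le> (1 + s) / s * r n" .
  qed
  have S: "coeff_norm_sq s a = ennreal ((norm (a 0))\<^sup>2) + (\<Sum>n. ennreal ((norm (a (Suc n)))\<^sup>2 / ?c (Suc n)))"
    using suminf_offset[of "\<lambda>n. ennreal ((norm (a n))\<^sup>2 / ?c n)" 1]
    by (simp add: coeff_norm_sq_def add.commute)
  have N: "dirichlet_norm_sq \<alpha> f = ennreal ((norm (a 0))\<^sup>2) + (\<Sum>n. ennreal (r n * ((norm (a (Suc n)))\<^sup>2 / ?c (Suc n))))"
    using dirichlet_norm_sq_power_series[of \<alpha> a f] f s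
    by (simp add: s_def r_def kernel_coeff_def mult_ac)
  have t: "0 \<le> (norm (a (Suc n)))\<^sup>2 / ?c (Suc n)" for n
    using kernel_coeff_pos[OF s(1), of "Suc n"] by simp
  show "dirichlet_norm_sq \<alpha> f \<le> coeff_norm_sq (1 - \<alpha>) a"
    unfolding s_def[symmetric] N S
    by (intro add_left_mono suminf_le ennreal_leI allI mult_left_le_one_le r t) auto
  have "coeff_norm_sq s a \<le> ennreal ((1 + s) / s) * ennreal ((norm (a 0))\<^sup>2)
      + (\<Sum>n. ennreal ((1 + s) / s) * ennreal (r n * ((norm (a (Suc n)))\<^sup>2 / ?c (Suc n))))"
    unfolding S
  proof (intro add_mono suminf_le allI)
    show "ennreal ((norm (a 0))\<^sup>2) \<le> ennreal ((1 + s) / s) * ennreal ((norm (a 0))\<^sup>2)"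
      using s by (simp add: ennreal_mult[symmetric] divide_simps) (simp add: algebra_simps)
    fix n
    have *: "1 * ((norm (a (Suc n)))\<^sup>2 / ?c (Suc n)) \<le> ((1 + s) / s * r n) * ((norm (a (Suc n)))\<^sup>2 / ?c (Suc n))"
      by (intro mult_right_mono r t)
    show "ennreal ((norm (a (Suc n)))\<^sup>2 / ?c (Suc n)) \<le> ennreal ((1 + s) / s) * ennreal (r n * ((norm (a (Suc n)))\<^sup>2 / ?c (Suc n)))"
    proof -
      have "0 \<le> (1 + s) / s" "0 \<le> r n * ((norm (a (Suc n)))\<^sup>2 / ?c (Suc n))"
        using s r(1)[of n] t[of n] by (auto simp del: times_divide_eq_right)
      then show ?thesis
        using *[unfolded mult_1_left mult.assoc] by (simp only: ennreal_mult[symmetric] ennreal_leI)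
    qed
  qed auto
  also have "\<dots> = ennreal ((1 + s) / s) * dirichlet_norm_sq \<alpha> f"
    unfolding N by (simp add: distrib_left)
  finally show "coeff_norm_sq (1 - \<alpha>) a \<le> ennreal ((2 - \<alpha>) / (1 - \<alpha>)) * dirichlet_norm_sq \<alpha> f"
    by (simp add: s_def)
qed

lemma dirichlet_space_iff_coeffs:
  assumes \<alpha>: "\<alpha> < 1" "0 \<le> \<alpha>"
  shows "f \<in> dirichlet_space \<alpha> \<longleftrightarrow>
    (\<exists>a. (\<forall>z. norm z < 1 \<longrightarrow> (\<lambda>n. a n * z ^ n) sums f z) \<and> coeff_norm_sq (1 - \<alpha>) a < \<infinity>)"
proof
  assume f: "f \<in> dirichlet_space \<alpha>"
  define a where "a n = (deriv ^^ n) f 0 / fact n" for n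
  have "f holomorphic_on ball 0 1" using f by (simp add: dirichlet_space_def)
  then have sums: "(\<lambda>n. a n * z ^ n) sums f z" if "norm z < 1" for z
    using holomorphic_power_series[of f 0 1 z] that by (simp add: a_def)
  have "coeff_norm_sq (1 - \<alpha>) a \<le> ennreal ((2 - \<alpha>) / (1 - \<alpha>)) * dirichlet_norm_sq \<alpha> f"
    by (rule dirichlet_norm_sq_coeff_bounds(2)[OF \<alpha> sums])
  also have "\<dots> < \<infinity>" using f by (simp add: dirichlet_space_def ennreal_mult_less_top)
  finally show "\<exists>a. (\<forall>z. norm z < 1 \<longrightarrow> (\<lambda>n. a n * z ^ n) sums f z) \<and> coeff_norm_sq (1 - \<alpha>) a < \<infinity>"
    using sums by blast
next
  assume "\<exists>a. (\<forall>z. norm z < 1 \<longrightarrow> (\<lambda>n. a n * z ^ n) sums f z) \<and> coeff_norm_sq (1 - \<alpha>) a < \<infinity>"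
  then obtain a where a: "\<And>z. norm z < 1 \<Longrightarrow> (\<lambda>n. a n * z ^ n) sums f z" "coeff_norm_sq (1 - \<alpha>) a < \<infinity>"
    by blast
  have "f holomorphic_on ball 0 1"
    by (rule power_series_holomorphic[of 0 1 a]) (use a in auto)
  moreover have "dirichlet_norm_sq \<alpha> f < \<infinity>"
    using dirichlet_norm_sq_coeff_bounds(1)[OF \<alpha> a(1)] a(2) by (auto intro: le_less_trans)
  ultimately show "f \<in> dirichlet_space \<alpha>" by (simp add: dirichlet_space_def)
qed

lemma coeff_norm_sq_finite_iff:
  assumes "s > 0"
  shows "coeff_norm_sq s a < \<infinity> \<longleftrightarrow> summable (\<lambda>n. (norm (a n))\<^sup>2 / kernel_coeff s n)"
proof -
  have "0 \<le> (norm (a n))\<^sup>2 / kernel_coeff s n" for n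
    using kernel_coeff_pos[OF assms, of n] by simp
  then show ?thesis
    unfolding coeff_norm_sq_def by (rule suminf_ennreal_lt_top_iff)
qed

text \<open>Multiplication by \<open>z - p\<close> shifts the coefficients, and the ratio of one kernel coefficient to the next
  is at most \<open>1 / s\<close>. This is what allows a single point to be added to an interpolating set.\<close>

lemma dirichlet_space_mult_linear:
  assumes \<alpha>: "\<alpha> < 1" "0 \<le> \<alpha>" and f: "f \<in> dirichlet_space \<alpha>"
  shows "(\<lambda>z. (z - p) * f z + c) \<in> dirichlet_space \<alpha>"
proof -
  define s where "s = 1 - \<alpha>"
  have s: "s > 0" "s \<le> 1" using \<alpha> by (auto simp: s_def)
  let ?k = "kernel_coeff s"
  note kpos = kernel_coeff_pos[OF s(1)]
  obtain a where a: "\<And>z. norm z < 1 \<Longrightarrow> (\<lambda>n. a n * z ^ n) sums f z" "coeff_norm_sq s a < \<infinity>"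
    using f unfolding dirichlet_space_iff_coeffs[OF \<alpha>] s_def by blast
  have sm: "summable (\<lambda>n. (norm (a n))\<^sup>2 / ?k n)"
    using a(2) coeff_norm_sq_finite_iff[OF s(1)] by simp
  define b where "b n = (if n = 0 then c else a (n - 1)) - p * a n" for n
  have "(\<lambda>n. b n * z ^ n) sums ((z - p) * f z + c)" if z: "norm z < 1" for z
  proof -
    have "(\<lambda>n. z * (a n * z ^ n)) sums (z * f z)" by (intro sums_mult a z)
    then have "(\<lambda>n. (if Suc n = 0 then c else a (Suc n - 1)) * z ^ Suc n) sums (z * f z)"
      by (simp add: mult_ac)
    then have "(\<lambda>n. (if n = 0 then c else a (n - 1)) * z ^ n) sums (z * f z + (if (0::nat) = 0 then c else a (0 - 1)) * z ^ 0)"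
      by (rule sums_Suc)
    then have "(\<lambda>n. (if n = 0 then c else a (n - 1)) * z ^ n - p * (a n * z ^ n)) sums (z * f z + c - p * f z)"
      using a(1)[OF z] by (intro sums_diff sums_mult) simp_all
    then show ?thesis by (simp add: b_def algebra_simps)
  qed
  moreover have "summable (\<lambda>n. (norm (b n))\<^sup>2 / ?k n)"
  proof -
    have "summable (\<lambda>n. 2 / s * ((norm (a n))\<^sup>2 / ?k n) + 2 * (norm p)\<^sup>2 * ((norm (a (Suc n)))\<^sup>2 / ?k (Suc n)))"
      using sm summable_Suc_iff[of "\<lambda>n. (norm (a n))\<^sup>2 / ?k n"] by (intro summable_add summable_mult) auto
    then have "summable (\<lambda>n. (norm (b (Suc n)))\<^sup>2 / ?k (Suc n))"
    proof (rule summable_comparison_test')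
      fix n
      have q: "?k n * s \<le> ?k (Suc n)"
      proof -
        have "s * real (Suc n) \<le> s + real n" using s by (simp add: algebra_simps mult_left_le_one_le)
        then show ?thesis unfolding kernel_coeff_Suc
          using kpos[of n] by (intro mult_left_mono) (auto simp: le_divide_eq)
      qed
      have "norm (b (Suc n)) \<le> norm (a n) + norm p * norm (a (Suc n))"
        unfolding b_def by (simp add: norm_triangle_ineq4[THEN order_trans] norm_mult)
      then have "(norm (b (Suc n)))\<^sup>2 \<le> (norm (a n) + norm p * norm (a (Suc n)))\<^sup>2"
        by (intro power_mono) auto
      also have "\<dots> \<le> 2 * (norm (a n))\<^sup>2 + 2 * (norm p * norm (a (Suc n)))\<^sup>2"
        using sum_squares_bound[of "norm (a n)" "norm p * norm (a (Suc n))"] by (simp add: power2_sum)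
      finally have "(norm (b (Suc n)))\<^sup>2 / ?k (Suc n) \<le> (2 * (norm (a n))\<^sup>2 + 2 * (norm p * norm (a (Suc n)))\<^sup>2) / ?k (Suc n)"
        using kpos[of "Suc n"] by (intro divide_right_mono) auto
      also have "\<dots> = 2 * (norm (a n))\<^sup>2 / ?k (Suc n) + 2 * (norm p)\<^sup>2 * ((norm (a (Suc n)))\<^sup>2 / ?k (Suc n))"
        by (simp add: add_divide_distrib power_mult_distrib)
      also have "2 * (norm (a n))\<^sup>2 / ?k (Suc n) \<le> 2 * (norm (a n))\<^sup>2 / (?k n * s)"
        using kpos[of n] kpos[of "Suc n"] s q by (intro divide_left_mono) auto
      finally show "norm ((norm (b (Suc n)))\<^sup>2 / ?k (Suc n)) \<le> 2 / s * ((norm (a n))\<^sup>2 / ?k n) + 2 * (norm p)\<^sup>2 * ((norm (a (Suc n)))\<^sup>2 / ?k (Suc n))"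
        using kpos[of "Suc n"] by (simp add: mult_ac)
    qed
    then show ?thesis by (subst (asm) summable_Suc_iff)
  qed
  ultimately show ?thesis
    unfolding dirichlet_space_iff_coeffs[OF \<alpha>] s_def[symmetric] coeff_norm_sq_finite_iff[OF s(1)] by blast
qed

section \<open>Gram matrices of kernels\<close>

text \<open>The squared norm of \<open>\<Sum>k. x k * kernel (z k)\<close> is the quadratic form of the Gram matrix of
  the kernels. Only absolute values of its entries are used later, so they are taken here.\<close>

lemma kernel_combination_norm_le:
  fixes x z :: "nat \<Rightarrow> complex"
  assumes K: "finite K" and s: "s > 0" and z: "\<And>k. norm (z k) < 1"
  shows "(\<Sum>n. ennreal (kernel_coeff s n * (norm (\<Sum>k\<in>K. x k * z k ^ n))\<^sup>2))
    \<le> ennreal (\<Sum>k\<in>K. \<Sum>l\<in>K. norm (x k) * norm (x l) * norm (1 - cnj (z k) * z l) powr (- s))"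
proof -
  let ?c = "kernel_coeff s"
  define V where "V = (\<Sum>k\<in>K. \<Sum>l\<in>K. x k * cnj (x l) * (1 - z k * cnj (z l)) powr of_real (- s))"
  have eq: "complex_of_real (?c n * (norm (\<Sum>k\<in>K. x k * z k ^ n))\<^sup>2)
      = (\<Sum>k\<in>K. \<Sum>l\<in>K. x k * cnj (x l) * (of_real (?c n) * (z k * cnj (z l)) ^ n))" for n
  proof -
    have "complex_of_real (?c n * (norm (\<Sum>k\<in>K. x k * z k ^ n))\<^sup>2)
       = of_real (?c n) * (\<Sum>k\<in>K. \<Sum>l\<in>K. (x k * z k ^ n) * cnj (x l * z l ^ n))"
      by (simp only: of_real_mult complex_norm_square cnj_sum sum_product)
    also have "\<dots> = (\<Sum>k\<in>K. \<Sum>l\<in>K. x k * cnj (x l) * (of_real (?c n) * (z k * cnj (z l)) ^ n))"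
      by (simp add: sum_distrib_left power_mult_distrib mult_ac)
    finally show ?thesis .
  qed
  have "(\<lambda>n. complex_of_real (?c n * (norm (\<Sum>k\<in>K. x k * z k ^ n))\<^sup>2)) sums V"
    unfolding eq V_def
  proof (intro sums_sum sums_mult kernel_coeff_sums)
    fix k l
    show "norm (z k * cnj (z l)) < 1"
      using mult_strict_mono'[of "norm (z k)" 1 "norm (z l)" 1] z by (simp add: norm_mult)
  qed
  then have "(\<lambda>n. Re (complex_of_real (?c n * (norm (\<Sum>k\<in>K. x k * z k ^ n))\<^sup>2))) sums Re V"
    by (rule sums_Re)
  then have "(\<lambda>n. ?c n * (norm (\<Sum>k\<in>K. x k * z k ^ n))\<^sup>2) sums Re V"
    unfolding Re_complex_of_real .
  then have "(\<Sum>n. ennreal (?c n * (norm (\<Sum>k\<in>K. x k * z k ^ n))\<^sup>2)) = ennreal (Re V)"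
    by (intro suminf_ennreal_eq) (use kernel_coeff_pos[OF s] in \<open>auto intro!: mult_nonneg_nonneg simp: less_imp_le\<close>)
  also have "Re V \<le> norm V" by (rule complex_Re_le_cmod)
  also have "norm V \<le> (\<Sum>k\<in>K. \<Sum>l\<in>K. norm (x k * cnj (x l) * (1 - z k * cnj (z l)) powr of_real (- s)))"
    unfolding V_def by (intro sum_norm_le order_trans[OF norm_sum] order_refl)
  also have "\<dots> = (\<Sum>k\<in>K. \<Sum>l\<in>K. norm (x k) * norm (x l) * norm (1 - cnj (z k) * z l) powr (- s))"
  proof (intro sum.cong refl)
    fix k l
    have "norm ((1 - z k * cnj (z l)) powr of_real (- s)) = norm (1 - z k * cnj (z l)) powr (- s)"
      by (subst norm_powr_real_powr') auto
    also have "norm (1 - z k * cnj (z l)) = norm (cnj (1 - z k * cnj (z l)))" by (simp only: complex_mod_cnj)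
    also have "cnj (1 - z k * cnj (z l)) = 1 - cnj (z k) * z l" by simp
    finally show "norm (x k * cnj (x l) * (1 - z k * cnj (z l)) powr of_real (- s))
      = norm (x k) * norm (x l) * norm (1 - cnj (z k) * z l) powr (- s)"
      by (simp only: norm_mult complex_mod_cnj)
  qed
  finally show ?thesis by (simp add: ennreal_leI)
qed

text \<open>The absolute value of an entry of the Gram matrix of the kernels after scaling them by \<open>u\<close>; with
  \<open>u k\<close> the reciprocal of the kernel norm, the diagonal is \<open>1\<close>. Allowing \<open>u k = 0\<close> removes
  a point from the sequence without reindexing.\<close>

definition gram_weight :: "real \<Rightarrow> (nat \<Rightarrow> real) \<Rightarrow> (nat \<Rightarrow> complex) \<Rightarrow> nat \<Rightarrow> nat \<Rightarrow> real" where
  "gram_weight s u z k l = u k * u l * norm (1 - cnj (z k) * z l) powr (- s)"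

text \<open>Duality: test \<open>f\<close> against the kernel combination whose coefficients are the sampled values
  themselves. With \<open>Y\<close> the sum on the left, Cauchy-Schwarz gives \<open>Y\<^sup>2 \<le> \<parallel>f\<parallel>\<^sup>2 * C * Y\<close>.\<close>

lemma bessel_inequality:
  fixes a z :: "nat \<Rightarrow> complex"
  assumes K: "finite K" and s: "s > 0" and z: "\<And>k. norm (z k) < 1" and u: "\<And>k. u k \<ge> 0"
    and C: "C > 0" "\<And>y. (\<And>k. y k \<ge> 0) \<Longrightarrow> (\<Sum>k\<in>K. \<Sum>l\<in>K. y k * y l * gram_weight s u z k l) \<le> C * (\<Sum>k\<in>K. (y k)\<^sup>2)"
    and f: "\<And>w. norm w < 1 \<Longrightarrow> (\<lambda>n. a n * w ^ n) sums f w"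
  shows "ennreal (\<Sum>k\<in>K. (norm (f (z k)))\<^sup>2 * (u k)\<^sup>2) \<le> ennreal C * coeff_norm_sq s a"
proof (cases "coeff_norm_sq s a = \<infinity> \<or> (\<Sum>k\<in>K. (norm (f (z k)))\<^sup>2 * (u k)\<^sup>2) = 0")
  case True
  then show ?thesis
  proof
    assume "coeff_norm_sq s a = \<infinity>"
    moreover have "ennreal C * top = top" using C(1) by (simp add: ennreal_mult_top)
    ultimately show ?thesis by simp
  next
    assume "(\<Sum>k\<in>K. (norm (f (z k)))\<^sup>2 * (u k)\<^sup>2) = 0"
    then show ?thesis by (simp only: ennreal_0 zero_le)
  qed
next
  case False
  let ?c = "kernel_coeff s"
  note cpos = kernel_coeff_pos[OF s]
  define Y where "Y = (\<Sum>k\<in>K. (norm (f (z k)))\<^sup>2 * (u k)\<^sup>2)"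
  define S where "S = enn2real (coeff_norm_sq s a)"
  have S: "coeff_norm_sq s a = ennreal S" "S \<ge> 0" using False by (auto simp: S_def less_top)
  have Y0: "Y \<ge> 0" unfolding Y_def by (intro sum_nonneg) auto
  then have Y: "Y > 0" using False unfolding Y_def[symmetric] by simp
  \<comment> \<open>The test combination: its pairing with \<open>f\<close> is the sum \<open>Y\<close> itself.\<close>
  define x where "x k = cnj (f (z k)) * of_real ((u k)\<^sup>2)" for k
  define e where "e n = (\<Sum>k\<in>K. x k * z k ^ n)" for n
  have "(\<lambda>n. \<Sum>k\<in>K. x k * (a n * z k ^ n)) sums (\<Sum>k\<in>K. x k * f (z k))"
    by (intro sums_sum sums_mult f z)
  moreover have "(\<Sum>k\<in>K. x k * f (z k)) = of_real Y"
    unfolding x_def Y_def of_real_sum of_real_mult complex_norm_square by (intro sum.cong refl) (simp only: mult_ac)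
  moreover have "(\<lambda>n. \<Sum>k\<in>K. x k * (a n * z k ^ n)) = (\<lambda>n. a n * e n)"
    unfolding e_def sum_distrib_left by (simp only: mult_ac)
  ultimately have sm: "(\<lambda>n. a n * e n) sums of_real Y" by simp
  define P where "P = (\<Sum>n. ennreal (norm (a n) / sqrt (?c n)) * ennreal (sqrt (?c n) * norm (e n)))"
  have Pe: "P = (\<Sum>n. ennreal (norm (a n * e n)))"
    unfolding P_def
  proof (rule suminf_cong)
    fix n
    show "ennreal (norm (a n) / sqrt (?c n)) * ennreal (sqrt (?c n) * norm (e n)) = ennreal (norm (a n * e n))"
      using cpos[of n] by (simp add: ennreal_mult[symmetric] norm_mult)
  qed
  have YP: "ennreal Y \<le> P"
  proof (cases "summable (\<lambda>n. norm (a n * e n))")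
    case True
    have "Y = norm (complex_of_real Y)" unfolding norm_of_real using Y0 by (simp only: abs_of_nonneg)
    also have "complex_of_real Y = (\<Sum>n. a n * e n)" by (rule sums_unique[OF sm])
    finally have "Y = norm (\<Sum>n. a n * e n)" .
    also have "\<dots> \<le> (\<Sum>n. norm (a n * e n))" by (rule summable_norm[OF True])
    finally have "ennreal Y \<le> ennreal (\<Sum>n. norm (a n * e n))" by (rule ennreal_leI)
    also have "\<dots> = P" unfolding Pe by (rule suminf_ennreal_eq[symmetric]) (use True in auto)
    finally show ?thesis .
  next
    case False
    then have "P = top" unfolding Pe using summable_suminf_not_top[OF norm_ge_zero, of "\<lambda>n. a n * e n"] by blast
    then show ?thesis by (simp only: top_greatest)
  qed
  define E where "E = (\<Sum>k\<in>K. \<Sum>l\<in>K. norm (x k) * norm (x l) * norm (1 - cnj (z k) * z l) powr (- s))"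
  have "P\<^sup>2 \<le> (\<Sum>n. (ennreal (norm (a n) / sqrt (?c n)))\<^sup>2) * (\<Sum>n. (ennreal (sqrt (?c n) * norm (e n)))\<^sup>2)"
    unfolding P_def by (rule Cauchy_Schwarz_suminf_ennreal)
  also have "(\<Sum>n. (ennreal (norm (a n) / sqrt (?c n)))\<^sup>2) = coeff_norm_sq s a"
    unfolding coeff_norm_sq_def
  proof (rule suminf_cong)
    fix n
    have "0 \<le> norm (a n) / sqrt (?c n)" "(norm (a n) / sqrt (?c n))\<^sup>2 = (norm (a n))\<^sup>2 / ?c n"
      using cpos[of n] by (auto simp: power_divide)
    then show "(ennreal (norm (a n) / sqrt (?c n)))\<^sup>2 = ennreal ((norm (a n))\<^sup>2 / ?c n)"
      by (simp only: ennreal_power)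
  qed
  also have "(\<Sum>n. (ennreal (sqrt (?c n) * norm (e n)))\<^sup>2) = (\<Sum>n. ennreal (?c n * (norm (e n))\<^sup>2))"
  proof (rule suminf_cong)
    fix n
    have "0 \<le> sqrt (?c n) * norm (e n)" "(sqrt (?c n) * norm (e n))\<^sup>2 = ?c n * (norm (e n))\<^sup>2"
      using cpos[of n] by (auto simp: power_mult_distrib)
    then show "(ennreal (sqrt (?c n) * norm (e n)))\<^sup>2 = ennreal (?c n * (norm (e n))\<^sup>2)"
      by (simp only: ennreal_power)
  qed
  also have "\<dots> \<le> ennreal E" unfolding E_def e_def by (rule kernel_combination_norm_le[OF K s z])
  also have "E = (\<Sum>k\<in>K. \<Sum>l\<in>K. (norm (f (z k)) * u k) * (norm (f (z l)) * u l) * gram_weight s u z k l)"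
    unfolding E_def x_def gram_weight_def using u
    by (intro sum.cong refl) (simp add: norm_mult power2_eq_square)
  also have "\<dots> \<le> C * Y"
    using C(2)[of "\<lambda>k. norm (f (z k)) * u k"] u by (simp add: Y_def power_mult_distrib)
  finally have "P\<^sup>2 \<le> coeff_norm_sq s a * ennreal (C * Y)"
    by (simp add: mult_left_mono ennreal_leI)
  then have "(ennreal Y)\<^sup>2 \<le> ennreal S * ennreal (C * Y)"
    using power_mono[OF YP, of 2] S by (auto intro: order_trans)
  then have "Y\<^sup>2 \<le> S * (C * Y)"
    using Y0 S C by (simp add: ennreal_power ennreal_mult[symmetric])
  then have "Y * Y \<le> (C * S) * Y" by (simp add: power2_eq_square mult_ac)
  then have "Y \<le> C * S" using Y by simp
  then show ?thesis unfolding Y_def[symmetric] S using C S by (simp add: ennreal_mult[symmetric] ennreal_leI)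
qed

text \<open>This is Bessel's inequality for a single point.\<close>

lemma growth_bound:
  assumes \<alpha>: "\<alpha> < 1" "0 \<le> \<alpha>" and f: "f \<in> dirichlet_space \<alpha>"
  obtains C where "C \<ge> 0" "\<And>w. norm w < 1 \<Longrightarrow> norm (f w) \<le> C * (1 - (norm w)\<^sup>2) powr (- (1 - \<alpha>) / 2)"
proof -
  define s where "s = 1 - \<alpha>"
  have s: "s > 0" using \<alpha> by (simp add: s_def)
  obtain a where a: "\<And>w. norm w < 1 \<Longrightarrow> (\<lambda>n. a n * w ^ n) sums f w" "coeff_norm_sq s a < \<infinity>"
    using f unfolding dirichlet_space_iff_coeffs[OF \<alpha>] s_def by blast
  define S where "S = enn2real (coeff_norm_sq s a)"
  have S: "coeff_norm_sq s a = ennreal S" "S \<ge> 0" using a(2) by (auto simp: S_def less_top)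
  have "norm (f w) \<le> sqrt S * (1 - (norm w)\<^sup>2) powr (- s / 2)" if w: "norm w < 1" for w
  proof -
    define u where "u = (1 - (norm w)\<^sup>2) powr (s / 2)"
    have pos: "1 - (norm w)\<^sup>2 > 0" using w by (simp add: power_less_one_iff)
    have "1 - cnj w * w = of_real (1 - (norm w)\<^sup>2)"
      by (simp only: of_real_diff of_real_1 complex_norm_square mult.commute)
    then have "norm (1 - cnj w * w) = 1 - (norm w)\<^sup>2" using pos by (simp only: norm_of_real)
    then have g: "gram_weight s (\<lambda>_. u) (\<lambda>_. w) k l = 1" for k l
      using pos by (simp add: gram_weight_def u_def powr_add[symmetric])
    have "ennreal (\<Sum>k\<in>{0::nat}. (norm (f w))\<^sup>2 * u\<^sup>2) \<le> ennreal 1 * coeff_norm_sq s a"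
      by (rule bessel_inequality[where z = "\<lambda>_. w" and u = "\<lambda>_. u", OF _ s _ _ _ _ a(1)])
         (use w g in \<open>auto simp: u_def power2_eq_square\<close>)
    then have "(norm (f w) * u)\<^sup>2 \<le> S" using S by (simp add: power_mult_distrib)
    then have "norm (f w) * u \<le> sqrt S" by (rule real_le_rsqrt)
    moreover have "u > 0" using pos by (simp add: u_def)
    ultimately have "norm (f w) \<le> sqrt S / u" by (simp only: pos_le_divide_eq)
    also have "\<dots> = sqrt S * (1 - (norm w)\<^sup>2) powr (- s / 2)"
      unfolding u_def powr_minus_divide minus_divide_left[symmetric] by simp
    finally show ?thesis .
  qed
  then show thesis using that[of "sqrt S"] S unfolding s_def by auto
qed

text \<open>An \<open>\<ell>\<^sup>2\<close> combination of normalized kernels lies in the space, by the same Gram bound.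
  The coefficients are bounded for finite combinations first and then pass to the limit, as in Fatou's lemma; the
  rearrangement of the double series is licensed by summability of \<open>u\<^sup>2\<close>.\<close>

lemma kernel_synthesis:
  fixes x z :: "nat \<Rightarrow> complex"
  assumes \<alpha>: "\<alpha> < 1" "0 \<le> \<alpha>" and z: "\<And>k. norm (z k) < 1" and u: "\<And>k. u k \<ge> 0" "summable (\<lambda>k. (u k)\<^sup>2)"
    and C: "C \<ge> 0" "\<And>m y. (\<And>k. y k \<ge> 0) \<Longrightarrow> (\<Sum>k<m. \<Sum>l<m. y k * y l * gram_weight (1 - \<alpha>) u z k l) \<le> C * (\<Sum>k<m. (y k)\<^sup>2)"
    and x: "summable (\<lambda>k. (norm (x k))\<^sup>2)"
  defines "f \<equiv> \<lambda>w. (\<Sum>k. x k * of_real (u k) * (1 - cnj (z k) * w) powr of_real (- (1 - \<alpha>)))"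
  shows "f \<in> dirichlet_space \<alpha>"
proof -
  define s where "s = 1 - \<alpha>"
  have s: "s > 0" using \<alpha> by (simp add: s_def)
  let ?c = "kernel_coeff s"
  note cpos = kernel_coeff_pos[OF s]
  have xu: "summable (\<lambda>k. norm (x k) * u k)"
  proof (rule summable_comparison_test')
    show "summable (\<lambda>k. (norm (x k))\<^sup>2 + (u k)\<^sup>2)" by (intro summable_add x u)
    show "norm (norm (x k) * u k) \<le> (norm (x k))\<^sup>2 + (u k)\<^sup>2" for k
    proof -
      have "0 \<le> norm (x k) * u k" using u(1)[of k] by simp
      then show ?thesis
        using sum_squares_bound[of "norm (x k)" "u k"] by simp
    qed
  qed
  define e where "e n = (\<Sum>k. x k * of_real (u k) * cnj (z k) ^ n)" for n
  define a where "a n = of_real (?c n) * e n" for n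
  have sme: "summable (\<lambda>k. norm (x k * of_real (u k) * cnj (z k) ^ n))" for n
  proof (rule summable_comparison_test'[OF xu])
    fix k
    have "norm (z k) ^ n \<le> 1" using z[of k] by (intro power_le_one) auto
    then have "norm (x k) * u k * norm (z k) ^ n \<le> norm (x k) * u k * 1"
      using u(1)[of k] by (intro mult_left_mono) auto
    then show "norm (norm (x k * of_real (u k) * cnj (z k) ^ n)) \<le> norm (x k) * u k"
      using u(1)[of k] by (simp add: norm_mult norm_power)
  qed
  have lim: "(\<lambda>m. \<Sum>k<m. x k * of_real (u k) * cnj (z k) ^ n) \<longlonglongrightarrow> e n" for n
    unfolding e_def by (rule summable_LIMSEQ[OF summable_norm_cancel[OF sme]])
  define X where "X = (\<Sum>k. (norm (x k))\<^sup>2)"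
  have X0: "X \<ge> 0" unfolding X_def by (rule suminf_nonneg[OF x]) auto
  have part: "(\<Sum>n<N. ?c n * (norm (\<Sum>k<m. x k * of_real (u k) * cnj (z k) ^ n))\<^sup>2) \<le> C * X" for N m
  proof -
    let ?v = "\<lambda>n. ?c n * (norm (\<Sum>k<m. x k * of_real (u k) * cnj (z k) ^ n))\<^sup>2"
    have "ennreal (\<Sum>n<N. ?v n) = (\<Sum>n<N. ennreal (?v n))"
      using cpos by (subst sum_ennreal) (auto simp: less_imp_le)
    also have "\<dots> \<le> (\<Sum>n. ennreal (?v n))" by (rule sum_le_suminf) auto
    also have "\<dots> \<le> ennreal (\<Sum>k<m. \<Sum>l<m. norm (x k * of_real (u k)) * norm (x l * of_real (u l)) * norm (1 - cnj (cnj (z k)) * cnj (z l)) powr (- s))"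
      by (rule kernel_combination_norm_le) (use s z in auto)
    also have "(\<Sum>k<m. \<Sum>l<m. norm (x k * of_real (u k)) * norm (x l * of_real (u l)) * norm (1 - cnj (cnj (z k)) * cnj (z l)) powr (- s))
       = (\<Sum>k<m. \<Sum>l<m. norm (x k) * norm (x l) * gram_weight s u z k l)"
    proof (intro sum.cong refl)
      fix k l
      have "norm (1 - cnj (cnj (z k)) * cnj (z l)) = norm (cnj (1 - cnj (cnj (z k)) * cnj (z l)))"
        by (simp only: complex_mod_cnj)
      also have "cnj (1 - cnj (cnj (z k)) * cnj (z l)) = 1 - cnj (z k) * z l" by simp
      finally show "norm (x k * of_real (u k)) * norm (x l * of_real (u l)) * norm (1 - cnj (cnj (z k)) * cnj (z l)) powr (- s)
        = norm (x k) * norm (x l) * gram_weight s u z k l"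
        using u(1) by (simp add: gram_weight_def norm_mult)
    qed
    also have "ennreal \<dots> \<le> ennreal (C * X)"
    proof (rule ennreal_leI)
      have "(\<Sum>k<m. \<Sum>l<m. norm (x k) * norm (x l) * gram_weight s u z k l) \<le> C * (\<Sum>k<m. (norm (x k))\<^sup>2)"
        using C(2)[of "\<lambda>k. norm (x k)" m] by (simp add: s_def)
      also have "(\<Sum>k<m. (norm (x k))\<^sup>2) \<le> X" unfolding X_def by (rule sum_le_suminf[OF x]) auto
      finally show "(\<Sum>k<m. \<Sum>l<m. norm (x k) * norm (x l) * gram_weight s u z k l) \<le> C * X"
        using C(1) by (simp add: mult_left_mono)
    qed
    finally show ?thesis using X0 C(1) by (subst (asm) ennreal_le_iff) auto
  qed
  have "(\<Sum>n<N. ?c n * (norm (e n))\<^sup>2) \<le> C * X" for N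
    by (rule LIMSEQ_le_const2[of "\<lambda>m. \<Sum>n<N. ?c n * (norm (\<Sum>k<m. x k * of_real (u k) * cnj (z k) ^ n))\<^sup>2"])
       (use part in \<open>auto intro!: tendsto_intros lim\<close>)
  then have "summable (\<lambda>n. ?c n * (norm (e n))\<^sup>2)"
    by (intro summableI_nonneg_bounded) (use cpos in \<open>auto simp: less_imp_le\<close>)
  then have "summable (\<lambda>n. (norm (a n))\<^sup>2 / ?c n)"
  proof (rule back_subst[of summable], intro ext)
    fix n
    show "?c n * (norm (e n))\<^sup>2 = (norm (a n))\<^sup>2 / ?c n"
      using cpos[of n] by (simp add: a_def norm_mult power_mult_distrib power2_eq_square)
  qed
  then have fin: "coeff_norm_sq s a < \<infinity>" unfolding coeff_norm_sq_finite_iff[OF s] .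
  have "(\<lambda>n. a n * w ^ n) sums f w" if w: "norm w < 1" for w
  proof -
    define F where "F n k = of_real (?c n) * w ^ n * (x k * of_real (u k) * cnj (z k) ^ n)" for n k
    have F2: "F n k = x k * of_real (u k) * (of_real (?c n) * (cnj (z k) * w) ^ n)" for n k
      unfolding F_def power_mult_distrib by (simp only: mult_ac)
    have Fle: "norm (F n k) \<le> ?c n * norm w ^ n * (norm (x k) * u k)" for n k
    proof -
      have "norm (z k) ^ n \<le> 1" using z[of k] by (intro power_le_one) auto
      then have "?c n * norm w ^ n * (norm (x k) * u k) * norm (z k) ^ n \<le> ?c n * norm w ^ n * (norm (x k) * u k) * 1"
        using u(1)[of k] cpos[of n] by (intro mult_left_mono) auto
      then show ?thesis using u(1)[of k] cpos[of n] by (simp add: F_def norm_mult norm_power mult_ac)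
    qed
    have "(\<Sum>n. \<Sum>k. ennreal (norm (F n k))) \<le> (\<Sum>n. \<Sum>k. ennreal (?c n * norm w ^ n) * ennreal (norm (x k) * u k))"
      using cpos u by (intro suminf_le allI) (auto simp: ennreal_mult[symmetric] less_imp_le intro!: ennreal_leI Fle)
    also have "\<dots> = (\<Sum>n. ennreal (?c n * norm w ^ n)) * (\<Sum>k. ennreal (norm (x k) * u k))"
      by simp
    also have "\<dots> < \<infinity>"
    proof -
      have "(\<Sum>k. ennreal (norm (x k) * u k)) < \<infinity>"
        using xu by (subst suminf_ennreal_lt_top_iff) (auto simp: u)
      moreover have "(\<Sum>n. ennreal (?c n * norm w ^ n)) < \<infinity>"
        using kernel_coeff_sums_real[of "norm w" s] w cpos
        by (subst suminf_ennreal_lt_top_iff) (auto simp: sums_iff less_imp_le)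
      ultimately show ?thesis by (simp add: ennreal_mult_less_top)
    qed
    finally have Ffin: "(\<Sum>n. \<Sum>k. ennreal (norm (F n k))) < \<infinity>" .
    have row: "(\<Sum>k. F n k) = a n * w ^ n" for n
    proof -
      have "(\<Sum>k. F n k) = of_real (?c n) * w ^ n * e n"
        unfolding F_def e_def by (rule suminf_mult[OF summable_norm_cancel[OF sme]])
      then show ?thesis unfolding a_def by (simp only: mult_ac)
    qed
    have col: "(\<Sum>n. F n k) = x k * of_real (u k) * (1 - cnj (z k) * w) powr of_real (- s)" for k
    proof -
      have "norm (cnj (z k) * w) < 1"
        using mult_strict_mono'[of "norm (z k)" 1 "norm w" 1] z w by (simp add: norm_mult)
      from sums_mult[OF kernel_coeff_sums[OF this, of s], of "x k * of_real (u k)"]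
      show ?thesis unfolding F2 by (simp only: sums_iff)
    qed
    have "summable (\<lambda>n. a n * w ^ n)"
      using suminf_swap(3)[OF Ffin] unfolding row by (rule summable_norm_cancel)
    moreover have "(\<Sum>n. a n * w ^ n) = f w"
      using suminf_swap(4)[OF Ffin] unfolding row col f_def s_def .
    ultimately show ?thesis by (simp only: sums_iff)
  qed
  then show ?thesis
    unfolding dirichlet_space_iff_coeffs[OF \<alpha>] using fin unfolding s_def by blast
qed

section \<open>Interpolation from a small Gram matrix\<close>

lemma suminf_ennreal_member_le:
  fixes f :: "nat \<Rightarrow> ennreal"
  shows "f k \<le> (\<Sum>n. f n)"
proof -
  have "f k = (\<Sum>n\<in>{k}. f n)" by simp
  also have "\<dots> \<le> (\<Sum>n. f n)" by (rule sum_le_suminf) auto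
  finally show ?thesis .
qed

lemma ennreal_mult_less_infinity:
  fixes a b :: ennreal
  shows "a < \<infinity> \<Longrightarrow> b < \<infinity> \<Longrightarrow> a * b < \<infinity>"
  by (simp add: ennreal_mult_less_top)

lemma suminf_ennreal_geometric_less_top:
  assumes "0 \<le> q" "q < 1"
  shows "(\<Sum>i. ennreal (q ^ i)) < \<infinity>"
  by (rule suminf_ennreal_lt_top_iff[THEN iffD2]) (use assms in \<open>auto intro: summable_geometric\<close>)

lemma norm_suminf_le_ennreal:
  fixes f :: "nat \<Rightarrow> complex"
  assumes "(\<Sum>n. ennreal (norm (f n))) < \<infinity>"
  shows "summable (\<lambda>n. norm (f n))" "ennreal (norm (suminf f)) \<le> (\<Sum>n. ennreal (norm (f n)))"
proof -
  show sm: "summable (\<lambda>n. norm (f n))"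
    by (rule suminf_ennreal_lt_top_iff[OF norm_ge_zero, THEN iffD1, OF assms])
  have "ennreal (norm (suminf f)) \<le> ennreal (\<Sum>n. norm (f n))"
    by (intro ennreal_leI summable_norm sm)
  also have "\<dots> = (\<Sum>n. ennreal (norm (f n)))"
    by (rule suminf_ennreal_eq[symmetric, OF norm_ge_zero summable_sums[OF sm]])
  finally show "ennreal (norm (suminf f)) \<le> (\<Sum>n. ennreal (norm (f n)))" .
qed

text \<open>The matrix of absolute values has norm at most \<open>1/2\<close> on \<open>\<ell>\<^sup>2\<close>, so \<open>x = \<Sum>i. (- g)\<^sup>i c\<close> solves
  \<open>x + g x = c\<close>. The iterates \<open>v i\<close> satisfy \<open>\<parallel>v i\<parallel>\<^sup>2 \<le> 4 powr -i * \<parallel>c\<parallel>\<^sup>2\<close>; summing them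
  coordinatewise, with no completeness of \<open>\<ell>\<^sup>2\<close>, keeps all sums elementary.\<close>

lemma neumann_solution_ell2:
  fixes g :: "nat \<Rightarrow> nat \<Rightarrow> complex" and c :: "nat \<Rightarrow> complex"
  assumes op: "\<And>y :: nat \<Rightarrow> ennreal.
      (\<Sum>k. (\<Sum>l. ennreal (norm (g k l)) * y l)\<^sup>2) \<le> ennreal (1/4) * (\<Sum>l. (y l)\<^sup>2)"
    and c: "summable (\<lambda>k. (norm (c k))\<^sup>2)"
  obtains x where "summable (\<lambda>k. (norm (x k))\<^sup>2)"
    "\<And>k. summable (\<lambda>l. norm (g k l * x l))" "\<And>k. x k + (\<Sum>l. g k l * x l) = c k"
proof -
  define E where "E v = (\<Sum>k. (ennreal (norm (v k)))\<^sup>2)" for v :: "nat \<Rightarrow> complex"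
  define A where "A v k = (\<Sum>l. g k l * v l)" for v k
  have Efin: "E v < \<infinity> \<longleftrightarrow> summable (\<lambda>k. (norm (v k))\<^sup>2)" for v
    unfolding E_def ennreal_power[OF norm_ge_zero]
    by (rule suminf_ennreal_lt_top_iff) simp
  have rowfin: "(\<Sum>l. ennreal (norm (g k l)) * y l) < \<infinity>" if "(\<Sum>l. (y l)\<^sup>2) < \<infinity>" for k y
  proof -
    have "(\<Sum>l. ennreal (norm (g k l)) * y l)\<^sup>2 \<le> (\<Sum>k. (\<Sum>l. ennreal (norm (g k l)) * y l)\<^sup>2)"
      by (rule suminf_ennreal_member_le)
    also have "\<dots> \<le> ennreal (1/4) * (\<Sum>l. (y l)\<^sup>2)" by (rule op)
    also have "\<dots> < \<infinity>" using that by (simp add: ennreal_mult_less_top)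
    finally have "(\<Sum>l. ennreal (norm (g k l)) * y l)\<^sup>2 < \<infinity>" .
    then show ?thesis
      by (simp only: infinity_ennreal_def power_less_top_ennreal) simp
  qed
  have EA: "E (A v) \<le> ennreal (1/4) * E v" if "E v < \<infinity>" for v
  proof -
    have "E (A v) \<le> (\<Sum>k. (\<Sum>l. ennreal (norm (g k l)) * ennreal (norm (v l)))\<^sup>2)"
      unfolding E_def
    proof (intro suminf_le allI power_mono)
      fix k
      have "(\<Sum>l. ennreal (norm (g k l * v l))) < \<infinity>"
        using rowfin[of "\<lambda>l. ennreal (norm (v l))" k] that unfolding E_def norm_mult ennreal_mult[OF norm_ge_zero norm_ge_zero] by blast
      from norm_suminf_le_ennreal(2)[OF this]
      show "ennreal (norm (A v k)) \<le> (\<Sum>l. ennreal (norm (g k l)) * ennreal (norm (v l)))"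
        unfolding A_def norm_mult ennreal_mult[OF norm_ge_zero norm_ge_zero] .
    qed auto
    also have "\<dots> \<le> ennreal (1/4) * E v" unfolding E_def by (rule op)
    finally show ?thesis .
  qed
  define v where "v i = ((\<lambda>w k. - A w k) ^^ i) c" for i
  have v0: "v 0 = c" and vS: "v (Suc i) k = - A (v i) k" for i k by (simp_all add: v_def)
  have Ec: "E c < \<infinity>" using c Efin by blast
  have Ev: "E (v i) \<le> ennreal ((1/4) ^ i) * E c" for i
  proof (induction i)
    case 0
    then show ?case by (simp add: v0)
  next
    case (Suc i)
    have "ennreal ((1/4) ^ i) * E c < \<infinity>" using Ec by (simp add: ennreal_mult_less_top)
    with Suc have fin: "E (v i) < \<infinity>" by (rule le_less_trans)
    have "E (v (Suc i)) = E (A (v i))" unfolding E_def vS norm_minus_cancel ..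
    also have "\<dots> \<le> ennreal (1/4) * E (v i)" by (rule EA[OF fin])
    also have "\<dots> \<le> ennreal (1/4) * (ennreal ((1/4) ^ i) * E c)" by (rule mult_left_mono[OF Suc]) simp
    also have "\<dots> = ennreal ((1/4) ^ Suc i) * E c"
    proof -
      have "ennreal (1/4) * ennreal ((1/4) ^ i) = ennreal ((1/4) ^ Suc i)"
        by (subst ennreal_mult'[symmetric]) simp_all
      then show ?thesis by (simp only: mult.assoc[symmetric])
    qed
    finally show ?case .
  qed
  define X where "X k = (\<Sum>i. ennreal (norm (v i k)))" for k
  define B where "B = (\<Sum>i. ennreal ((9/16) ^ i)) * ((\<Sum>i. ennreal ((4/9) ^ i)) * E c)"
  have Bfin: "B < \<infinity>"
    unfolding B_def by (intro ennreal_mult_less_infinity Ec suminf_ennreal_geometric_less_top) simp_all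
  have X2: "(X k)\<^sup>2 \<le> (\<Sum>i. ennreal ((9/16) ^ i)) * (\<Sum>i. ennreal ((16/9) ^ i) * (ennreal (norm (v i k)))\<^sup>2)" for k
  proof -
    \<comment> \<open>Any weights \<open>q\<^sup>i\<close> with \<open>1/2 < q < 1\<close> would do: \<open>(3/4)\<^sup>i\<close> is square summable, and
      \<open>(4/3)\<^sup>i * \<parallel>v i\<parallel>\<close> still is, since \<open>16/9 * 1/4 = 4/9\<close>.\<close>
    have a: "X k = (\<Sum>i. ennreal ((3/4) ^ i) * (ennreal ((4/3) ^ i) * ennreal (norm (v i k))))"
      unfolding X_def
    proof (rule suminf_cong)
      fix i
      have "ennreal ((3/4) ^ i) * ennreal ((4/3) ^ i) = ennreal ((3/4 * (4/3)) ^ i)"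
        by (subst ennreal_mult'[symmetric]) (simp_all add: power_mult_distrib[symmetric])
      then show "ennreal (norm (v i k)) = ennreal ((3/4) ^ i) * (ennreal ((4/3) ^ i) * ennreal (norm (v i k)))"
        by (simp add: mult.assoc[symmetric])
    qed
    have b: "(ennreal ((3/4) ^ i))\<^sup>2 = ennreal ((9/16) ^ i)" for i
      by (subst ennreal_power) (simp_all add: power_mult[symmetric] mult.commute[of i 2], simp add: power_mult power2_eq_square)
    have d: "(ennreal ((4/3) ^ i) * ennreal (norm (v i k)))\<^sup>2 = ennreal ((16/9) ^ i) * (ennreal (norm (v i k)))\<^sup>2" for i
    proof -
      have "(ennreal ((4/3) ^ i))\<^sup>2 = ennreal ((16/9) ^ i)"
        by (subst ennreal_power) (simp_all add: power_mult[symmetric] mult.commute[of i 2], simp add: power_mult power2_eq_square)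
      then show ?thesis by (simp only: power_mult_distrib)
    qed
    show ?thesis unfolding a using Cauchy_Schwarz_suminf_ennreal[of "\<lambda>i. ennreal ((3/4) ^ i)" "\<lambda>i. ennreal ((4/3) ^ i) * ennreal (norm (v i k))"]
      unfolding b d .
  qed
  have XB: "(\<Sum>k. (X k)\<^sup>2) \<le> B"
  proof -
    have "(\<Sum>k. (X k)\<^sup>2) \<le> (\<Sum>k. (\<Sum>i. ennreal ((9/16) ^ i)) * (\<Sum>i. ennreal ((16/9) ^ i) * (ennreal (norm (v i k)))\<^sup>2))"
      by (intro suminf_le allI X2) auto
    also have "\<dots> = (\<Sum>i. ennreal ((9/16) ^ i)) * (\<Sum>k. \<Sum>i. ennreal ((16/9) ^ i) * (ennreal (norm (v i k)))\<^sup>2)"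
      by (rule ennreal_suminf_cmult)
    also have "(\<Sum>k. \<Sum>i. ennreal ((16/9) ^ i) * (ennreal (norm (v i k)))\<^sup>2) = (\<Sum>i. ennreal ((16/9) ^ i) * E (v i))"
      unfolding E_def by (subst suminf_swap_ennreal) (simp only: ennreal_suminf_cmult)
    also have "\<dots> \<le> (\<Sum>i. ennreal ((4/9) ^ i) * E c)"
    proof (intro suminf_le allI)
      fix i
      have "ennreal ((16/9) ^ i) * E (v i) \<le> ennreal ((16/9) ^ i) * (ennreal ((1/4) ^ i) * E c)"
        by (rule mult_left_mono[OF Ev]) simp
      also have "\<dots> = ennreal ((4/9) ^ i) * E c"
      proof -
        have "ennreal ((16/9) ^ i) * ennreal ((1/4) ^ i) = ennreal ((4/9) ^ i)"
          by (subst ennreal_mult'[symmetric]) (simp_all add: power_mult_distrib[symmetric])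
        then show ?thesis by (simp only: mult.assoc[symmetric])
      qed
      finally show "ennreal ((16/9) ^ i) * E (v i) \<le> ennreal ((4/9) ^ i) * E c" .
    qed auto
    also have "\<dots> = (\<Sum>i. ennreal ((4/9) ^ i)) * E c" by (rule ennreal_suminf_multc)
    finally show ?thesis unfolding B_def by (simp only: mult_left_mono zero_le)
  qed
  then have Xsq: "(\<Sum>k. (X k)\<^sup>2) < \<infinity>" using Bfin by (rule le_less_trans)
  have Xfin: "X k < \<infinity>" for k
  proof -
    have "(X k)\<^sup>2 < \<infinity>" using Xsq by (rule le_less_trans[OF suminf_ennreal_member_le])
    then show ?thesis
      by (simp only: infinity_ennreal_def power_less_top_ennreal) simp
  qed
  define x where "x k = (\<Sum>i. v i k)" for k
  have smv: "summable (\<lambda>i. norm (v i k))" for k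
    by (rule norm_suminf_le_ennreal(1)[OF Xfin[unfolded X_def]])
  have xX: "ennreal (norm (x k)) \<le> X k" for k
    unfolding x_def X_def by (rule norm_suminf_le_ennreal(2)[OF Xfin[unfolded X_def]])
  have "E x \<le> (\<Sum>k. (X k)\<^sup>2)"
    unfolding E_def by (intro suminf_le allI power_mono xX) auto
  then have "E x < \<infinity>" using Xsq by (rule le_less_trans)
  then have x1: "summable (\<lambda>k. (norm (x k))\<^sup>2)" using Efin by blast
  have F: "(\<Sum>l. \<Sum>i. ennreal (norm (g k l * v i l))) < \<infinity>" for k
    using rowfin[OF Xsq, of k]
    unfolding X_def norm_mult ennreal_mult[OF norm_ge_zero norm_ge_zero] ennreal_suminf_cmult .
  have row: "(\<Sum>i. g k l * v i l) = g k l * x l" for k l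
    unfolding x_def by (rule suminf_mult[OF summable_norm_cancel[OF smv]])
  have x2: "summable (\<lambda>l. norm (g k l * x l))" for k
    using suminf_swap(3)[OF F, of k] unfolding row .
  have x3: "x k + (\<Sum>l. g k l * x l) = c k" for k
  proof -
    have "(\<Sum>l. g k l * x l) = (\<Sum>i. A (v i) k)"
      using suminf_swap(4)[OF F, of k] unfolding row A_def .
    also have "\<dots> = (\<Sum>i. - v (Suc i) k)" by (simp only: vS minus_minus)
    also have "\<dots> = - (\<Sum>i. v (Suc i) k)"
      by (rule suminf_minus, subst summable_Suc_iff) (rule summable_norm_cancel[OF smv])
    also have "(\<Sum>i. v (Suc i) k) = x k - c k"
      using suminf_split_head[OF summable_norm_cancel[OF smv[of k]]] by (simp only: x_def v0)
    finally show ?thesis by simp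
  qed
  show thesis by (rule that[OF x1 x2 x3])
qed

lemma kernel_norm_eq:
  assumes "norm z < 1"
  shows "kernel_norm \<alpha> z = (1 - (norm z)\<^sup>2) powr (- (1 - \<alpha>) / 2)"
proof -
  have pos: "1 - (norm z)\<^sup>2 > 0" using assms by (simp add: power_less_one_iff)
  have "kernel_norm \<alpha> z = sqrt ((1 - (norm z)\<^sup>2) powr (- (1 - \<alpha>)))"
    using assms by (simp add: kernel_norm_def dirichlet_kernel_diag)
  also have "\<dots> = (1 - (norm z)\<^sup>2) powr (- (1 - \<alpha>) / 2)"
    using pos by (simp add: powr_half_sqrt[symmetric] powr_powr)
  finally show ?thesis .
qed

lemma summable_on_iff_summable_nat:
  fixes f :: "nat \<Rightarrow> real"
  assumes "\<And>k. 0 \<le> f k"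
  shows "f summable_on I \<longleftrightarrow> summable (\<lambda>k. if k \<in> I then f k else 0)"
proof -
  have "f summable_on I \<longleftrightarrow> (\<lambda>k. if k \<in> I then f k else 0) summable_on UNIV"
    by (rule summable_on_cong_neutral) auto
  also have "\<dots> \<longleftrightarrow> summable (\<lambda>k. if k \<in> I then f k else 0)"
    by (rule summable_on_UNIV_nonneg_real_iff) (use assms in auto)
  finally show ?thesis .
qed

text \<open>Cauchy-Schwarz applied to \<open>\<langle>y, a y\<rangle>\<close>, with \<open>y\<close> cut off outside \<open>K\<close>.\<close>

lemma quadratic_form_le_of_operator_bound:
  fixes a :: "nat \<Rightarrow> nat \<Rightarrow> real"
  assumes a: "\<And>k l. 0 \<le> a k l" and K: "finite K"
    and op: "\<And>y :: nat \<Rightarrow> ennreal. (\<Sum>k. (\<Sum>l. ennreal (a k l) * y l)\<^sup>2) \<le> ennreal (1/4) * (\<Sum>l. (y l)\<^sup>2)"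
    and y: "\<And>k. 0 \<le> y k"
  shows "(\<Sum>k\<in>K. \<Sum>l\<in>K. y k * y l * a k l) \<le> 1/2 * (\<Sum>k\<in>K. (y k)\<^sup>2)"
proof -
  define w where "w k = (if k \<in> K then ennreal (y k) else 0)" for k
  define R where "R = (\<Sum>k\<in>K. \<Sum>l\<in>K. y k * y l * a k l)"
  define Y where "Y = (\<Sum>k\<in>K. (y k)\<^sup>2)"
  have R0: "R \<ge> 0" and Y0: "Y \<ge> 0" unfolding R_def Y_def using a y by (auto intro!: sum_nonneg)
  have w2: "(\<Sum>k. (w k)\<^sup>2) = ennreal Y"
  proof -
    have "(\<Sum>k. (w k)\<^sup>2) = (\<Sum>k\<in>K. (w k)\<^sup>2)"
      by (rule suminf_finite[OF K]) (simp add: w_def)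
    also have "\<dots> = (\<Sum>k\<in>K. ennreal ((y k)\<^sup>2))"
      by (rule sum.cong) (simp_all add: w_def ennreal_power y)
    also have "\<dots> = ennreal Y" unfolding Y_def by (rule sum_ennreal) simp
    finally show ?thesis .
  qed
  have inner: "(\<Sum>l. ennreal (a k l) * w l) = ennreal (\<Sum>l\<in>K. a k l * y l)" for k
  proof -
    have "(\<Sum>l. ennreal (a k l) * w l) = (\<Sum>l\<in>K. ennreal (a k l) * w l)"
      by (rule suminf_finite[OF K]) (simp add: w_def)
    also have "\<dots> = (\<Sum>l\<in>K. ennreal (a k l * y l))"
      by (rule sum.cong) (simp_all add: w_def ennreal_mult a y)
    also have "\<dots> = ennreal (\<Sum>l\<in>K. a k l * y l)" by (rule sum_ennreal) (simp add: a y)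
    finally show ?thesis .
  qed
  have RS: "ennreal R = (\<Sum>k. w k * (\<Sum>l. ennreal (a k l) * w l))"
  proof -
    have "(\<Sum>k. w k * (\<Sum>l. ennreal (a k l) * w l)) = (\<Sum>k\<in>K. w k * (\<Sum>l. ennreal (a k l) * w l))"
      by (rule suminf_finite[OF K]) (simp add: w_def)
    also have "\<dots> = (\<Sum>k\<in>K. ennreal (y k * (\<Sum>l\<in>K. a k l * y l)))"
      unfolding inner by (rule sum.cong) (simp_all add: w_def ennreal_mult a y sum_nonneg)
    also have "\<dots> = ennreal (\<Sum>k\<in>K. y k * (\<Sum>l\<in>K. a k l * y l))"
      by (rule sum_ennreal) (simp add: a y sum_nonneg)
    also have "(\<Sum>k\<in>K. y k * (\<Sum>l\<in>K. a k l * y l)) = R"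
      unfolding R_def sum_distrib_left by (intro sum.cong refl) (simp only: mult_ac)
    finally show ?thesis ..
  qed
  have "(ennreal R)\<^sup>2 \<le> (\<Sum>k. (w k)\<^sup>2) * (\<Sum>k. (\<Sum>l. ennreal (a k l) * w l)\<^sup>2)"
    unfolding RS by (rule Cauchy_Schwarz_suminf_ennreal)
  also have "\<dots> \<le> (\<Sum>k. (w k)\<^sup>2) * (ennreal (1/4) * (\<Sum>l. (w l)\<^sup>2))"
    by (intro mult_left_mono op) simp
  also have "\<dots> = ennreal ((1/2 * Y)\<^sup>2)"
    unfolding w2 using Y0 by (simp add: ennreal_mult[symmetric] power2_eq_square)
  finally have "ennreal (R\<^sup>2) \<le> ennreal ((1/2 * Y)\<^sup>2)"
    unfolding ennreal_power[OF R0] .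
  then have "R\<^sup>2 \<le> (1/2 * Y)\<^sup>2" by (subst (asm) ennreal_le_iff) simp_all
  then have "R \<le> 1/2 * Y" by (rule power2_le_imp_le) (use Y0 in simp)
  then show ?thesis unfolding R_def Y_def .
qed

text \<open>Write the Gram matrix of the normalized kernels as identity plus \<open>A\<close> with \<open>\<parallel>A\<parallel> \<le> 1/2\<close>. Its
  boundedness gives Bessel's inequality, hence the restriction map lands in \<open>\<ell>\<^sup>2\<close>; its invertibility, through the
  Neumann series, produces coefficients \<open>x\<close> for which the kernel combination takes the prescribed values.\<close>

theorem interpolating_of_small_gram:
  fixes z :: "nat \<Rightarrow> complex"
  assumes \<alpha>: "\<alpha> < 1" "0 \<le> \<alpha>" and z: "\<And>k. norm (z k) < 1" and inj: "inj_on z I"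
  defines "u \<equiv> \<lambda>k. if k \<in> I then (1 - (norm (z k))\<^sup>2) powr ((1 - \<alpha>) / 2) else 0"
  assumes u2: "summable (\<lambda>k. (u k)\<^sup>2)"
    and op: "\<And>y :: nat \<Rightarrow> ennreal.
      (\<Sum>k. (\<Sum>l. ennreal (if k = l then 0 else gram_weight (1 - \<alpha>) u z k l) * y l)\<^sup>2) \<le> ennreal (1/4) * (\<Sum>l. (y l)\<^sup>2)"
  shows "interpolating \<alpha> (z ` I)"
proof -
  define s where "s = 1 - \<alpha>"
  have s: "s > 0" using \<alpha> by (simp add: s_def)
  have u0: "u k \<ge> 0" for k by (simp add: u_def)
  have pos: "1 - (norm (z k))\<^sup>2 > 0" for k using z[of k] by (simp add: power_less_one_iff)
  define a where "a k l = (if k = l then 0 else gram_weight s u z k l)" for k l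
  have a0: "a k l \<ge> 0" for k l using u0 by (simp add: a_def gram_weight_def)
  have diag: "u k * u k * (1 - cnj (z k) * z k) powr of_real (- s) = (if k \<in> I then 1 else 0)" for k
  proof -
    have "1 - cnj (z k) * z k = of_real (1 - (norm (z k))\<^sup>2)"
      by (simp only: of_real_diff of_real_1 complex_norm_square mult.commute)
    then have "(1 - cnj (z k) * z k) powr of_real (- s) = of_real ((1 - (norm (z k))\<^sup>2) powr (- s))"
      using pos[of k] by (simp only: powr_of_real less_imp_le)
    moreover have "k \<in> I \<Longrightarrow> u k * u k * (1 - (norm (z k))\<^sup>2) powr (- s) = 1"
      using pos[of k] by (simp add: u_def s_def powr_add[symmetric])
    ultimately show ?thesis
      by (cases "k \<in> I") (simp_all add: u_def flip: of_real_mult)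
  qed
  have nd: "norm (u k * u l * (1 - cnj (z l) * z k) powr of_real (- s)) = gram_weight s u z k l" for k l
  proof -
    have "norm (1 - cnj (z l) * z k) = norm (cnj (1 - cnj (z l) * z k))" by (simp only: complex_mod_cnj)
    also have "cnj (1 - cnj (z l) * z k) = 1 - cnj (z k) * z l" by simp
    finally have "norm ((1 - cnj (z l) * z k) powr of_real (- s)) = norm (1 - cnj (z k) * z l) powr (- s)"
      by (subst norm_powr_real_powr') auto
    then show ?thesis using u0 by (simp add: gram_weight_def norm_mult)
  qed
  have gdiag: "gram_weight s u z k k \<le> 1" for k
    unfolding nd[symmetric] diag by simp
  have C: "(\<Sum>k\<in>K. \<Sum>l\<in>K. y k * y l * gram_weight s u z k l) \<le> 2 * (\<Sum>k\<in>K. (y k)\<^sup>2)"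
    if y: "\<And>k. y k \<ge> 0" and K: "finite K" for y and K :: "nat set"
  proof -
    have "(\<Sum>k\<in>K. \<Sum>l\<in>K. y k * y l * gram_weight s u z k l)
       \<le> (\<Sum>k\<in>K. \<Sum>l\<in>K. y k * y l * a k l + (if l = k then (y k)\<^sup>2 else 0))"
    proof (intro sum_mono)
      fix k l
      have "(y k)\<^sup>2 * gram_weight s u z k k \<le> (y k)\<^sup>2 * 1" by (intro mult_left_mono gdiag) simp
      then show "y k * y l * gram_weight s u z k l \<le> y k * y l * a k l + (if l = k then (y k)\<^sup>2 else 0)"
        by (auto simp: a_def power2_eq_square)
    qed
    also have "\<dots> = (\<Sum>k\<in>K. \<Sum>l\<in>K. y k * y l * a k l) + (\<Sum>k\<in>K. (y k)\<^sup>2)"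
      using K by (simp add: sum.distrib)
    also have "(\<Sum>k\<in>K. \<Sum>l\<in>K. y k * y l * a k l) \<le> 1/2 * (\<Sum>k\<in>K. (y k)\<^sup>2)"
      by (rule quadratic_form_le_of_operator_bound[OF a0 K _ y]) (use op in \<open>simp only: a_def s_def\<close>)
    also have "1/2 * (\<Sum>k\<in>K. (y k)\<^sup>2) + (\<Sum>k\<in>K. (y k)\<^sup>2) \<le> 2 * (\<Sum>k\<in>K. (y k)\<^sup>2)"
      using sum_nonneg[of K "\<lambda>k. (y k)\<^sup>2"] by simp
    finally show ?thesis by simp
  qed
  have kn: "f (z k) / of_real (kernel_norm \<alpha> (z k)) = of_real (u k) * f (z k)" if "k \<in> I" for f :: "complex \<Rightarrow> complex" and k
  proof -
    have "(1 - (norm (z k))\<^sup>2) powr (- (1 - \<alpha>) / 2) * u k = 1"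
      using that pos[of k] by (simp add: u_def powr_add[symmetric] add_divide_distrib[symmetric])
    then have "kernel_norm \<alpha> (z k) * u k = 1" using kernel_norm_eq[OF z] by simp
    then have "u k = 1 / kernel_norm \<alpha> (z k)" by (metis mult_eq_0_iff nonzero_mult_div_cancel_left zero_neq_one)
    then show ?thesis by (simp add: divide_inverse mult.commute)
  qed
  have "restriction_map \<alpha> (z ` I) f \<in> ell2_on (z ` I)" if f: "f \<in> dirichlet_space \<alpha>" for f
  proof -
    obtain b where b: "\<And>w. norm w < 1 \<Longrightarrow> (\<lambda>n. b n * w ^ n) sums f w" "coeff_norm_sq s b < \<infinity>"
      using f unfolding dirichlet_space_iff_coeffs[OF \<alpha>] s_def by blast
    define S where "S = enn2real (coeff_norm_sq s b)"
    have S: "coeff_norm_sq s b = ennreal S" "S \<ge> 0" using b(2) by (auto simp: S_def less_top)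
    have "(\<Sum>k<m. (norm (f (z k)))\<^sup>2 * (u k)\<^sup>2) \<le> 2 * S" for m
    proof -
      have "ennreal (\<Sum>k<m. (norm (f (z k)))\<^sup>2 * (u k)\<^sup>2) \<le> ennreal 2 * coeff_norm_sq s b"
        by (rule bessel_inequality[OF _ s z u0 _ C b(1)]) auto
      also have "\<dots> = ennreal (2 * S)" unfolding S(1) using S(2) by (simp add: ennreal_mult)
      finally show ?thesis using S(2) by (subst (asm) ennreal_le_iff) auto
    qed
    then have "summable (\<lambda>k. (norm (f (z k)))\<^sup>2 * (u k)\<^sup>2)"
      by (intro summableI_nonneg_bounded) auto
    also have "(\<lambda>k. (norm (f (z k)))\<^sup>2 * (u k)\<^sup>2) = (\<lambda>k. if k \<in> I then (norm (f (z k) / of_real (kernel_norm \<alpha> (z k))))\<^sup>2 else 0)"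
    proof
      fix k
      show "(norm (f (z k)))\<^sup>2 * (u k)\<^sup>2 = (if k \<in> I then (norm (f (z k) / of_real (kernel_norm \<alpha> (z k))))\<^sup>2 else 0)"
      proof (cases "k \<in> I")
        case True
        then show ?thesis unfolding kn[OF True] using u0[of k] by (simp add: norm_mult power_mult_distrib)
      qed (simp add: u_def)
    qed
    finally have "(\<lambda>k. (norm (f (z k) / of_real (kernel_norm \<alpha> (z k))))\<^sup>2) summable_on I"
      by (subst summable_on_iff_summable_nat) auto
    then have "(\<lambda>x. (norm (f x / of_real (kernel_norm \<alpha> x)))\<^sup>2) summable_on (z ` I)"
      by (subst summable_on_reindex[OF inj]) (simp add: comp_def)
    then have "(\<lambda>x. (norm (restriction_map \<alpha> (z ` I) f x))\<^sup>2) summable_on (z ` I)"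
      by (rule summable_on_cong[THEN iffD1, rotated]) (simp add: restriction_map_def)
    then show ?thesis by (simp add: ell2_on_def restriction_map_def)
  qed
  moreover have "\<exists>f\<in>dirichlet_space \<alpha>. c = restriction_map \<alpha> (z ` I) f" if c: "c \<in> ell2_on (z ` I)" for c
  proof -
    define c' where "c' k = (if k \<in> I then c (z k) else 0)" for k
    have "(\<lambda>x. (norm (c x))\<^sup>2) summable_on (z ` I)" using c by (simp add: ell2_on_def)
    then have "(\<lambda>k. (norm (c (z k)))\<^sup>2) summable_on I"
      by (subst (asm) summable_on_reindex[OF inj]) (simp add: comp_def)
    then have "summable (\<lambda>k. if k \<in> I then (norm (c (z k)))\<^sup>2 else 0)"
      by (subst (asm) summable_on_iff_summable_nat) auto
    also have "(\<lambda>k. if k \<in> I then (norm (c (z k)))\<^sup>2 else 0) = (\<lambda>k. (norm (c' k))\<^sup>2)"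
      by (auto simp: c'_def)
    finally have c'2: "summable (\<lambda>k. (norm (c' k))\<^sup>2)" .
    define g where "g k l = (if k = l then 0 else u k * u l * (1 - cnj (z l) * z k) powr of_real (- s))" for k l
    have ng: "norm (g k l) = (if k = l then 0 else gram_weight s u z k l)" for k l
      unfolding g_def using nd[of k l] by simp
    have op': "(\<Sum>k. (\<Sum>l. ennreal (norm (g k l)) * y l)\<^sup>2) \<le> ennreal (1/4) * (\<Sum>l. (y l)\<^sup>2)"
      for y :: "nat \<Rightarrow> ennreal"
      unfolding ng s_def by (rule op)
    obtain x where x: "summable (\<lambda>k. (norm (x k))\<^sup>2)" "\<And>k. summable (\<lambda>l. norm (g k l * x l))"
      "\<And>k. x k + (\<Sum>l. g k l * x l) = c' k"
      by (rule neumann_solution_ell2[OF op' c'2]) (rule that)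
    define f where "f w = (\<Sum>k. x k * of_real (u k) * (1 - cnj (z k) * w) powr of_real (- (1 - \<alpha>)))" for w
    have f: "f \<in> dirichlet_space \<alpha>"
      unfolding f_def
      by (rule kernel_synthesis[OF \<alpha> z u0 u2 _ _ x(1), of 2]) (use C in \<open>auto simp: s_def\<close>)
    have val: "of_real (u j) * f (z j) = c (z j)" if j: "j \<in> I" for j
    proof -
      have uj: "u j \<noteq> 0" using j pos[of j] by (simp add: u_def)
      have "(\<lambda>k. g j k * x k) sums (\<Sum>k. g j k * x k)"
        by (rule summable_sums[OF summable_norm_cancel[OF x(2)]])
      moreover have "(\<lambda>k. if k = j then x k else 0) sums x j" by (rule sums_single)
      ultimately have "(\<lambda>k. (if k = j then x k else 0) + g j k * x k) sums c' j"
        using sums_add[of "\<lambda>k. if k = j then x k else 0" "x j"] unfolding x(3)[of j, symmetric] by blast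
      moreover have "(if k = j then x k else 0) + g j k * x k
         = of_real (u j) * (x k * of_real (u k) * (1 - cnj (z k) * z j) powr of_real (- (1 - \<alpha>)))" for k
      proof (cases "k = j")
        case True
        have "of_real (u j) * (x j * of_real (u j) * (1 - cnj (z j) * z j) powr of_real (- (1 - \<alpha>)))
          = x j * (u j * u j * (1 - cnj (z j) * z j) powr of_real (- s))"
          unfolding s_def by (simp only: mult_ac of_real_mult)
        then show ?thesis unfolding diag using True j by (simp add: g_def)
      next
        case False
        then show ?thesis unfolding g_def s_def by (simp add: mult_ac)
      qed
      ultimately have "(\<lambda>k. of_real (u j) * (x k * of_real (u k) * (1 - cnj (z k) * z j) powr of_real (- (1 - \<alpha>)))) sums c' j"
        by simp
      then have "(\<lambda>k. x k * of_real (u k) * (1 - cnj (z k) * z j) powr of_real (- (1 - \<alpha>))) sums (c' j / of_real (u j))"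
        using uj by (subst (asm) sums_mult_iff[of "of_real (u j)" _ "c' j / of_real (u j)", simplified]) auto
      then have "f (z j) = c' j / of_real (u j)" unfolding f_def by (rule sums_unique[symmetric])
      then show ?thesis using uj j by (simp add: c'_def)
    qed
    have "c = restriction_map \<alpha> (z ` I) f"
    proof (rule extensionalityI[of _ "z ` I"])
      show "c \<in> extensional (z ` I)" using c by (simp add: ell2_on_def)
      show "restriction_map \<alpha> (z ` I) f \<in> extensional (z ` I)" by (simp add: restriction_map_def)
      fix w assume "w \<in> z ` I"
      then obtain j where j: "j \<in> I" "w = z j" by auto
      then show "c w = restriction_map \<alpha> (z ` I) f w"
        using val[OF j(1)] kn[OF j(1), of f] by (simp add: restriction_map_def)
    qed
    then show ?thesis using f by blast
  qed
  ultimately show ?thesis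
    unfolding interpolating_def using z by auto
qed

section \<open>Adding finitely many points\<close>

lemma summable_on_nonzero_const_imp_finite:
  fixes c :: real
  assumes "(\<lambda>x. c) summable_on A" "c \<noteq> 0"
  shows "finite A"
proof (rule ccontr)
  assume inf: "infinite A"
  have s: "(\<lambda>x. \<bar>c\<bar>) summable_on A"
    using assms(1) summable_on_iff_abs_summable_on_real[of "\<lambda>x. c" A] by simp
  obtain n where n: "infsum (\<lambda>x. \<bar>c\<bar>) A < real n * \<bar>c\<bar>"
    using reals_Archimedean3[of "\<bar>c\<bar>"] assms(2) by auto
  obtain F where F: "finite F" "F \<subseteq> A" "card F = n"
    using infinite_arbitrarily_large[OF inf] by metis
  have "sum (\<lambda>x. \<bar>c\<bar>) F \<le> infsum (\<lambda>x. \<bar>c\<bar>) A"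
    by (rule finite_sum_le_infsum[OF s F(1,2)]) simp
  then show False using n F by simp
qed

text \<open>A function interpolating on \<open>insert p L\<close> is sought in the form \<open>(z - p) * g z + P\<close>: the constant
  takes care of \<open>p\<close>, and \<open>g\<close> has to interpolate data on \<open>L\<close> divided by \<open>z - p\<close>. The division preserves
  \<open>\<ell>\<^sup>2\<close> because \<open>L\<close> stays away from \<open>p\<close>: since the constant \<open>1\<close> belongs to the space, the weights
  \<open>(1 - |x|\<^sup>2) powr (1 - \<alpha>)\<close> are summable over \<open>L\<close>, so \<open>L\<close> cannot accumulate inside the disc.\<close>

lemma interpolating_insert:
  assumes \<alpha>: "\<alpha> < 1" "0 \<le> \<alpha>" and L: "interpolating \<alpha> L" and p: "norm p < 1" "p \<notin> L"
  shows "interpolating \<alpha> (insert p L)"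
proof -
  define \<kappa> where "\<kappa> x = complex_of_real (kernel_norm \<alpha> x)" for x
  have L1: "norm x < 1" if "x \<in> L" for x using L that by (auto simp: interpolating_def)
  have \<kappa>0: "\<kappa> x \<noteq> 0" if "norm x < 1" for x
  proof -
    have "1 - (norm x)\<^sup>2 > 0" using that by (simp add: power_less_one_iff)
    then show ?thesis by (simp add: \<kappa>_def kernel_norm_eq[OF that])
  qed
  have bes: "(\<lambda>x. (norm (f x / \<kappa> x))\<^sup>2) summable_on L" if "f \<in> dirichlet_space \<alpha>" for f
  proof -
    have "restriction_map \<alpha> L f \<in> ell2_on L" using L that by (auto simp: interpolating_def)
    then have "(\<lambda>x. (norm (restriction_map \<alpha> L f x))\<^sup>2) summable_on L" by (simp add: ell2_on_def)
    then show ?thesis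
      by (rule summable_on_cong[THEN iffD1, rotated]) (simp add: restriction_map_def \<kappa>_def)
  qed
  have const: "(\<lambda>z. c) \<in> dirichlet_space \<alpha>" for c
    by (simp add: dirichlet_space_def dirichlet_norm_sq_def)
  have one: "(\<lambda>x. (norm (1 / \<kappa> x))\<^sup>2) summable_on L" by (rule bes[OF const])
  define \<delta> where "\<delta> = (1 - norm p) / 2"
  have \<delta>: "\<delta> > 0" using p by (simp add: \<delta>_def)
  have "finite {x \<in> L. dist x p < \<delta>}"
  proof (rule ccontr)
    assume inf: "infinite {x \<in> L. dist x p < \<delta>}"
    define r where "r = (1 + norm p) / 2"
    have r: "0 \<le> r" "r < 1" using p by (auto simp: r_def)
    have "(\<lambda>x. (norm (1 / \<kappa> x))\<^sup>2) summable_on {x \<in> L. dist x p < \<delta>}"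
      by (rule summable_on_subset_banach[OF one]) auto
    then have "(\<lambda>x. (1 - r\<^sup>2) powr (1 - \<alpha>)) summable_on {x \<in> L. dist x p < \<delta>}"
    proof (rule summable_on_comparison_test)
      fix x assume x: "x \<in> {x \<in> L. dist x p < \<delta>}"
      have "norm x \<le> norm p + dist x p" by (metis add.commute dist_0_norm dist_commute dist_triangle)
      also have "\<dots> \<le> r" using x by (simp add: \<delta>_def r_def field_simps)
      finally have "(norm x)\<^sup>2 \<le> r\<^sup>2" by (intro power_mono) auto
      moreover have "r\<^sup>2 < 1" using r by (simp add: power_less_one_iff)
      ultimately have "(1 - r\<^sup>2) powr (1 - \<alpha>) \<le> (1 - (norm x)\<^sup>2) powr (1 - \<alpha>)"
        using \<alpha> by (intro powr_mono2) auto
      also have "\<dots> = (norm (1 / \<kappa> x))\<^sup>2"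
      proof -
        have "norm x < 1" using x L1 by simp
        then have "(norm (1 / \<kappa> x))\<^sup>2 = 1 / (kernel_norm \<alpha> x)\<^sup>2"
          by (simp add: \<kappa>_def norm_divide power_divide)
        also have "\<dots> = (1 - (norm x)\<^sup>2) powr (1 - \<alpha>)"
          unfolding kernel_norm_sq[OF \<open>norm x < 1\<close>] powr_minus_divide by simp
        finally show ?thesis ..
      qed
      finally show "(1 - r\<^sup>2) powr (1 - \<alpha>) \<le> (norm (1 / \<kappa> x))\<^sup>2" .
    qed auto
    moreover have "(1 - r\<^sup>2) powr (1 - \<alpha>) \<noteq> 0"
      using r by (simp add: power2_eq_1_iff abs_square_eq_1)
    ultimately show False
      using inf summable_on_nonzero_const_imp_finite by blast
  qed
  then obtain \<epsilon> where \<epsilon>: "\<epsilon> > 0" "\<And>x. x \<in> L \<Longrightarrow> dist x p < \<delta> \<Longrightarrow> x \<noteq> p \<Longrightarrow> \<epsilon> \<le> dist p x"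
    using finite_set_avoid[of "{x \<in> L. dist x p < \<delta>}" p] by blast
  define \<eta> where "\<eta> = min \<epsilon> \<delta>"
  have \<eta>: "\<eta> > 0" "\<And>x. x \<in> L \<Longrightarrow> \<eta> \<le> norm (x - p)"
  proof -
    show "\<eta> > 0" using \<epsilon> \<delta> by (simp add: \<eta>_def)
    fix x assume x: "x \<in> L"
    then have "x \<noteq> p" using p(2) by blast
    then show "\<eta> \<le> norm (x - p)"
      using \<epsilon>(2)[OF x] unfolding \<eta>_def dist_norm norm_minus_commute[of p]
      by (cases "norm (x - p) < \<delta>") simp_all
  qed
  have "restriction_map \<alpha> (insert p L) f \<in> ell2_on (insert p L)" if f: "f \<in> dirichlet_space \<alpha>" for f
  proof -
    have "(\<lambda>x. (norm (f x / \<kappa> x))\<^sup>2) summable_on (insert p L)"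
      using bes[OF f] by (simp add: summable_on_insert_iff)
    then have "(\<lambda>x. (norm (restriction_map \<alpha> (insert p L) f x))\<^sup>2) summable_on (insert p L)"
      by (rule summable_on_cong[THEN iffD1, rotated]) (simp add: restriction_map_def \<kappa>_def)
    then show ?thesis by (simp add: ell2_on_def restriction_map_def)
  qed
  moreover have "\<exists>f\<in>dirichlet_space \<alpha>. c = restriction_map \<alpha> (insert p L) f" if c: "c \<in> ell2_on (insert p L)" for c
  proof -
    define P where "P = c p * \<kappa> p"
    define d where "d = (\<lambda>x\<in>L. (c x - P / \<kappa> x) / (x - p))"
    have "d \<in> ell2_on L"
    proof -
      have "(\<lambda>x. (norm (c x))\<^sup>2) summable_on (insert p L)" using c by (simp add: ell2_on_def)
      then have "(\<lambda>x. (norm (c x))\<^sup>2) summable_on L" by (rule summable_on_subset_banach) auto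
      then have "(\<lambda>x. 2 / \<eta>\<^sup>2 * ((norm (c x))\<^sup>2 + (norm (P / \<kappa> x))\<^sup>2)) summable_on L"
        by (intro summable_on_cmult_right summable_on_add bes const)
      then have "(\<lambda>x. (norm (d x))\<^sup>2) summable_on L"
      proof (rule summable_on_comparison_test)
        fix x assume x: "x \<in> L"
        have "norm (c x - P / \<kappa> x) \<le> norm (c x) + norm (P / \<kappa> x)" by (rule norm_triangle_ineq4)
        then have "(norm (c x - P / \<kappa> x))\<^sup>2 \<le> (norm (c x) + norm (P / \<kappa> x))\<^sup>2" by (intro power_mono) auto
        also have "\<dots> \<le> 2 * ((norm (c x))\<^sup>2 + (norm (P / \<kappa> x))\<^sup>2)"
          using sum_squares_bound[of "norm (c x)" "norm (P / \<kappa> x)"] by (simp add: power2_sum del: norm_divide)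
        finally have n: "(norm (c x - P / \<kappa> x))\<^sup>2 \<le> 2 * ((norm (c x))\<^sup>2 + (norm (P / \<kappa> x))\<^sup>2)" .
        have "\<eta>\<^sup>2 \<le> (norm (x - p))\<^sup>2" using \<eta> x by (intro power_mono) auto
        have "(norm (d x))\<^sup>2 = (norm (c x - P / \<kappa> x))\<^sup>2 / (norm (x - p))\<^sup>2"
          using x by (simp add: d_def norm_divide power_divide)
        also have "\<dots> \<le> (2 * ((norm (c x))\<^sup>2 + (norm (P / \<kappa> x))\<^sup>2)) / \<eta>\<^sup>2"
          using n \<open>\<eta>\<^sup>2 \<le> (norm (x - p))\<^sup>2\<close> \<eta>(1) by (intro frac_le) auto
        finally show "(norm (d x))\<^sup>2 \<le> 2 / \<eta>\<^sup>2 * ((norm (c x))\<^sup>2 + (norm (P / \<kappa> x))\<^sup>2)"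
          by (simp only: times_divide_eq_left)
      qed auto
      then show ?thesis by (simp add: ell2_on_def d_def)
    qed
    then obtain g where g: "g \<in> dirichlet_space \<alpha>" "d = restriction_map \<alpha> L g"
      using L by (auto simp: interpolating_def)
    define f where "f x = (x - p) * g x + P" for x
    have "f \<in> dirichlet_space \<alpha>"
      unfolding f_def by (rule dirichlet_space_mult_linear[OF \<alpha> g(1)])
    moreover have "c = restriction_map \<alpha> (insert p L) f"
    proof (rule extensionalityI[of _ "insert p L"])
      show "c \<in> extensional (insert p L)" using c by (simp add: ell2_on_def)
      show "restriction_map \<alpha> (insert p L) f \<in> extensional (insert p L)" by (simp add: restriction_map_def)
      fix x assume x: "x \<in> insert p L"
      show "c x = restriction_map \<alpha> (insert p L) f x"
      proof (cases "x = p")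
        case True
        then show ?thesis using \<kappa>0[OF p(1)] by (simp add: restriction_map_def f_def P_def \<kappa>_def)
      next
        case False
        then have xL: "x \<in> L" using x by simp
        have "d x = g x / \<kappa> x" using g(2) xL by (simp add: restriction_map_def \<kappa>_def)
        then have "(c x - P / \<kappa> x) / (x - p) = g x / \<kappa> x" using xL by (simp add: d_def)
        then have "c x - P / \<kappa> x = (x - p) * (g x / \<kappa> x)" using False by (simp add: nonzero_divide_eq_eq mult.commute)
        then have "c x = ((x - p) * g x + P) / \<kappa> x" by (simp add: add_divide_distrib diff_eq_eq)
        then show ?thesis using x by (simp add: restriction_map_def f_def \<kappa>_def)
      qed
    qed
    ultimately show ?thesis by blast
  qed
  ultimately show ?thesis
    unfolding interpolating_def using L p by (auto simp: interpolating_def)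
qed

lemma interpolating_union_finite:
  assumes \<alpha>: "\<alpha> < 1" "0 \<le> \<alpha>" and L: "interpolating \<alpha> L" and F: "finite F" "F \<subseteq> ball 0 1"
  shows "interpolating \<alpha> (F \<union> L)"
  using F
proof (induction F)
  case empty
  then show ?case using L by simp
next
  case (insert p F)
  show ?case
  proof (cases "p \<in> F \<union> L")
    case True
    then show ?thesis using insert by (simp add: insert_absorb)
  next
    case False
    then show ?thesis using interpolating_insert[OF \<alpha>, of "F \<union> L" p] insert by simp
  qed
qed

section \<open>Square-summable Gram matrices\<close>

lemma power2_le_imp_le_ennreal:
  fixes a b :: ennreal
  assumes "a\<^sup>2 \<le> b\<^sup>2"
  shows "a \<le> b"
proof (cases b)
  case top
  then show ?thesis by (simp only: top_greatest)
next
  case (real r)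
  have "b < \<infinity>" unfolding real(2) by (rule ennreal_less_top[folded infinity_ennreal_def])
  then have "b\<^sup>2 < \<infinity>" by (simp only: infinity_ennreal_def power_less_top_ennreal) simp
  with assms have "a\<^sup>2 < \<infinity>" by (rule le_less_trans)
  then have "a < \<infinity>" by (simp only: infinity_ennreal_def power_less_top_ennreal) simp
  then obtain q where q: "q \<ge> 0" "a = ennreal q" by (cases a) auto
  have "ennreal (q\<^sup>2) \<le> ennreal (r\<^sup>2)"
    using assms unfolding real(2) q(2) ennreal_power[OF real(1)] ennreal_power[OF q(1)] .
  then have "q\<^sup>2 \<le> r\<^sup>2" by (subst (asm) ennreal_le_iff) simp_all
  then have "q \<le> r" using real(1) by (rule power2_le_imp_le)
  then show ?thesis unfolding real(2) q(2) by (rule ennreal_leI)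
qed

text \<open>The \<open>\<ell>\<^sup>2\<close> norm of \<open>A\<close> satisfies \<open>\<parallel>A\<parallel>\<^sup>4 = \<parallel>A\<^sup>T A\<parallel>\<^sup>2\<close>, which is at most the squared
  Hilbert-Schmidt norm of \<open>A\<^sup>T A\<close>. This is weaker to require than finiteness of the
  Hilbert-Schmidt norm of \<open>A\<close>, and the critical exponent \<open>\<alpha> = 1/2\<close> needs the difference.\<close>

lemma operator_bound_of_gram_square:
  fixes A :: "nat \<Rightarrow> nat \<Rightarrow> ennreal" and y :: "nat \<Rightarrow> ennreal"
  shows "(\<Sum>k. (\<Sum>l. A k l * y l)\<^sup>2)\<^sup>2 \<le> (\<Sum>l. \<Sum>m. (\<Sum>k. A k l * A k m)\<^sup>2) * (\<Sum>l. (y l)\<^sup>2)\<^sup>2"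
proof -
  define S where "S = (\<Sum>l. (y l)\<^sup>2)"
  define B where "B l m = (\<Sum>k. A k l * A k m)" for l m
  have "(\<Sum>k. (\<Sum>l. A k l * y l)\<^sup>2) = (\<Sum>k. \<Sum>l. \<Sum>m. y l * (A k l * A k m * y m))"
  proof (rule suminf_cong)
    fix k
    have "(\<Sum>l. A k l * y l)\<^sup>2 = (\<Sum>l. A k l * y l * (\<Sum>m. A k m * y m))"
      unfolding power2_eq_square by (rule ennreal_suminf_multc[symmetric])
    also have "\<dots> = (\<Sum>l. \<Sum>m. A k l * y l * (A k m * y m))"
      unfolding ennreal_suminf_cmult ..
    also have "\<dots> = (\<Sum>l. \<Sum>m. y l * (A k l * A k m * y m))"
      by (simp only: mult_ac)
    finally show "(\<Sum>l. A k l * y l)\<^sup>2 = (\<Sum>l. \<Sum>m. y l * (A k l * A k m * y m))" .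
  qed
  also have "\<dots> = (\<Sum>l. \<Sum>m. \<Sum>k. y l * (A k l * A k m * y m))"
    unfolding suminf_swap_ennreal[of "\<lambda>k l. \<Sum>m. y l * (A k l * A k m * y m)"]
    by (rule suminf_cong, rule suminf_swap_ennreal)
  also have "\<dots> = (\<Sum>l. y l * (\<Sum>m. B l m * y m))"
    unfolding B_def ennreal_suminf_cmult ennreal_suminf_multc ..
  finally have eq: "(\<Sum>k. (\<Sum>l. A k l * y l)\<^sup>2) = (\<Sum>l. y l * (\<Sum>m. B l m * y m))" .
  have "(\<Sum>l. y l * (\<Sum>m. B l m * y m))\<^sup>2 \<le> S * (\<Sum>l. (\<Sum>m. B l m * y m)\<^sup>2)"
    unfolding S_def by (rule Cauchy_Schwarz_suminf_ennreal)
  also have "\<dots> \<le> S * (\<Sum>l. (\<Sum>m. (B l m)\<^sup>2) * S)"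
    unfolding S_def by (intro mult_left_mono suminf_le allI Cauchy_Schwarz_suminf_ennreal) auto
  also have "\<dots> = (\<Sum>l. \<Sum>m. (B l m)\<^sup>2) * S\<^sup>2"
    unfolding ennreal_suminf_multc power2_eq_square by (simp only: mult_ac)
  finally show ?thesis unfolding eq S_def B_def .
qed

lemma ennreal_suminf_tail_small:
  fixes f :: "nat \<Rightarrow> ennreal" and e :: real
  assumes "(\<Sum>n. f n) < \<infinity>" "e > 0"
  obtains N where "(\<Sum>n. if N \<le> n then f n else 0) \<le> ennreal e"
proof -
  define r where "r n = enn2real (f n)" for n
  have fin: "f n < \<infinity>" for n using suminf_ennreal_member_le assms(1) by (rule le_less_trans)
  have fr: "f n = ennreal (r n)" for n unfolding r_def using fin[of n] by simp
  have r0: "0 \<le> r n" for n by (simp add: r_def)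
  have sm: "summable r" using assms(1) unfolding fr by (rule suminf_ennreal_lt_top_iff[OF r0, THEN iffD1])
  obtain N where N: "norm (\<Sum>i. r (i + N)) < e" using suminf_exist_split[OF assms(2) sm] by blast
  have smN: "summable (\<lambda>i. r (i + N))" by (rule summable_ignore_initial_segment[OF sm])
  have "(\<Sum>n. if N \<le> n then f n else 0) = (\<Sum>j. if N \<le> j + N then f (j + N) else 0) + (\<Sum>j<N. if N \<le> j then f j else 0)"
    by (rule suminf_offset) (rule summableI)
  also have "\<dots> = (\<Sum>j. ennreal (r (j + N)))" by (simp add: fr)
  also have "\<dots> = ennreal (\<Sum>j. r (j + N))"
    by (rule suminf_ennreal_eq[OF r0 summable_sums[OF smN]])
  also have "\<dots> \<le> ennreal e" using N by (intro ennreal_leI) auto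
  finally show thesis by (rule that)
qed

lemma gram_weight_commute: "gram_weight s u z k l = gram_weight s u z l k"
proof -
  have "norm (1 - cnj (z k) * z l) = norm (cnj (1 - cnj (z k) * z l))" by (simp only: complex_mod_cnj)
  also have "cnj (1 - cnj (z k) * z l) = 1 - cnj (z l) * z k" by simp
  finally show ?thesis unfolding gram_weight_def by (simp only: mult_ac)
qed

text \<open>If \<open>A\<^sup>T A\<close> is Hilbert-Schmidt, discarding finitely many points makes the norm of \<open>A\<close> as
  small as needed; the discarded points are then put back one by one.\<close>

theorem interpolating_of_gram_square_summable:
  fixes z :: "nat \<Rightarrow> complex"
  assumes \<alpha>: "\<alpha> < 1" "0 \<le> \<alpha>" and z: "\<And>k. norm (z k) < 1" and inj: "inj_on z I"
  defines "u \<equiv> \<lambda>k. if k \<in> I then (1 - (norm (z k))\<^sup>2) powr ((1 - \<alpha>) / 2) else 0"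
  defines "A \<equiv> \<lambda>j k. ennreal (if j = k then 0 else gram_weight (1 - \<alpha>) u z j k)"
  assumes u2: "summable (\<lambda>k. (u k)\<^sup>2)"
    and fin: "(\<Sum>k. \<Sum>l. (\<Sum>j. A j k * A j l)\<^sup>2) < \<infinity>"
  shows "interpolating \<alpha> (z ` I)"
proof -
  \<comment> \<open>\<open>1/16\<close> because the bound controls the fourth power of the norm, which is to be at most \<open>1/2\<close>.\<close>
  obtain N where N: "(\<Sum>k. if N \<le> k then (\<Sum>l. (\<Sum>j. A j k * A j l)\<^sup>2) else 0) \<le> ennreal (1/16)"
    using ennreal_suminf_tail_small[OF fin, of "1/16"] by auto
  define J where "J = I \<inter> {N..}"
  define v where "v k = (if k \<in> J then (1 - (norm (z k))\<^sup>2) powr ((1 - \<alpha>) / 2) else 0)" for k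
  have vu: "v k = (if N \<le> k then u k else 0)" for k by (simp add: v_def u_def J_def)
  define A' where "A' j k = ennreal (if j = k then 0 else gram_weight (1 - \<alpha>) v z j k)" for j k
  have A': "A' j k = (if N \<le> j \<and> N \<le> k then A j k else 0)" for j k
    unfolding A'_def A_def gram_weight_def vu by simp
  have sq: "(\<Sum>k. \<Sum>l. (\<Sum>j. A' j k * A' j l)\<^sup>2) \<le> ennreal (1/16)"
  proof -
    have "(\<Sum>k. \<Sum>l. (\<Sum>j. A' j k * A' j l)\<^sup>2) \<le> (\<Sum>k. if N \<le> k then (\<Sum>l. (\<Sum>j. A j k * A j l)\<^sup>2) else 0)"
    proof (intro suminf_le allI)
      fix k
      show "(\<Sum>l. (\<Sum>j. A' j k * A' j l)\<^sup>2) \<le> (if N \<le> k then (\<Sum>l. (\<Sum>j. A j k * A j l)\<^sup>2) else 0)"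
      proof (cases "N \<le> k")
        case True
        have "(\<Sum>l. (\<Sum>j. A' j k * A' j l)\<^sup>2) \<le> (\<Sum>l. (\<Sum>j. A j k * A j l)\<^sup>2)"
          by (intro suminf_le allI power_mono mult_mono) (auto simp: A')
        then show ?thesis using True by simp
      next
        case False
        then show ?thesis by (simp add: A')
      qed
    qed auto
    then show ?thesis using N by (rule order_trans)
  qed
  have "interpolating \<alpha> (z ` J)"
  proof (rule interpolating_of_small_gram[OF \<alpha> z])
    show "inj_on z J" using inj by (rule inj_on_subset) (auto simp: J_def)
    show "summable (\<lambda>k. (if k \<in> J then (1 - (norm (z k))\<^sup>2) powr ((1 - \<alpha>) / 2) else 0)\<^sup>2)"
      unfolding v_def[symmetric] by (rule summable_comparison_test'[OF u2]) (simp add: vu)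
    fix y :: "nat \<Rightarrow> ennreal"
    have "(\<Sum>k. (\<Sum>l. A' k l * y l)\<^sup>2)\<^sup>2 \<le> (\<Sum>l. \<Sum>m. (\<Sum>k. A' k l * A' k m)\<^sup>2) * (\<Sum>l. (y l)\<^sup>2)\<^sup>2"
      by (rule operator_bound_of_gram_square)
    also have "\<dots> \<le> ennreal (1/16) * (\<Sum>l. (y l)\<^sup>2)\<^sup>2" by (rule mult_right_mono[OF sq]) simp
    also have "\<dots> = (ennreal (1/4) * (\<Sum>l. (y l)\<^sup>2))\<^sup>2"
    proof -
      have "(ennreal (1/4))\<^sup>2 = ennreal (1/16)"
        by (subst ennreal_power) (simp_all add: power2_eq_square)
      then show ?thesis by (simp only: power_mult_distrib)
    qed
    finally have "(\<Sum>k. (\<Sum>l. A' k l * y l)\<^sup>2) \<le> ennreal (1/4) * (\<Sum>l. (y l)\<^sup>2)"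
      by (rule power2_le_imp_le_ennreal)
    then show "(\<Sum>k. (\<Sum>l. ennreal (if k = l then 0 else gram_weight (1 - \<alpha>)
        (\<lambda>k. if k \<in> J then (1 - (norm (z k))\<^sup>2) powr ((1 - \<alpha>) / 2) else 0) z k l) * y l)\<^sup>2) \<le> ennreal (1/4) * (\<Sum>l. (y l)\<^sup>2)"
      unfolding A'_def v_def[abs_def] .
  qed
  then have "interpolating \<alpha> (z ` (I \<inter> {..<N}) \<union> z ` J)"
    by (rule interpolating_union_finite[OF \<alpha>]) (use z in auto)
  also have "z ` (I \<inter> {..<N}) \<union> z ` J = z ` I"
    unfolding J_def image_Un[symmetric] by (rule arg_cong[of _ _ "image z"]) auto
  finally show ?thesis .
qed

section \<open>Obstructions to interpolation\<close>

text \<open>Apply the restriction map to the constant function \<open>1\<close>.\<close>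

lemma interpolating_imp_summable_weights:
  fixes z :: "nat \<Rightarrow> complex"
  assumes L: "interpolating \<alpha> (z ` I)" and inj: "inj_on z I"
  shows "summable (\<lambda>k. if k \<in> I then (1 - (norm (z k))\<^sup>2) powr (1 - \<alpha>) else 0)"
proof -
  have "(\<lambda>z. 1) \<in> dirichlet_space \<alpha>"
    by (simp add: dirichlet_space_def dirichlet_norm_sq_def)
  then have "restriction_map \<alpha> (z ` I) (\<lambda>z. 1) \<in> ell2_on (z ` I)"
    using L by (auto simp: interpolating_def)
  then have "(\<lambda>x. (norm (restriction_map \<alpha> (z ` I) (\<lambda>z. 1) x))\<^sup>2) summable_on (z ` I)"
    by (simp add: ell2_on_def)
  then have "(\<lambda>x. (1 - (norm x)\<^sup>2) powr (1 - \<alpha>)) summable_on (z ` I)"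
  proof (rule summable_on_cong[THEN iffD1, rotated])
    fix x assume x: "x \<in> z ` I"
    then have "norm x < 1" using L by (auto simp: interpolating_def)
    have "(norm (restriction_map \<alpha> (z ` I) (\<lambda>z. 1) x))\<^sup>2 = 1 / (kernel_norm \<alpha> x)\<^sup>2"
      using x by (simp add: restriction_map_def norm_divide power_divide)
    then show "(norm (restriction_map \<alpha> (z ` I) (\<lambda>z. 1) x))\<^sup>2 = (1 - (norm x)\<^sup>2) powr (1 - \<alpha>)"
      unfolding kernel_norm_sq[OF \<open>norm x < 1\<close>] powr_minus_divide by simp
  qed
  then have "(\<lambda>k. (1 - (norm (z k))\<^sup>2) powr (1 - \<alpha>)) summable_on I"
    by (subst (asm) summable_on_reindex[OF inj]) (simp add: comp_def)
  then show ?thesis by (subst (asm) summable_on_iff_summable_nat) auto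
qed

text \<open>On the disc around \<open>p\<close> of radius \<open>(1 - |p|)/2\<close> the growth bound is uniform; Cauchy's estimate
  bounds the derivative on the disc of half that radius, which contains \<open>q\<close>.\<close>

lemma growth_bound_imp_difference_bound:
  assumes f: "f holomorphic_on ball 0 1" and e: "e \<ge> 0"
    and C: "\<And>w. norm w < 1 \<Longrightarrow> norm (f w) \<le> C * (1 - (norm w)\<^sup>2) powr (- e)"
    and p: "norm p < 1" and q: "norm (p - q) \<le> t * (1 - norm p) / 4" and t: "0 \<le> t" "t \<le> 1" and C0: "C \<ge> 0"
  shows "norm (f p - f q) \<le> t * C * ((1 - norm p) / 2) powr (- e)"
proof -
  define r where "r = (1 - norm p) / 2"
  have r: "r > 0" using p by (simp add: r_def)
  define B where "B = C * r powr (- e)"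
  have fB: "norm (f w) \<le> B" if "norm (p - w) \<le> r" for w
  proof -
    have nw: "norm w \<le> 1 - r"
      using norm_triangle_ineq2[of w p] that unfolding norm_minus_commute[of p w] by (simp add: r_def field_simps)
    have "(norm w)\<^sup>2 \<le> norm w * 1"
      unfolding power2_eq_square using nw r by (intro mult_left_mono) auto
    then have "r \<le> 1 - (norm w)\<^sup>2" using nw by simp
    then have "(1 - (norm w)\<^sup>2) powr (- e) \<le> r powr (- e)"
      using r e by (intro powr_mono2') auto
    then have "C * (1 - (norm w)\<^sup>2) powr (- e) \<le> B" unfolding B_def using C0 by (rule mult_left_mono)
    moreover have "norm w < 1" using nw r by simp
    ultimately show ?thesis using C[of w] by (metis order_trans)
  qed
  have sub: "cball w (r/2) \<subseteq> cball p r" if "w \<in> cball p (r/2)" for w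
  proof
    fix x assume "x \<in> cball w (r/2)"
    then show "x \<in> cball p r"
      using that dist_triangle[of p x w] by simp
  qed
  have sub2: "cball p r \<subseteq> ball 0 1"
  proof
    fix w assume "w \<in> cball p r"
    then have "norm (p - w) \<le> r" by (simp add: dist_norm)
    then have "norm w \<le> 1 - r"
      using norm_triangle_ineq2[of w p] unfolding norm_minus_commute[of p w] by (simp add: r_def field_simps)
    then show "w \<in> ball 0 1" using r by simp
  qed
  have d: "norm (deriv f w) \<le> B / (r/2)" if w: "w \<in> cball p (r/2)" for w
  proof -
    have "norm ((deriv ^^ 1) f w) \<le> fact 1 * B / (r/2) ^ 1"
    proof (rule Cauchy_inequality)
      show "f holomorphic_on ball w (r/2)"
        using f by (rule holomorphic_on_subset) (use sub[OF w] sub2 ball_subset_cball in blast)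
      have "f holomorphic_on cball w (r/2)"
        using f by (rule holomorphic_on_subset) (use sub[OF w] sub2 in blast)
      then show "continuous_on (cball w (r/2)) f" by (rule holomorphic_on_imp_continuous_on)
      show "0 < r/2" using r by simp
      fix x assume "norm (w - x) = r/2"
      then have "x \<in> cball p r" using sub[OF w] by (auto simp: dist_norm)
      then show "norm (f x) \<le> B" by (intro fB) (simp add: dist_norm)
    qed
    then show ?thesis by simp
  qed
  have qin: "q \<in> cball p (r/2)"
  proof -
    have "t * (1 - norm p) \<le> 1 * (1 - norm p)" using t p by (intro mult_right_mono) auto
    then show ?thesis using q by (simp add: dist_norm r_def)
  qed
  have "norm (f p - f q) \<le> B / (r/2) * norm (p - q)"
  proof (rule field_differentiable_bound[OF convex_cball _ d])
    fix w assume "w \<in> cball p (r/2)"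
    then have "w \<in> ball 0 1" using sub[of w] sub2 r by (meson centre_in_cball half_gt_zero less_imp_le subsetD)
    then have "(f has_field_derivative deriv f w) (at w)"
      by (intro holomorphic_derivI[OF f]) auto
    then show "(f has_field_derivative deriv f w) (at w within cball p (r/2))"
      by (rule has_field_derivative_at_within)
  qed (use r qin in auto)
  also have "\<dots> \<le> B / (r/2) * (t * (1 - norm p) / 4)"
    using q r C0 by (intro mult_left_mono) (auto simp: B_def)
  also have "\<dots> = t * B" using r by (simp add: r_def field_simps)
  finally show ?thesis by (simp add: B_def r_def mult.assoc)
qed

text \<open>Prescribe normalized values \<open>(3/4)\<^sup>i\<close> at \<open>p i\<close> and \<open>0\<close> at \<open>q i\<close>. This is square summable data,
  but any function of the space changes by only \<open>O((1/2)\<^sup>i)\<close> kernel norms between two points this close.\<close>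

theorem not_interpolating_of_close_pairs:
  fixes p q :: "nat \<Rightarrow> complex"
  assumes \<alpha>: "\<alpha> < 1" "0 \<le> \<alpha>"
    and L: "\<And>i. p i \<in> L" "\<And>i. q i \<in> L" and inj: "inj p" and ne: "\<And>i j. q i \<noteq> p j"
    and close: "\<And>i. norm (p i - q i) \<le> (1/2) ^ i * (1 - norm (p i)) / 4"
  shows "\<not> interpolating \<alpha> L"
proof
  assume int: "interpolating \<alpha> L"
  define s where "s = 1 - \<alpha>"
  have s: "s > 0" using \<alpha> by (simp add: s_def)
  \<comment> \<open>\<open>(3/4)\<^sup>i\<close> decays fast enough to be square summable and yet slower than \<open>(1/2)\<^sup>i\<close>.\<close>
  define c where "c = (\<lambda>x\<in>L. if x \<in> range p then complex_of_real ((3/4) ^ (inv p x)) else 0)"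
  have cp: "c (p i) = of_real ((3/4) ^ i)" for i using L inj by (simp add: c_def)
  have cq: "c (q i) = 0" for i using L ne by (auto simp: c_def)
  have "c \<in> ell2_on L"
  proof -
    have "summable (\<lambda>i. (9/16 :: real) ^ i)" by (rule summable_geometric) simp
    then have "(\<lambda>i. (9/16 :: real) ^ i) summable_on UNIV"
      by (subst summable_on_UNIV_nonneg_real_iff) auto
    also have "(\<lambda>i. (9/16 :: real) ^ i) = (\<lambda>x. (norm (c x))\<^sup>2) \<circ> p"
      by (auto simp: fun_eq_iff cp norm_power power_mult[symmetric] mult.commute[of _ 2])
         (simp add: power_mult power2_eq_square)
    finally have "(\<lambda>x. (norm (c x))\<^sup>2) summable_on (range p)"
      using summable_on_reindex[OF inj] by blast
    then have "(\<lambda>x. (norm (c x))\<^sup>2) summable_on L"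
      by (rule summable_on_cong_neutral[THEN iffD1, rotated -1]) (use L in \<open>auto simp: c_def\<close>)
    then show ?thesis by (simp add: ell2_on_def c_def)
  qed
  then obtain f where f: "f \<in> dirichlet_space \<alpha>" "c = restriction_map \<alpha> L f"
    using int by (auto simp: interpolating_def)
  obtain C where C: "C \<ge> 0" "\<And>w. norm w < 1 \<Longrightarrow> norm (f w) \<le> C * (1 - (norm w)\<^sup>2) powr (- s / 2)"
    using growth_bound[OF \<alpha> f(1)] unfolding s_def by blast
  have L1: "norm x < 1" if "x \<in> L" for x using int that by (auto simp: interpolating_def)
  have val: "f x = c x * of_real (kernel_norm \<alpha> x)" if "x \<in> L" for x
  proof -
    have "1 - (norm x)\<^sup>2 > 0" using L1[OF that] by (simp add: power_less_one_iff)
    then have "kernel_norm \<alpha> x \<noteq> 0" by (simp add: kernel_norm_eq[OF L1[OF that]])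
    moreover have "c x = f x / of_real (kernel_norm \<alpha> x)" using f(2) that by (simp add: restriction_map_def)
    ultimately show ?thesis by simp
  qed
  have "(3/2) ^ i \<le> C * 4 powr (s/2)" for i
  proof -
    define r where "r = (1 - norm (p i)) / 2"
    have r: "r > 0" using L1[OF L(1)] by (simp add: r_def)
    have "norm (f (p i) - f (q i)) \<le> (1/2) ^ i * C * ((1 - norm (p i)) / 2) powr (- (s / 2))"
      by (rule growth_bound_imp_difference_bound[OF _ _ _ L1[OF L(1)] close])
         (use C f s in \<open>auto simp: dirichlet_space_def power_le_one\<close>)
    moreover have "f (q i) = 0" using val[OF L(2)] cq by simp
    moreover have "norm (f (p i)) = (3/4) ^ i * (1 - (norm (p i))\<^sup>2) powr (- s / 2)"
      unfolding val[OF L(1)] cp kernel_norm_eq[OF L1[OF L(1)]] s_def by (simp add: norm_mult norm_power)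
    ultimately have 1: "(3/4) ^ i * (1 - (norm (p i))\<^sup>2) powr (- s / 2) \<le> (1/2) ^ i * C * r powr (- s / 2)"
      by (simp add: r_def)
    have "1 - (norm (p i))\<^sup>2 > 0" using L1[OF L(1)] by (simp add: power_less_one_iff)
    moreover have "1 - (norm (p i))\<^sup>2 \<le> 4 * r"
    proof -
      have "1 - (norm (p i))\<^sup>2 = (1 - norm (p i)) * (1 + norm (p i))" by (simp add: power2_eq_square algebra_simps)
      also have "\<dots> \<le> (1 - norm (p i)) * 2" using L1[OF L(1)[of i]] by (intro mult_left_mono) auto
      finally show ?thesis by (simp add: r_def)
    qed
    ultimately have "(4 * r) powr (- s / 2) \<le> (1 - (norm (p i))\<^sup>2) powr (- s / 2)"
      using s by (intro powr_mono2') auto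
    then have "(3/4) ^ i * (4 * r) powr (- s / 2) \<le> (3/4) ^ i * (1 - (norm (p i))\<^sup>2) powr (- s / 2)"
      by (intro mult_left_mono) auto
    also note 1
    also have "(4 * r) powr (- s / 2) = r powr (- s / 2) / 4 powr (s / 2)"
      using r by (simp add: powr_mult powr_minus_divide)
    finally have "(3/4) ^ i * r powr (- s / 2) / 4 powr (s / 2) \<le> (1/2) ^ i * C * r powr (- s / 2)" by simp
    then have "((3/4) ^ i / 4 powr (s/2)) * r powr (- s / 2) \<le> ((1/2) ^ i * C) * r powr (- s / 2)" by simp
    moreover have "r powr (- s / 2) > 0" using r by simp
    ultimately have "(3/4) ^ i / 4 powr (s/2) \<le> (1/2) ^ i * C" by (rule mult_right_le_imp_le)
    then have "(3/4) ^ i \<le> (1/2) ^ i * C * 4 powr (s/2)" by (simp add: pos_divide_le_eq)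
    then have "2 ^ i * (3/4) ^ i \<le> 2 ^ i * ((1/2) ^ i * C * 4 powr (s/2))" by (intro mult_left_mono) auto
    then show ?thesis by (simp add: power_mult_distrib[symmetric] mult.assoc[symmetric])
  qed
  moreover obtain i where "C * 4 powr (s/2) < (3/2) ^ i" using real_arch_pow[of "3/2"] by auto
  ultimately show False by (meson not_le)
qed

section \<open>Independent uniform angles\<close>

definition uniform_angles :: "'a measure \<Rightarrow> (nat \<Rightarrow> 'a \<Rightarrow> real) \<Rightarrow> bool" where
  "uniform_angles M \<theta> \<longleftrightarrow> prob_space M \<and> prob_space.indep_vars M (\<lambda>_. borel) \<theta> UNIV \<and>
     (\<forall>k. distributed M lborel (\<theta> k) (\<lambda>x. indicator {0..2*pi} x / measure lborel {0..2*pi}))"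

lemma uniform_angles_measurable:
  assumes "uniform_angles M \<theta>"
  shows "\<theta> k \<in> borel_measurable M"
proof -
  have "distributed M lborel (\<theta> k) (\<lambda>x. indicator {0..2*pi} x / measure lborel {0..2*pi})"
    using assms by (simp add: uniform_angles_def)
  then show ?thesis by (simp add: distributed_def)
qed

lemma uniform_angles_distr:
  assumes \<theta>: "uniform_angles M \<theta>" and g[measurable]: "g \<in> borel_measurable borel"
  shows "(\<integral>\<^sup>+t. g t \<partial>distr M borel (\<theta> k)) = (\<integral>\<^sup>+t\<in>{0..2*pi}. g t \<partial>lborel) * ennreal (1 / (2 * pi))"
proof -
  have dst: "distributed M lborel (\<theta> k) (\<lambda>x. indicator {0..2*pi} x / measure lborel {0..2*pi})"
    using \<theta> by (simp add: uniform_angles_def)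
  have mf: "(\<lambda>x. indicator {0..2*pi} x / measure lborel {0..2*pi} :: ennreal) \<in> borel_measurable lborel"
    using dst by (simp add: distributed_def)
  have "distr M borel (\<theta> k) = distr M lborel (\<theta> k)" by (intro distr_cong) auto
  also have "\<dots> = density lborel (\<lambda>x. indicator {0..2*pi} x / measure lborel {0..2*pi})"
    by (rule distributed_distr_eq_density[OF dst])
  finally have "(\<integral>\<^sup>+t. g t \<partial>distr M borel (\<theta> k))
      = (\<integral>\<^sup>+t. ennreal (indicator {0..2*pi} t / measure lborel {0..2*pi}) * g t \<partial>lborel)"
    using nn_integral_density[OF mf, of g] by simp
  also have "\<dots> = (\<integral>\<^sup>+t. (g t * indicator {0..2*pi} t) * ennreal (1 / (2 * pi)) \<partial>lborel)"
  proof (rule nn_integral_cong)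
    fix t
    show "ennreal (indicator {0..2*pi} t / measure lborel {0..2*pi}) * g t = (g t * indicator {0..2*pi} t) * ennreal (1 / (2 * pi))"
      by (cases "t \<in> {0..2*pi}") (simp_all add: mult.commute)
  qed
  also have "\<dots> = (\<integral>\<^sup>+t\<in>{0..2*pi}. g t \<partial>lborel) * ennreal (1 / (2 * pi))"
    by (rule nn_integral_multc) measurable
  finally show ?thesis .
qed

lemma uniform_angles_AE_range:
  assumes \<theta>: "uniform_angles M \<theta>"
  shows "AE \<omega> in M. 0 \<le> \<theta> k \<omega> \<and> \<theta> k \<omega> < 2 * pi"
proof -
  have m: "\<theta> k \<in> borel_measurable M" by (rule uniform_angles_measurable[OF \<theta>])
  have "(\<integral>\<^sup>+t. indicator (- {0..<2*pi}) t \<partial>distr M borel (\<theta> k))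
      = (\<integral>\<^sup>+t\<in>{0..2*pi}. indicator (- {0..<2*pi}) t \<partial>lborel) * ennreal (1 / (2 * pi))"
    by (rule uniform_angles_distr[OF \<theta>]) simp
  also have "(\<integral>\<^sup>+t\<in>{0..2*pi}. indicator (- {0..<2*pi}) t \<partial>lborel) = (\<integral>\<^sup>+t. indicator {2*pi} t \<partial>lborel)"
    by (intro nn_integral_cong) (auto simp: indicator_def)
  also have "\<dots> = emeasure lborel {2*pi}" by (rule nn_integral_indicator) simp
  also have "\<dots> = 0" by (rule emeasure_lborel_singleton)
  finally have z: "emeasure (distr M borel (\<theta> k)) (- {0..<2*pi}) = 0" by simp
  have "AE t in distr M borel (\<theta> k). t \<in> {0..<2*pi}"
    by (rule AE_I[OF _ z]) auto
  then have "AE \<omega> in M. \<theta> k \<omega> \<in> {0..<2*pi}"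
    by (subst (asm) AE_distr_iff) (use m in auto)
  then show ?thesis by simp
qed

text \<open>Conditioning on the angles in \<open>J\<close>, the fresh angle \<open>\<theta> l\<close> can be integrated first, by
  independence. Peeling off leaves of a tree in this way evaluates expectations of products along its edges.\<close>

lemma uniform_angles_integrate_out:
  assumes \<theta>: "uniform_angles M \<theta>" and l: "l \<notin> J" and k: "k \<in> J"
    and F[measurable]: "F \<in> borel_measurable (PiM J (\<lambda>_. borel))"
    and \<phi>[measurable]: "(\<lambda>(t, t'). \<phi> t t') \<in> borel_measurable (borel \<Otimes>\<^sub>M borel)"
  shows "(\<integral>\<^sup>+\<omega>. \<phi> (\<theta> l \<omega>) (\<theta> k \<omega>) * F (\<lambda>i\<in>J. \<theta> i \<omega>) \<partial>M)
    = (\<integral>\<^sup>+\<omega>. ((\<integral>\<^sup>+t\<in>{0..2*pi}. \<phi> t (\<theta> k \<omega>) \<partial>lborel) * ennreal (1 / (2 * pi))) * F (\<lambda>i\<in>J. \<theta> i \<omega>) \<partial>M)"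
proof -
  interpret prob_space M using \<theta> by (simp add: uniform_angles_def)
  have indep: "indep_vars (\<lambda>_. borel) \<theta> UNIV" using \<theta> by (simp add: uniform_angles_def)
  define R where "R \<omega> = (\<lambda>i\<in>J. \<theta> i \<omega>)" for \<omega>
  let ?P = "PiM J (\<lambda>_. borel :: real measure)"
  let ?Q = "PiM {l} (\<lambda>_. borel :: real measure)"
  define T where "T \<omega> = (\<lambda>i\<in>{l}. \<theta> i \<omega>)" for \<omega>
  have iv: "indep_var ?Q T ?P R"
    unfolding T_def R_def by (rule indep_var_restrict[OF indep]) (use l k in auto)
  have rv: "T \<in> measurable M ?Q" "R \<in> measurable M ?P"
    using iv by (auto simp: indep_var_eq)
  have \<theta>m[measurable]: "\<theta> l \<in> borel_measurable M" by (rule uniform_angles_measurable[OF \<theta>])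
  define D where "D = distr M ?Q T"
  define E where "E = distr M ?P R"
  have joint: "D \<Otimes>\<^sub>M E = distr M (?Q \<Otimes>\<^sub>M ?P) (\<lambda>\<omega>. (T \<omega>, R \<omega>))"
    using iv by (simp add: indep_var_distribution_eq D_def E_def)
  interpret D: prob_space D unfolding D_def by (rule prob_space_distr) (rule rv)
  interpret E: prob_space E unfolding E_def by (rule prob_space_distr) (rule rv)
  interpret DE: pair_prob_space D E ..
  define G where "G = (\<lambda>(t :: nat \<Rightarrow> real, v). \<phi> (t l) (v k) * F v)"
  have comp[measurable]: "(\<lambda>v. v k) \<in> borel_measurable ?P" "(\<lambda>t. t l) \<in> borel_measurable ?Q"
    using k by (auto intro: measurable_component_singleton)
  have Gm: "G \<in> borel_measurable (?Q \<Otimes>\<^sub>M ?P)"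
    unfolding G_def by measurable
  have sDE: "sets (D \<Otimes>\<^sub>M E) = sets (?Q \<Otimes>\<^sub>M ?P)"
    by (intro sets_pair_measure_cong) (simp_all add: D_def E_def)
  have Gm': "G \<in> borel_measurable (D \<Otimes>\<^sub>M E)"
    using Gm by (simp add: measurable_cong_sets[OF sDE refl])
  have \<phi>m: "(\<lambda>t. \<phi> t x) \<in> borel_measurable borel" for x by measurable
  have "(\<integral>\<^sup>+\<omega>. \<phi> (\<theta> l \<omega>) (\<theta> k \<omega>) * F (\<lambda>i\<in>J. \<theta> i \<omega>) \<partial>M) = (\<integral>\<^sup>+\<omega>. G (T \<omega>, R \<omega>) \<partial>M)"
    using k by (simp add: G_def R_def T_def)
  also have "\<dots> = (\<integral>\<^sup>+p. G p \<partial>(D \<Otimes>\<^sub>M E))"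
    unfolding joint using rv Gm by (subst nn_integral_distr) auto
  also have "\<dots> = (\<integral>\<^sup>+v. \<integral>\<^sup>+t. G (t, v) \<partial>D \<partial>E)"
    by (rule DE.nn_integral_snd[OF Gm', symmetric])
  also have "\<dots> = (\<integral>\<^sup>+v. ((\<integral>\<^sup>+t\<in>{0..2*pi}. \<phi> t (v k) \<partial>lborel) * ennreal (1 / (2 * pi))) * F v \<partial>E)"
  proof (rule nn_integral_cong)
    fix v
    have \<phi>l: "(\<lambda>t. \<phi> (t l) (v k)) \<in> borel_measurable ?Q"
      using comp(2) \<phi>m by (rule measurable_compose)
    have "(\<integral>\<^sup>+t. G (t, v) \<partial>D) = (\<integral>\<^sup>+t. \<phi> (t l) (v k) \<partial>D) * F v"
      unfolding G_def prod.case by (rule nn_integral_multc) (simp add: D_def \<phi>l)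
    also have "(\<integral>\<^sup>+t. \<phi> (t l) (v k) \<partial>D) = (\<integral>\<^sup>+\<omega>. \<phi> (T \<omega> l) (v k) \<partial>M)"
      unfolding D_def by (subst nn_integral_distr[OF rv(1)]) (simp_all add: \<phi>l)
    also have "\<dots> = (\<integral>\<^sup>+t. \<phi> t (v k) \<partial>distr M borel (\<theta> l))"
      by (subst nn_integral_distr[OF \<theta>m]) (simp_all add: T_def \<phi>m)
    also have "\<dots> = (\<integral>\<^sup>+t\<in>{0..2*pi}. \<phi> t (v k) \<partial>lborel) * ennreal (1 / (2 * pi))"
      by (rule uniform_angles_distr[OF \<theta> \<phi>m])
    finally show "(\<integral>\<^sup>+t. G (t, v) \<partial>D) = ((\<integral>\<^sup>+t\<in>{0..2*pi}. \<phi> t (v k) \<partial>lborel) * ennreal (1 / (2 * pi))) * F v" .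
  qed
  also have "\<dots> = (\<integral>\<^sup>+\<omega>. ((\<integral>\<^sup>+t\<in>{0..2*pi}. \<phi> t (R \<omega> k) \<partial>lborel) * ennreal (1 / (2 * pi))) * F (R \<omega>) \<partial>M)"
    unfolding E_def by (rule nn_integral_distr[OF rv(2)]) measurable
  finally show ?thesis using k by (simp add: R_def)
qed

lemma uniform_angles_integrate_out_le:
  assumes \<theta>: "uniform_angles M \<theta>" and l: "l \<notin> J" and k: "k \<in> J"
    and F[measurable]: "F \<in> borel_measurable (PiM J (\<lambda>_. borel))"
    and \<phi>[measurable]: "(\<lambda>(t, t'). \<phi> t t') \<in> borel_measurable (borel \<Otimes>\<^sub>M borel)"
    and C: "\<And>t'. 0 \<le> t' \<Longrightarrow> t' < 2 * pi \<Longrightarrow> (\<integral>\<^sup>+t\<in>{0..2*pi}. \<phi> t t' \<partial>lborel) * ennreal (1 / (2 * pi)) \<le> C"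
  shows "(\<integral>\<^sup>+\<omega>. \<phi> (\<theta> l \<omega>) (\<theta> k \<omega>) * F (\<lambda>i\<in>J. \<theta> i \<omega>) \<partial>M) \<le> C * (\<integral>\<^sup>+\<omega>. F (\<lambda>i\<in>J. \<theta> i \<omega>) \<partial>M)"
proof -
  have [measurable]: "\<theta> i \<in> borel_measurable M" for i by (rule uniform_angles_measurable[OF \<theta>])
  have Fm: "(\<lambda>\<omega>. F (\<lambda>i\<in>J. \<theta> i \<omega>)) \<in> borel_measurable M" by measurable
  have "(\<integral>\<^sup>+\<omega>. \<phi> (\<theta> l \<omega>) (\<theta> k \<omega>) * F (\<lambda>i\<in>J. \<theta> i \<omega>) \<partial>M) \<le> (\<integral>\<^sup>+\<omega>. C * F (\<lambda>i\<in>J. \<theta> i \<omega>) \<partial>M)"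
    unfolding uniform_angles_integrate_out[OF \<theta> l k F \<phi>]
  proof (rule nn_integral_mono_AE)
    show "AE \<omega> in M. ((\<integral>\<^sup>+t\<in>{0..2*pi}. \<phi> t (\<theta> k \<omega>) \<partial>lborel) * ennreal (1 / (2 * pi))) * F (\<lambda>i\<in>J. \<theta> i \<omega>) \<le> C * F (\<lambda>i\<in>J. \<theta> i \<omega>)"
      using uniform_angles_AE_range[OF \<theta>, of k]
      by eventually_elim (intro mult_right_mono C, auto)
  qed
  also have "\<dots> = C * (\<integral>\<^sup>+\<omega>. F (\<lambda>i\<in>J. \<theta> i \<omega>) \<partial>M)" by (rule nn_integral_cmult[OF Fm])
  finally show ?thesis .
qed

text \<open>Peel off the end of the path, one vertex at a time.\<close>

lemma uniform_angles_path_integrals: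
  assumes \<theta>: "uniform_angles M \<theta>"
    and \<phi>[measurable]: "\<And>i. (\<lambda>(t, t'). \<phi> i t t') \<in> borel_measurable (borel \<Otimes>\<^sub>M borel)"
    and C: "\<And>i t'. 0 \<le> t' \<Longrightarrow> t' < 2 * pi \<Longrightarrow> (\<integral>\<^sup>+t\<in>{0..2*pi}. \<phi> i t t' \<partial>lborel) * ennreal (1 / (2 * pi)) \<le> C"
  shows "a \<noteq> b \<Longrightarrow> (\<integral>\<^sup>+\<omega>. \<phi> (1::nat) (\<theta> b \<omega>) (\<theta> a \<omega>) \<partial>M) \<le> C"
    and "distinct [a, b, c] \<Longrightarrow>
      (\<integral>\<^sup>+\<omega>. \<phi> 2 (\<theta> c \<omega>) (\<theta> b \<omega>) * \<phi> 1 (\<theta> b \<omega>) (\<theta> a \<omega>) \<partial>M) \<le> C * C"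
    and "distinct [a, b, c, d] \<Longrightarrow>
      (\<integral>\<^sup>+\<omega>. \<phi> 3 (\<theta> d \<omega>) (\<theta> c \<omega>) * (\<phi> 2 (\<theta> c \<omega>) (\<theta> b \<omega>) * \<phi> 1 (\<theta> b \<omega>) (\<theta> a \<omega>)) \<partial>M) \<le> C * (C * C)"
proof -
  interpret prob_space M using \<theta> by (simp add: uniform_angles_def)
  have comp[measurable]: "(\<lambda>v. v i) \<in> borel_measurable (PiM J (\<lambda>_. borel :: real measure))" if "i \<in> J" for i :: nat and J
    using that by (rule measurable_component_singleton)
  have edge: "(\<lambda>v. \<phi> n (v i) (v j)) \<in> borel_measurable (PiM J (\<lambda>_. borel :: real measure))"
    if "i \<in> J" "j \<in> J" for i j :: nat and J n
    using measurable_compose[OF measurable_Pair[OF comp[OF that(1)] comp[OF that(2)]] \<phi>[of n]] by simp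
  show 1: "(\<integral>\<^sup>+\<omega>. \<phi> (1::nat) (\<theta> b \<omega>) (\<theta> a \<omega>) \<partial>M) \<le> C" if "a \<noteq> b" for a b
  proof -
    have "(\<integral>\<^sup>+\<omega>. \<phi> 1 (\<theta> b \<omega>) (\<theta> a \<omega>) * (\<lambda>_. 1) (\<lambda>i\<in>{a}. \<theta> i \<omega>) \<partial>M) \<le> C * (\<integral>\<^sup>+\<omega>. (\<lambda>_. 1) (\<lambda>i\<in>{a}. \<theta> i \<omega>) \<partial>M)"
      by (rule uniform_angles_integrate_out_le[OF \<theta> _ _ _ \<phi> C, where l = b and J = "{a}" and k = a and F = "\<lambda>_. 1"])
         (use that in auto)
    then show ?thesis by (simp add: emeasure_space_1)
  qed
  show 2: "(\<integral>\<^sup>+\<omega>. \<phi> 2 (\<theta> c \<omega>) (\<theta> b \<omega>) * \<phi> 1 (\<theta> b \<omega>) (\<theta> a \<omega>) \<partial>M) \<le> C * C" if d: "distinct [a, b, c]" for a b c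
  proof -
    have [measurable]: "(\<lambda>v. \<phi> 1 (v b) (v a)) \<in> borel_measurable (PiM {a, b} (\<lambda>_. borel))"
      by (rule edge) auto
    have "(\<integral>\<^sup>+\<omega>. \<phi> 2 (\<theta> c \<omega>) (\<theta> b \<omega>) * \<phi> 1 (\<theta> b \<omega>) (\<theta> a \<omega>) \<partial>M) \<le> C * (\<integral>\<^sup>+\<omega>. \<phi> 1 (\<theta> b \<omega>) (\<theta> a \<omega>) \<partial>M)"
      using uniform_angles_integrate_out_le[OF \<theta> _ _ _ \<phi> C, of c "{a, b}" b "\<lambda>v. \<phi> 1 (v b) (v a)" 2] d by simp
    also have "\<dots> \<le> C * C" by (intro mult_left_mono 1) (use d in auto)
    finally show ?thesis .
  qed
  show "(\<integral>\<^sup>+\<omega>. \<phi> 3 (\<theta> d \<omega>) (\<theta> c \<omega>) * (\<phi> 2 (\<theta> c \<omega>) (\<theta> b \<omega>) * \<phi> 1 (\<theta> b \<omega>) (\<theta> a \<omega>)) \<partial>M) \<le> C * (C * C)"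
    if d: "distinct [a, b, c, d]"
  proof -
    have [measurable]: "(\<lambda>v. \<phi> 2 (v c) (v b) * \<phi> 1 (v b) (v a)) \<in> borel_measurable (PiM {a, b, c} (\<lambda>_. borel))"
      by (intro borel_measurable_times_ennreal edge) auto
    have "(\<integral>\<^sup>+\<omega>. \<phi> 3 (\<theta> d \<omega>) (\<theta> c \<omega>) * (\<phi> 2 (\<theta> c \<omega>) (\<theta> b \<omega>) * \<phi> 1 (\<theta> b \<omega>) (\<theta> a \<omega>)) \<partial>M)
       \<le> C * (\<integral>\<^sup>+\<omega>. \<phi> 2 (\<theta> c \<omega>) (\<theta> b \<omega>) * \<phi> 1 (\<theta> b \<omega>) (\<theta> a \<omega>) \<partial>M)"
      using uniform_angles_integrate_out_le[OF \<theta> _ _ _ \<phi> C, of d "{a, b, c}" c "\<lambda>v. \<phi> 2 (v c) (v b) * \<phi> 1 (v b) (v a)" 3] d by simp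
    also have "\<dots> \<le> C * (C * C)" by (intro mult_left_mono 2) (use d in auto)
    finally show ?thesis .
  qed
qed

section \<open>Expected size of a kernel entry\<close>

lemma norm_one_minus_cis_sq:
  "(norm (1 - complex_of_real r * cis u))\<^sup>2 = (1 - r)\<^sup>2 + 4 * r * (sin (u / 2))\<^sup>2"
proof -
  have "(norm (1 - complex_of_real r * cis u))\<^sup>2 = (1 - r * cos u)\<^sup>2 + (r * sin u)\<^sup>2"
    by (simp add: cmod_power2)
  also have "\<dots> = 1 - 2 * r * cos u + r\<^sup>2 * ((sin u)\<^sup>2 + (cos u)\<^sup>2)"
    by algebra
  also have "\<dots> = 1 - 2 * r * cos u + r\<^sup>2" by (simp only: sin_cos_squared_add mult_1_right)
  also have "cos u = 1 - 2 * (sin (u / 2))\<^sup>2" using cos_double_sin[of "u / 2"] by simp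
  finally show ?thesis by (simp add: power2_eq_square algebra_simps)
qed

lemma sin_ge_half:
  fixes x :: real
  assumes "0 \<le> x" "x \<le> pi / 2"
  shows "x / 2 \<le> sin x"
proof -
  let ?n = "Suc (Suc (Suc 0))"
  have e: "(\<Sum>m<?n. sin_coeff m * x ^ m) = x"
    by (simp add: sin_coeff_def)
  have "\<bar>sin x - x\<bar> \<le> inverse (fact ?n) * \<bar>x\<bar> ^ ?n"
    using Maclaurin_sin_bound[of x ?n] unfolding e .
  also have "inverse (fact ?n) * \<bar>x\<bar> ^ ?n = x ^ 3 / 6"
  proof -
    have f: "fact ?n = (6 :: real)" by simp
    have p: "\<bar>x\<bar> ^ ?n = x ^ 3" using assms(1) unfolding numeral_3_eq_3 by simp
    show ?thesis unfolding f p by simp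
  qed
  finally have "\<bar>sin x - x\<bar> \<le> x ^ 3 / 6" .
  moreover have "x ^ 3 \<le> 3 * x"
  proof -
    have "x \<le> 1.7" using assms pi_less_4 pi_approx by simp
    then have "x * x \<le> 1.7 * 1.7" using assms by (intro mult_mono) auto
    then have "x * (x * x) \<le> x * 3" using assms by (intro mult_left_mono) auto
    then show ?thesis by (simp add: power3_eq_cube mult_ac)
  qed
  ultimately show ?thesis by linarith
qed

text \<open>The distance from \<open>1\<close> to \<open>r * cis u\<close> is comparable to the sum of the radial gap \<open>1 - r\<close> and the
  angle \<open>|u|\<close>. For \<open>r \<ge> 1/2\<close> this follows from \<open>|sin (u/2)| \<ge> |u|/4\<close>; for smaller \<open>r\<close> the radial gap
  alone is at least \<open>1/2\<close>. The constant \<open>1/10\<close> serves both cases.\<close>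

lemma norm_one_minus_cis_ge:
  assumes r: "0 \<le> r" "r \<le> 1" and u: "\<bar>u\<bar> \<le> pi"
  shows "((1 - r) + \<bar>u\<bar>) / 10 \<le> norm (1 - complex_of_real r * cis u)"
proof (rule power2_le_imp_le)
  have "(\<bar>u\<bar> / 4)\<^sup>2 \<le> (sin (\<bar>u\<bar> / 2))\<^sup>2"
    using sin_ge_half[of "\<bar>u\<bar> / 2"] u by (intro power_mono) auto
  also have "(sin (\<bar>u\<bar> / 2))\<^sup>2 = (sin (u / 2))\<^sup>2" by (cases "u \<ge> 0") (simp_all add: abs_if)
  finally have sin: "\<bar>u\<bar>\<^sup>2 / 16 \<le> (sin (u / 2))\<^sup>2" by (simp add: power_divide)
  show "(((1 - r) + \<bar>u\<bar>) / 10)\<^sup>2 \<le> (norm (1 - complex_of_real r * cis u))\<^sup>2"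
  proof (cases "r \<ge> 1/2")
    case True
    have "((1 - r) + \<bar>u\<bar>)\<^sup>2 \<le> 2 * (1 - r)\<^sup>2 + 2 * \<bar>u\<bar>\<^sup>2"
      using sum_squares_bound[of "1 - r" "\<bar>u\<bar>"] unfolding power2_sum by linarith
    then have "(((1 - r) + \<bar>u\<bar>) / 10)\<^sup>2 \<le> (1 - r)\<^sup>2 / 50 + \<bar>u\<bar>\<^sup>2 / 50"
      by (simp add: power_divide)
    also have "\<dots> \<le> (1 - r)\<^sup>2 + 2 * (\<bar>u\<bar>\<^sup>2 / 16)"
      using zero_le_power2[of "1 - r"] zero_le_power2[of "\<bar>u\<bar>"] by linarith
    also have "2 * (\<bar>u\<bar>\<^sup>2 / 16) \<le> (4 * r) * (sin (u / 2))\<^sup>2"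
      using True sin by (intro mult_mono) auto
    finally show ?thesis unfolding norm_one_minus_cis_sq by simp
  next
    case False
    have "((1 - r) + \<bar>u\<bar>) / 10 \<le> 1/2" using r u pi_less_4 by simp
    also have "1/2 \<le> 1 - r" using False by simp
    finally have "(((1 - r) + \<bar>u\<bar>) / 10)\<^sup>2 \<le> (1 - r)\<^sup>2" using r by (intro power_mono) auto
    moreover have "0 \<le> 4 * r * (sin (u / 2))\<^sup>2" using r by simp
    ultimately show ?thesis unfolding norm_one_minus_cis_sq by linarith
  qed
qed simp

text \<open>For \<open>r = \<rho> j * \<rho> k\<close> and \<open>p = s\<close> this is the absolute value of the kernel \<open>(1 - cnj z * w) powr -s\<close>
  at the points with polar coordinates \<open>(\<rho> j, t)\<close> and \<open>(\<rho> k, t')\<close>; products of kernel entries are thought of as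
  graphs with these edges, and other exponents \<open>p\<close> arise from estimating them.\<close>

definition edge_weight :: "real \<Rightarrow> real \<Rightarrow> real \<Rightarrow> real \<Rightarrow> ennreal" where
  "edge_weight r p t t' = ennreal (norm (1 - complex_of_real r * cis (t - t')) powr (- p))"

lemma edge_weight_measurable [measurable]:
  "(\<lambda>(t, t'). edge_weight r p t t') \<in> borel_measurable (borel \<Otimes>\<^sub>M borel)"
proof -
  have "(\<lambda>x :: real \<times> real. norm (1 - complex_of_real r * cis (fst x - snd x))) \<in> borel_measurable borel"
    by (intro borel_measurable_continuous_onI continuous_intros)
  then have [measurable]: "(\<lambda>x :: real \<times> real. norm (1 - complex_of_real r * cis (fst x - snd x))) \<in> borel_measurable (borel \<Otimes>\<^sub>M borel)"
    by (simp only: borel_prod)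
  show ?thesis unfolding edge_weight_def case_prod_beta' by measurable
qed

lemma edge_weight_commute: "edge_weight r p t t' = edge_weight r p t' t"
proof -
  have "norm (1 - complex_of_real r * cis (t - t')) = norm (cnj (1 - complex_of_real r * cis (t - t')))"
    by (simp only: complex_mod_cnj)
  also have "cnj (1 - complex_of_real r * cis (t - t')) = 1 - complex_of_real r * cis (t' - t)"
    by (simp add: cis_cnj)
  finally show ?thesis by (simp only: edge_weight_def)
qed

lemma nn_integral_even_shift:
  fixes h :: "real \<Rightarrow> ennreal"
  assumes h[measurable]: "h \<in> borel_measurable borel" and neg: "\<And>v. v < 0 \<Longrightarrow> h v = 0"
  shows "(\<integral>\<^sup>+t. h \<bar>t - c\<bar> \<partial>lborel) \<le> 2 * (\<integral>\<^sup>+t. h t \<partial>lborel)"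
proof -
  have "(\<integral>\<^sup>+t. h \<bar>t - c\<bar> \<partial>lborel) = (\<integral>\<^sup>+t. h \<bar>t\<bar> \<partial>lborel)"
    using nn_integral_shift_real[of "\<lambda>t. h \<bar>t\<bar>" "- c"] by simp
  also have "\<dots> \<le> (\<integral>\<^sup>+t. h t + h (- t) \<partial>lborel)"
    by (intro nn_integral_mono) (auto simp: abs_if)
  also have "\<dots> = (\<integral>\<^sup>+t. h t \<partial>lborel) + (\<integral>\<^sup>+t. h (- t) \<partial>lborel)"
    by (rule nn_integral_add) measurable
  also have "(\<integral>\<^sup>+t. h (- t) \<partial>lborel) = (\<integral>\<^sup>+t. h t \<partial>lborel)"
    by (subst (2) lborel_distr_uminus[symmetric], subst nn_integral_distr) auto
  finally show ?thesis by (simp only: mult_2)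
qed

text \<open>Up to constants, the integral of \<open>(1 - r + v) powr -p\<close> over \<open>0 \<le> v \<le> pi\<close>: bounded uniformly
  in \<open>r\<close> below the critical exponent \<open>p = 1\<close> and a power of \<open>1 - r\<close> above it. At \<open>p = 1\<close> the integral is
  logarithmic, so that case is excluded throughout.\<close>

definition edge_bound :: "real \<Rightarrow> real \<Rightarrow> real" where
  "edge_bound r p = 10 powr p * (if p < 1 then 5 / (1 - p) else (1 - r) powr (1 - p) / (p - 1))"

lemma nn_integral_shifted_power_le:
  assumes r: "0 \<le> r" "r < 1" and p: "0 < p" "p \<noteq> 1"
  shows "(\<integral>\<^sup>+v. ennreal ((((1 - r) + v) / 10) powr (- p)) * indicator {0..pi} v \<partial>lborel) \<le> ennreal (edge_bound r p)"
proof -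
  define b where "b = 1 - r"
  have b: "b > 0" "b \<le> 1" using r by (auto simp: b_def)
  let ?F = "\<lambda>v. 10 powr p * ((b + v) powr (1 - p) / (1 - p))"
  have I: "((\<lambda>v. ((b + v) / 10) powr (- p)) has_integral (?F pi - ?F 0)) {0..pi}"
  proof (rule fundamental_theorem_of_calculus)
    fix v assume v: "v \<in> {0..pi}"
    have "((\<lambda>v. (b + v) powr (1 - p)) has_real_derivative (1 - p) * (b + v) powr (1 - p - 1)) (at v within {0..pi})"
      using b v by (auto intro!: derivative_eq_intros)
    then have "(?F has_real_derivative 10 powr p * ((1 - p) * (b + v) powr (1 - p - 1) / (1 - p))) (at v within {0..pi})"
      by (intro DERIV_cmult DERIV_cdivide)
    also have "10 powr p * ((1 - p) * (b + v) powr (1 - p - 1) / (1 - p)) = ((b + v) / 10) powr (- p)"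
      using b v p by (simp add: powr_divide powr_minus_divide)
    finally show "(?F has_vector_derivative ((b + v) / 10) powr (- p)) (at v within {0..pi})"
      by (simp only: has_real_derivative_iff_has_vector_derivative)
  qed simp
  have "(\<integral>\<^sup>+v. ennreal ((((1 - r) + v) / 10) powr (- p)) * indicator {0..pi} v \<partial>lborel)
     = (\<integral>\<^sup>+v. ennreal (indicator {0..pi} v * ((b + v) / 10) powr (- p)) \<partial>lborel)"
    by (intro nn_integral_cong) (auto simp: indicator_def b_def)
  also have "\<dots> = ennreal (?F pi - ?F 0)"
    by (rule nn_integral_has_integral_lebesgue[OF _ I]) simp
  also have "?F pi - ?F 0 \<le> edge_bound r p"
  proof (cases "p < 1")
    case True
    have "(b + pi) powr (1 - p) \<le> 5 powr (1 - p)" using b True pi_less_4 by (intro powr_mono2) auto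
    also have "\<dots> \<le> 5 powr 1" using p by (intro powr_mono) auto
    also have "5 powr 1 = (5 :: real)" by simp
    finally have "(b + pi) powr (1 - p) - b powr (1 - p) \<le> 5" using powr_ge_zero[of b "1 - p"] by linarith
    then have "((b + pi) powr (1 - p) - b powr (1 - p)) / (1 - p) \<le> 5 / (1 - p)"
      using True by (intro divide_right_mono) auto
    then have "10 powr p * (((b + pi) powr (1 - p) - b powr (1 - p)) / (1 - p)) \<le> 10 powr p * (5 / (1 - p))"
      by (rule mult_left_mono) simp
    then show ?thesis using True by (simp add: edge_bound_def right_diff_distrib diff_divide_distrib)
  next
    case False
    then have p1: "p > 1" using p by simp
    have "(b powr (1 - p) - (b + pi) powr (1 - p)) / (p - 1) \<le> b powr (1 - p) / (p - 1)"
      using p1 by (intro divide_right_mono) auto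
    then have "10 powr p * ((b powr (1 - p) - (b + pi) powr (1 - p)) / (p - 1)) \<le> 10 powr p * (b powr (1 - p) / (p - 1))"
      by (rule mult_left_mono) simp
    moreover have "?F pi - ?F 0 = 10 powr p * ((b powr (1 - p) - (b + pi) powr (1 - p)) / (p - 1))"
    proof -
      have "?F pi - ?F 0 = 10 powr p * (((b + pi) powr (1 - p) - b powr (1 - p)) / (1 - p))"
        by (simp add: right_diff_distrib diff_divide_distrib)
      also have "((b + pi) powr (1 - p) - b powr (1 - p)) / (1 - p) = (b powr (1 - p) - (b + pi) powr (1 - p)) / (p - 1)"
        by (subst frac_eq_eq) (use p in \<open>auto simp: algebra_simps\<close>)
      finally show ?thesis .
    qed
    ultimately show ?thesis using False by (simp add: edge_bound_def b_def)
  qed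
  finally show ?thesis by (simp add: ennreal_leI)
qed

text \<open>Modulo \<open>2 * pi\<close> every angle is within \<open>pi\<close> of one of \<open>t'\<close>, \<open>t' + 2 * pi\<close>, \<open>t' - 2 * pi\<close>, and
  near each of these centres the lower bound for \<open>|1 - r * cis u|\<close> applies. Three centres with two sides each
  give a factor \<open>6\<close>, which is absorbed by the density \<open>1 / (2 * pi)\<close>.\<close>

lemma edge_weight_integral_le:
  assumes r: "0 \<le> r" "r < 1" and p: "0 < p" "p \<noteq> 1" and t': "0 \<le> t'" "t' < 2 * pi"
  shows "(\<integral>\<^sup>+t\<in>{0..2*pi}. edge_weight r p t t' \<partial>lborel) * ennreal (1 / (2 * pi)) \<le> ennreal (edge_bound r p)"
proof -
  define h where "h v = ennreal ((((1 - r) + v) / 10) powr (- p)) * indicator {0..pi} v" for v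
  have hm[measurable]: "h \<in> borel_measurable borel" unfolding h_def by measurable
  have near: "edge_weight r p t t' \<le> h \<bar>t - c\<bar>" if c: "cis (t - t') = cis (t - c)" "\<bar>t - c\<bar> \<le> pi" for t c
  proof -
    have "((1 - r) + \<bar>t - c\<bar>) / 10 \<le> norm (1 - complex_of_real r * cis (t - c))"
      by (rule norm_one_minus_cis_ge) (use r c in auto)
    then have "norm (1 - complex_of_real r * cis (t - t')) powr (- p) \<le> (((1 - r) + \<bar>t - c\<bar>) / 10) powr (- p)"
      unfolding c(1) using p r by (intro powr_mono2') auto
    then show ?thesis using c(2) by (simp add: edge_weight_def h_def ennreal_leI)
  qed
  have cover: "edge_weight r p t t' \<le> h \<bar>t - t'\<bar> + h \<bar>t - (t' + 2 * pi)\<bar> + h \<bar>t - (t' - 2 * pi)\<bar>"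
    if t: "t \<in> {0..2*pi}" for t
  proof -
    consider "\<bar>t - t'\<bar> \<le> pi" | "\<bar>t - (t' + 2 * pi)\<bar> \<le> pi" | "\<bar>t - (t' - 2 * pi)\<bar> \<le> pi"
      using t t' by (auto simp: abs_le_iff) linarith
    then show ?thesis
    proof cases
      case 1
      then have "edge_weight r p t t' \<le> h \<bar>t - t'\<bar>" by (intro near) auto
      from add_mono[OF add_mono[OF this zero_le] zero_le] show ?thesis by (simp only: add_0_right)
    next
      case 2
      have "cis (t - t') = cis (t - (t' + 2 * pi))" by (simp add: complex_eq_iff cos_diff sin_diff cos_add sin_add)
      then have "edge_weight r p t t' \<le> h \<bar>t - (t' + 2 * pi)\<bar>" using 2 by (intro near)
      from add_mono[OF add_mono[OF zero_le this] zero_le] show ?thesis by (simp only: add_0_right add_0_left)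
    next
      case 3
      have "cis (t - t') = cis (t - (t' - 2 * pi))" by (simp add: complex_eq_iff cos_diff sin_diff)
      then have "edge_weight r p t t' \<le> h \<bar>t - (t' - 2 * pi)\<bar>" using 3 by (intro near)
      from add_mono[OF add_mono[OF zero_le zero_le] this] show ?thesis by (simp only: add_0_right add_0_left)
    qed
  qed
  have hI: "(\<integral>\<^sup>+t. h \<bar>t - c\<bar> \<partial>lborel) \<le> 2 * ennreal (edge_bound r p)" for c
  proof -
    have "(\<integral>\<^sup>+t. h \<bar>t - c\<bar> \<partial>lborel) \<le> 2 * (\<integral>\<^sup>+t. h t \<partial>lborel)"
      by (rule nn_integral_even_shift[OF hm]) (simp add: h_def)
    also have "\<dots> \<le> 2 * ennreal (edge_bound r p)"
      unfolding h_def by (intro mult_left_mono nn_integral_shifted_power_le r p) simp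
    finally show ?thesis .
  qed
  have "(\<integral>\<^sup>+t\<in>{0..2*pi}. edge_weight r p t t' \<partial>lborel)
     \<le> (\<integral>\<^sup>+t. h \<bar>t - t'\<bar> + h \<bar>t - (t' + 2 * pi)\<bar> + h \<bar>t - (t' - 2 * pi)\<bar> \<partial>lborel)"
  proof (rule nn_integral_mono)
    fix t
    show "edge_weight r p t t' * indicator {0..2*pi} t \<le> h \<bar>t - t'\<bar> + h \<bar>t - (t' + 2 * pi)\<bar> + h \<bar>t - (t' - 2 * pi)\<bar>"
      using cover[of t] by (cases "t \<in> {0..2*pi}") auto
  qed
  also have "\<dots> = (\<integral>\<^sup>+t. h \<bar>t - t'\<bar> \<partial>lborel) + (\<integral>\<^sup>+t. h \<bar>t - (t' + 2 * pi)\<bar> \<partial>lborel) + (\<integral>\<^sup>+t. h \<bar>t - (t' - 2 * pi)\<bar> \<partial>lborel)"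
    by (subst nn_integral_add, measurable)+
  also have "\<dots> \<le> 2 * ennreal (edge_bound r p) + 2 * ennreal (edge_bound r p) + 2 * ennreal (edge_bound r p)"
    by (intro add_mono hI)
  also have "\<dots> = ennreal 6 * ennreal (edge_bound r p)"
    by (simp flip: distrib_right)
  finally have "(\<integral>\<^sup>+t\<in>{0..2*pi}. edge_weight r p t t' \<partial>lborel) * ennreal (1 / (2 * pi))
      \<le> ennreal 6 * ennreal (edge_bound r p) * ennreal (1 / (2 * pi))"
    by (rule mult_right_mono) simp
  also have "\<dots> = ennreal (6 / (2 * pi)) * ennreal (edge_bound r p)"
  proof -
    have "ennreal 6 * ennreal (1 / (2 * pi)) = ennreal (6 / (2 * pi))"
      by (subst ennreal_mult'[symmetric]) simp_all
    then show ?thesis by (metis mult.assoc mult.commute)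
  qed
  also have "\<dots> \<le> 1 * ennreal (edge_bound r p)"
  proof (rule mult_right_mono)
    have "6 / (2 * pi) \<le> 1" using pi_approx by simp
    then show "ennreal (6 / (2 * pi)) \<le> 1" using ennreal_leI by fastforce
  qed simp
  finally show ?thesis by simp
qed

section \<open>Moments of the random Gram matrix\<close>

text \<open>The reciprocal of the kernel norm of a point of radius \<open>\<rho> k\<close>, with \<open>s = 1 - \<alpha>\<close>. It is cut off outside the
  index set \<open>I\<close>, which will select one index for each point of the random set.\<close>

definition radial_weight :: "real \<Rightarrow> (nat \<Rightarrow> real) \<Rightarrow> nat set \<Rightarrow> nat \<Rightarrow> real" where
  "radial_weight s \<rho> I k = (if k \<in> I then (1 - (\<rho> k)\<^sup>2) powr (s / 2) else 0)"

text \<open>The off-diagonal part of the Gram matrix, as a function of the angles.\<close>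

definition gram_entry :: "real \<Rightarrow> (nat \<Rightarrow> real) \<Rightarrow> nat set \<Rightarrow> (nat \<Rightarrow> real) \<Rightarrow> nat \<Rightarrow> nat \<Rightarrow> ennreal" where
  "gram_entry s \<rho> I t j k = ennreal (if j = k then 0 else
     gram_weight s (radial_weight s \<rho> I) (\<lambda>k. complex_of_real (\<rho> k) * cis (t k)) j k)"

lemma radial_weight_nonneg [simp]: "0 \<le> radial_weight s \<rho> I k"
  by (simp add: radial_weight_def)

lemma gram_entry_commute: "gram_entry s \<rho> I t j k = gram_entry s \<rho> I t k j"
proof (cases "j = k")
  case False
  have "gram_weight s (radial_weight s \<rho> I) (\<lambda>k. complex_of_real (\<rho> k) * cis (t k)) j k
    = gram_weight s (radial_weight s \<rho> I) (\<lambda>k. complex_of_real (\<rho> k) * cis (t k)) k j"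
    by (rule gram_weight_commute)
  then show ?thesis using False not_sym[OF False] by (simp only: gram_entry_def if_False)
qed simp

lemma gram_entry_eq_edge_weight:
  assumes "j \<noteq> k"
  shows "gram_entry s \<rho> I t j k =
    ennreal (radial_weight s \<rho> I j * radial_weight s \<rho> I k) * edge_weight (\<rho> j * \<rho> k) s (t j) (t k)"
proof -
  have cz: "cnj (complex_of_real (\<rho> j) * cis (t j)) * (complex_of_real (\<rho> k) * cis (t k))
     = complex_of_real (\<rho> j * \<rho> k) * cis (t k - t j)"
  proof -
    have "cnj (cis (t j)) * cis (t k) = cis (t k - t j)" by (simp add: cis_cnj cis_mult)
    then show ?thesis by (simp add: mult_ac)
  qed
  have "gram_weight s (radial_weight s \<rho> I) (\<lambda>k. complex_of_real (\<rho> k) * cis (t k)) j k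
    = (radial_weight s \<rho> I j * radial_weight s \<rho> I k) * norm (1 - complex_of_real (\<rho> j * \<rho> k) * cis (t k - t j)) powr (- s)"
    unfolding gram_weight_def by (simp only: cz)
  then have "gram_entry s \<rho> I t j k
    = ennreal (radial_weight s \<rho> I j * radial_weight s \<rho> I k) * edge_weight (\<rho> j * \<rho> k) s (t k) (t j)"
    using assms by (simp add: gram_entry_def edge_weight_def ennreal_mult)
  then show ?thesis by (simp only: edge_weight_commute)
qed

lemma gram_entry_diag [simp]: "gram_entry s \<rho> I t k k = 0"
  by (simp add: gram_entry_def)

lemma edge_weight_power2: "(edge_weight r p t t')\<^sup>2 = edge_weight r (2 * p) t t'"
proof -
  have "(norm (1 - complex_of_real r * cis (t - t')) powr (- p))\<^sup>2 = norm (1 - complex_of_real r * cis (t - t')) powr (- (2 * p))"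
    by (simp add: power2_eq_square powr_add[symmetric])
  then show ?thesis unfolding edge_weight_def by (subst ennreal_power) simp_all
qed

lemma gram_entry_power2_le:
  "(gram_entry s \<rho> I t j k)\<^sup>2 \<le>
    ennreal ((radial_weight s \<rho> I j)\<^sup>2 * (radial_weight s \<rho> I k)\<^sup>2) * edge_weight (\<rho> j * \<rho> k) (2 * s) (t j) (t k)"
proof (cases "j = k")
  case False
  show ?thesis
    unfolding gram_entry_eq_edge_weight[OF False] power_mult_distrib edge_weight_power2
    by (subst ennreal_power) (simp_all add: power_mult_distrib)
qed simp

lemma norm_one_minus_cis_ge_gap:
  assumes "0 \<le> r"
  shows "1 - r \<le> norm (1 - complex_of_real r * cis u)"
  using norm_triangle_ineq2[of 1 "complex_of_real r * cis u"] assms by (simp add: norm_mult)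

context
  fixes M :: "'a measure" and \<theta> :: "nat \<Rightarrow> 'a \<Rightarrow> real" and \<rho> :: "nat \<Rightarrow> real" and s :: real and I :: "nat set"
  assumes \<theta>: "uniform_angles M \<theta>" and \<rho>: "\<And>k. 0 \<le> \<rho> k" "\<And>k. \<rho> k < 1" and s: "0 < s"
begin

abbreviation "W k \<equiv> ennreal ((radial_weight s \<rho> I k)\<^sup>2)"
abbreviation "E p j k \<omega> \<equiv> edge_weight (\<rho> j * \<rho> k) p (\<theta> j \<omega>) (\<theta> k \<omega>)"
abbreviation "G j k \<omega> \<equiv> gram_entry s \<rho> I (\<lambda>k. \<theta> k \<omega>) j k"

lemma radii_prod: "0 \<le> \<rho> j * \<rho> k" "\<rho> j * \<rho> k < 1"
proof -
  show "0 \<le> \<rho> j * \<rho> k" using \<rho> by simp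
  have "\<rho> j * \<rho> k \<le> 1 * \<rho> k" using \<rho>[of j] \<rho>[of k] by (intro mult_right_mono) auto
  then show "\<rho> j * \<rho> k < 1" using \<rho>(2)[of k] by simp
qed

lemma E_measurable [measurable]: "(\<lambda>\<omega>. E p j k \<omega>) \<in> borel_measurable M"
proof -
  note [measurable] = uniform_angles_measurable[OF \<theta>]
  have "(\<lambda>\<omega>. (\<theta> j \<omega>, \<theta> k \<omega>)) \<in> measurable M (borel \<Otimes>\<^sub>M borel)" by measurable
  from measurable_compose[OF this edge_weight_measurable[of "\<rho> j * \<rho> k" p]] show ?thesis by simp
qed

lemma G_measurable [measurable]: "(\<lambda>\<omega>. G j k \<omega>) \<in> borel_measurable M"
proof (cases "j = k")
  case False
  show ?thesis unfolding gram_entry_eq_edge_weight[OF False] by measurable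
qed simp

lemma edge_expectation_le:
  assumes "j \<noteq> k" "0 < p" "p \<noteq> 1"
  shows "(\<integral>\<^sup>+\<omega>. E p j k \<omega> \<partial>M) \<le> ennreal (edge_bound (\<rho> j * \<rho> k) p)"
  by (rule uniform_angles_path_integrals(1)[OF \<theta>, where \<phi> = "\<lambda>_. edge_weight (\<rho> j * \<rho> k) p"])
     (use assms radii_prod edge_weight_integral_le in auto)

text \<open>The second moment suffices away from the critical exponent: a finite expectation makes the
  Hilbert-Schmidt norm of \<open>G\<close> finite almost surely, and \<open>\<parallel>G\<^sup>T G\<parallel> \<le> \<parallel>G\<parallel>\<^sup>2\<close> in that norm.\<close>

lemma AE_gram_square_finite_of_hilbert_schmidt:
  assumes p: "2 * s \<noteq> 1"
    and fin: "(\<Sum>k. \<Sum>j. W j * W k * ennreal (edge_bound (\<rho> j * \<rho> k) (2 * s))) < \<infinity>"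
  shows "AE \<omega> in M. (\<Sum>k. \<Sum>l. (\<Sum>j. G j k \<omega> * G j l \<omega>)\<^sup>2) < \<infinity>"
proof -
  have "(\<integral>\<^sup>+\<omega>. (\<Sum>k. \<Sum>j. (G j k \<omega>)\<^sup>2) \<partial>M) = (\<Sum>k. \<Sum>j. \<integral>\<^sup>+\<omega>. (G j k \<omega>)\<^sup>2 \<partial>M)"
    by (subst nn_integral_suminf, measurable)+
  also have "\<dots> \<le> (\<Sum>k. \<Sum>j. W j * W k * ennreal (edge_bound (\<rho> j * \<rho> k) (2 * s)))"
  proof (intro suminf_le allI)
    fix k j
    show "(\<integral>\<^sup>+\<omega>. (G j k \<omega>)\<^sup>2 \<partial>M) \<le> W j * W k * ennreal (edge_bound (\<rho> j * \<rho> k) (2 * s))"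
    proof (cases "j = k")
      case False
      have "(\<integral>\<^sup>+\<omega>. (G j k \<omega>)\<^sup>2 \<partial>M) \<le> (\<integral>\<^sup>+\<omega>. (W j * W k) * E (2 * s) j k \<omega> \<partial>M)"
        by (intro nn_integral_mono order_trans[OF gram_entry_power2_le]) (simp add: ennreal_mult)
      also have "\<dots> = (W j * W k) * (\<integral>\<^sup>+\<omega>. E (2 * s) j k \<omega> \<partial>M)"
        by (rule nn_integral_cmult) measurable
      also have "\<dots> \<le> (W j * W k) * ennreal (edge_bound (\<rho> j * \<rho> k) (2 * s))"
        by (intro mult_left_mono edge_expectation_le) (use False s p in auto)
      finally show ?thesis .
    qed simp
  qed auto
  also note fin
  finally have "(\<integral>\<^sup>+\<omega>. (\<Sum>k. \<Sum>j. (G j k \<omega>)\<^sup>2) \<partial>M) \<noteq> \<infinity>" by simp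
  then have "AE \<omega> in M. (\<Sum>k. \<Sum>j. (G j k \<omega>)\<^sup>2) \<noteq> \<infinity>"
    by (intro nn_integral_PInf_AE) measurable
  then show ?thesis
  proof eventually_elim
    fix \<omega> assume fin: "(\<Sum>k. \<Sum>j. (G j k \<omega>)\<^sup>2) \<noteq> \<infinity>"
    have "(\<Sum>k. \<Sum>l. (\<Sum>j. G j k \<omega> * G j l \<omega>)\<^sup>2) \<le> (\<Sum>k. \<Sum>l. (\<Sum>j. (G j k \<omega>)\<^sup>2) * (\<Sum>j. (G j l \<omega>)\<^sup>2))"
      by (intro suminf_le allI Cauchy_Schwarz_suminf_ennreal) auto
    also have "\<dots> = (\<Sum>k. \<Sum>j. (G j k \<omega>)\<^sup>2) * (\<Sum>k. \<Sum>j. (G j k \<omega>)\<^sup>2)"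
      unfolding ennreal_suminf_cmult ennreal_suminf_multc ..
    also have "\<dots> < \<infinity>" using fin by (intro ennreal_mult_less_infinity) (simp_all add: less_top)
    finally show "(\<Sum>k. \<Sum>l. (\<Sum>j. G j k \<omega> * G j l \<omega>)\<^sup>2) < \<infinity>" .
  qed
qed

text \<open>The smallest of four factors is at most the cube root of the product of the other three.\<close>

lemma four_product_le:
  fixes a b c d :: real
  assumes "0 < a" "0 < b" "0 < c" "0 < d"
  shows "a * b * c * d \<le> b powr (4/3) * c powr (4/3) * d powr (4/3) + a powr (4/3) * c powr (4/3) * d powr (4/3)
    + a powr (4/3) * b powr (4/3) * d powr (4/3) + a powr (4/3) * b powr (4/3) * c powr (4/3)"
proof -
  have main: "x * (y * z * w) \<le> y powr (4/3) * z powr (4/3) * w powr (4/3)"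
    if pos: "0 < x" "0 < y" "0 < z" "0 < w" and le: "x \<le> y" "x \<le> z" "x \<le> w" for x y z w :: real
  proof -
    have "x * x * x \<le> y * z * w" using pos le by (intro mult_mono) auto
    then have "(x * x * x) powr (1/3) \<le> (y * z * w) powr (1/3)" using pos by (intro powr_mono2) auto
    moreover have "(x * x * x) powr (1/3) = x"
      using pos by (simp add: powr_mult powr_add[symmetric])
    ultimately have "x \<le> (y * z * w) powr (1/3)" by simp
    then have "x * (y * z * w) \<le> (y * z * w) powr (1/3) * (y * z * w)"
      using pos by (intro mult_right_mono) auto
    also have "\<dots> = (y * z * w) powr (1/3) * (y * z * w) powr 1" using pos by simp
    also have "\<dots> = (y * z * w) powr (4/3)" unfolding powr_add[symmetric] by simp
    also have "\<dots> = y powr (4/3) * z powr (4/3) * w powr (4/3)" using pos by (simp add: powr_mult)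
    finally show ?thesis .
  qed
  have nn: "0 \<le> x powr (4/3) * y powr (4/3) * z powr (4/3)" for x y z :: real by simp
  note n4 = nn[of b c d] nn[of a c d] nn[of a b d] nn[of a b c]
  consider "a \<le> b" "a \<le> c" "a \<le> d" | "b \<le> a" "b \<le> c" "b \<le> d" | "c \<le> a" "c \<le> b" "c \<le> d" | "d \<le> a" "d \<le> b" "d \<le> c"
    by linarith
  then show ?thesis
  proof cases
    case 1
    have "a * b * c * d = a * (b * c * d)" by simp
    then show ?thesis using main[of a b c d] 1 assms n4 by linarith
  next
    case 2
    have "a * b * c * d = b * (a * c * d)" by simp
    then show ?thesis using main[of b a c d] 2 assms n4 by linarith
  next
    case 3
    have "a * b * c * d = c * (a * b * d)" by simp
    then show ?thesis using main[of c a b d] 3 assms n4 by linarith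
  next
    case 4
    have "a * b * c * d = d * (a * b * c)" by simp
    then show ?thesis using main[of d a b c] 4 assms n4 by linarith
  qed
qed

lemma edge_norm_pos: "0 < norm (1 - complex_of_real (\<rho> j * \<rho> k) * cis u)"
  using norm_one_minus_cis_ge_gap[OF radii_prod(1), of j k u] radii_prod(2)[of j k] by linarith

text \<open>The four edges form a cycle \<open>k - j - l - m - k\<close>, whose expectation does not factor. Removing its smallest edge
  leaves a path, at the price of raising the exponent from \<open>s\<close> to \<open>4 * s / 3\<close>; for \<open>s \<le> 1/2\<close>
  this stays at most \<open>2/3\<close>, below the critical exponent \<open>1\<close>.\<close>

lemma four_edges_le:
  "E s j k \<omega> * E s j l \<omega> * E s m l \<omega> * E s m k \<omega> \<le>
    E (4 * s / 3) j l \<omega> * (E (4 * s / 3) l m \<omega> * E (4 * s / 3) m k \<omega>)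
    + E (4 * s / 3) l m \<omega> * (E (4 * s / 3) m k \<omega> * E (4 * s / 3) k j \<omega>)
    + E (4 * s / 3) m k \<omega> * (E (4 * s / 3) k j \<omega> * E (4 * s / 3) j l \<omega>)
    + E (4 * s / 3) k j \<omega> * (E (4 * s / 3) j l \<omega> * E (4 * s / 3) l m \<omega>)"
proof -
  define x where "x j k = norm (1 - complex_of_real (\<rho> j * \<rho> k) * cis (\<theta> j \<omega> - \<theta> k \<omega>))" for j k
  have x: "x j k > 0" for j k unfolding x_def by (rule edge_norm_pos)
  have E: "E p j k \<omega> = ennreal (x j k powr (- p))" for p j k by (simp add: edge_weight_def x_def)
  have xc: "x j k = x k j" for j k
  proof -
    have "x j k = norm (cnj (1 - complex_of_real (\<rho> j * \<rho> k) * cis (\<theta> j \<omega> - \<theta> k \<omega>)))"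
      unfolding x_def by (simp only: complex_mod_cnj)
    also have "cnj (1 - complex_of_real (\<rho> j * \<rho> k) * cis (\<theta> j \<omega> - \<theta> k \<omega>)) = 1 - complex_of_real (\<rho> k * \<rho> j) * cis (\<theta> k \<omega> - \<theta> j \<omega>)"
      by (simp add: cis_cnj mult.commute)
    finally show ?thesis by (simp only: x_def)
  qed
  have pw: "(x j k powr (- s)) powr (4/3) = x j k powr (- (4 * s / 3))" for j k
    by (simp add: powr_powr mult.commute)
  define a b c d where abcd: "a = x j k powr (- s)" "b = x j l powr (- s)" "c = x l m powr (- s)" "d = x m k powr (- s)"
  have "a * b * c * d \<le> b powr (4/3) * c powr (4/3) * d powr (4/3) + a powr (4/3) * c powr (4/3) * d powr (4/3)
    + a powr (4/3) * b powr (4/3) * d powr (4/3) + a powr (4/3) * b powr (4/3) * c powr (4/3)"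
    by (rule four_product_le) (use x in \<open>simp_all add: abcd less_imp_neq[symmetric]\<close>)
  then have "ennreal (a * b * c * d) \<le> ennreal (b powr (4/3) * (c powr (4/3) * d powr (4/3)) + c powr (4/3) * (d powr (4/3) * a powr (4/3))
    + d powr (4/3) * (a powr (4/3) * b powr (4/3)) + a powr (4/3) * (b powr (4/3) * c powr (4/3)))"
    by (intro ennreal_leI) (simp only: mult_ac)
  then show ?thesis
    unfolding E xc[of m l] xc[of k j] abcd pw
    by (simp only: ennreal_mult ennreal_plus powr_ge_zero mult_nonneg_nonneg add_nonneg_nonneg)
qed

lemma path3_expectation_le:
  assumes "distinct [a, b, c, d]" and p: "0 < p" "p < 1"
  shows "(\<integral>\<^sup>+\<omega>. E p a b \<omega> * (E p b c \<omega> * E p c d \<omega>) \<partial>M) \<le> ennreal (edge_bound 0 p) * (ennreal (edge_bound 0 p) * ennreal (edge_bound 0 p))"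
proof -
  define r where "r i = (if i = (3::nat) then \<rho> a * \<rho> b else if i = 2 then \<rho> b * \<rho> c else \<rho> c * \<rho> d)" for i
  have r: "0 \<le> r i" "r i < 1" for i using radii_prod by (auto simp: r_def)
  define \<phi> where "\<phi> i = edge_weight (r i) p" for i
  have "(\<integral>\<^sup>+\<omega>. \<phi> 3 (\<theta> a \<omega>) (\<theta> b \<omega>) * (\<phi> 2 (\<theta> b \<omega>) (\<theta> c \<omega>) * \<phi> 1 (\<theta> c \<omega>) (\<theta> d \<omega>)) \<partial>M)
     \<le> ennreal (edge_bound 0 p) * (ennreal (edge_bound 0 p) * ennreal (edge_bound 0 p))"
  proof (rule uniform_angles_path_integrals(3)[OF \<theta>])
    show "(\<lambda>(t, t'). \<phi> i t t') \<in> borel_measurable (borel \<Otimes>\<^sub>M borel)" for i unfolding \<phi>_def by measurable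
    show "(\<integral>\<^sup>+t\<in>{0..2*pi}. \<phi> i t t' \<partial>lborel) * ennreal (1 / (2 * pi)) \<le> ennreal (edge_bound 0 p)"
      if "0 \<le> t'" "t' < 2 * pi" for i t'
    proof -
      have "edge_bound 0 p = edge_bound (r i) p" using p by (simp add: edge_bound_def)
      then show ?thesis unfolding \<phi>_def
        using edge_weight_integral_le[OF r p(1) _ that, of i] p(2) by simp
    qed
  qed (use assms in auto)
  then show ?thesis by (simp add: \<phi>_def r_def)
qed

lemma path2_expectation_le:
  assumes "distinct [a, b, c]" and p: "0 < p" "p < 1"
  shows "(\<integral>\<^sup>+\<omega>. E p a b \<omega> * E p b c \<omega> \<partial>M) \<le> ennreal (edge_bound 0 p) * ennreal (edge_bound 0 p)"
proof -
  define r where "r i = (if i = (2::nat) then \<rho> a * \<rho> b else \<rho> b * \<rho> c)" for i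
  have r: "0 \<le> r i" "r i < 1" for i using radii_prod by (auto simp: r_def)
  define \<phi> where "\<phi> i = edge_weight (r i) p" for i
  have "(\<integral>\<^sup>+\<omega>. \<phi> 2 (\<theta> a \<omega>) (\<theta> b \<omega>) * \<phi> 1 (\<theta> b \<omega>) (\<theta> c \<omega>) \<partial>M)
     \<le> ennreal (edge_bound 0 p) * ennreal (edge_bound 0 p)"
  proof (rule uniform_angles_path_integrals(2)[OF \<theta>])
    show "(\<lambda>(t, t'). \<phi> i t t') \<in> borel_measurable (borel \<Otimes>\<^sub>M borel)" for i unfolding \<phi>_def by measurable
    show "(\<integral>\<^sup>+t\<in>{0..2*pi}. \<phi> i t t' \<partial>lborel) * ennreal (1 / (2 * pi)) \<le> ennreal (edge_bound 0 p)"
      if "0 \<le> t'" "t' < 2 * pi" for i t'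
    proof -
      have "edge_bound 0 p = edge_bound (r i) p" using p by (simp add: edge_bound_def)
      then show ?thesis unfolding \<phi>_def
        using edge_weight_integral_le[OF r p(1) _ that, of i] p(2) by simp
    qed
  qed (use assms in auto)
  then show ?thesis by (simp add: \<phi>_def r_def)
qed

lemma gap_ge_half: "(1 - (\<rho> k)\<^sup>2) / 2 \<le> 1 - \<rho> j * \<rho> k"
proof -
  have "\<rho> j * \<rho> k \<le> 1 * \<rho> k" using \<rho>(1)[of k] \<rho>(2)[of j] by (intro mult_right_mono) auto
  moreover have "1 - (\<rho> k)\<^sup>2 = (1 - \<rho> k) * (1 + \<rho> k)" by (simp add: power2_eq_square algebra_simps)
  moreover have "(1 - \<rho> k) * (1 + \<rho> k) \<le> (1 - \<rho> k) * 2" using \<rho>(2)[of k] by (intro mult_left_mono) auto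
  ultimately show ?thesis by simp
qed

lemma one_minus_radius_sq_pos: "0 < 1 - (\<rho> k)\<^sup>2"
  using \<rho>[of k] by (simp add: power_less_one_iff)

text \<open>A loss of \<open>(1 - (\<rho> k)\<^sup>2) powr -s\<close> costs one of two available factors \<open>W k\<close>.\<close>

lemma radial_weight_cancel:
  "((radial_weight s \<rho> I k)\<^sup>2)\<^sup>2 * (1 - (\<rho> k)\<^sup>2) powr (- s) = (radial_weight s \<rho> I k)\<^sup>2"
proof (cases "k \<in> I")
  case True
  have "(radial_weight s \<rho> I k)\<^sup>2 = (1 - (\<rho> k)\<^sup>2) powr s"
    using True by (simp add: radial_weight_def power2_eq_square powr_add[symmetric])
  moreover have "(1 - (\<rho> k)\<^sup>2) powr s * (1 - (\<rho> k)\<^sup>2) powr (- s) = 1"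
    using one_minus_radius_sq_pos[of k] by (simp add: powr_add[symmetric])
  ultimately show ?thesis by (simp add: power2_eq_square)
qed (simp add: radial_weight_def)

text \<open>Degenerate 4-cycle with \<open>k = l\<close>: a path through \<open>k\<close> with exponent \<open>2 * s\<close>, which is critical when \<open>s = 1/2\<close>.
  Each edge gives up \<open>(1 - (\<rho> k)\<^sup>2) powr (- s / 2)\<close> to lower its exponent to \<open>3 * s / 2 \<le> 3/4\<close>, and the loss is paid by
  one of the two factors \<open>W k\<close>.\<close>

lemma star_expectation_le:
  assumes d: "distinct [j, k, m]" and s2: "s \<le> 1/2"
  shows "(\<integral>\<^sup>+\<omega>. (G j k \<omega>)\<^sup>2 * (G m k \<omega>)\<^sup>2 \<partial>M)
    \<le> ennreal (4 * (edge_bound 0 (3 * s / 2))\<^sup>2) * (W k * (W j * W m))"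
proof -
  define D where "D = 2 * (1 - (\<rho> k)\<^sup>2) powr (- s / 2)"
  have D0: "0 \<le> D" by (simp add: D_def)
  have edge: "E (2 * s) i k \<omega> \<le> ennreal D * E (3 * s / 2) i k \<omega>" for i \<omega>
  proof -
    define x where "x = norm (1 - complex_of_real (\<rho> i * \<rho> k) * cis (\<theta> i \<omega> - \<theta> k \<omega>))"
    have x: "(1 - (\<rho> k)\<^sup>2) / 2 \<le> x"
      unfolding x_def using gap_ge_half[of k i] norm_one_minus_cis_ge_gap[OF radii_prod(1)] by (rule order_trans)
    have pos: "0 < (1 - (\<rho> k)\<^sup>2) / 2" using one_minus_radius_sq_pos[of k] by simp
    have "x powr (- s / 2) \<le> ((1 - (\<rho> k)\<^sup>2) / 2) powr (- s / 2)"
      using x pos s by (intro powr_mono2') auto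
    also have "\<dots> = 2 powr (s / 2) * (1 - (\<rho> k)\<^sup>2) powr (- s / 2)"
      using one_minus_radius_sq_pos[of k] by (simp add: powr_divide powr_minus_divide)
    also have "\<dots> \<le> D"
    proof -
      have "2 powr (s / 2) \<le> 2 powr (1::real)" using s2 by (intro powr_mono) auto
      then show ?thesis unfolding D_def by (intro mult_right_mono) auto
    qed
    finally have "x powr (- s / 2) * x powr (- (3 * s / 2)) \<le> D * x powr (- (3 * s / 2))"
      by (rule mult_right_mono) simp
    then have "x powr (- (2 * s)) \<le> D * x powr (- (3 * s / 2))"
      by (simp add: powr_add[symmetric])
    then show ?thesis unfolding edge_weight_def x_def[symmetric]
      using D0 by (simp add: ennreal_mult[symmetric] ennreal_leI)
  qed
  have "(\<integral>\<^sup>+\<omega>. (G j k \<omega>)\<^sup>2 * (G m k \<omega>)\<^sup>2 \<partial>M)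
     \<le> (\<integral>\<^sup>+\<omega>. (W j * W k * ennreal D * (W m * W k * ennreal D)) * (E (3 * s / 2) j k \<omega> * E (3 * s / 2) k m \<omega>) \<partial>M)"
  proof (rule nn_integral_mono)
    fix \<omega>
    have le: "(G i k \<omega>)\<^sup>2 \<le> W i * W k * ennreal D * E (3 * s / 2) i k \<omega>" for i
    proof -
      have "(G i k \<omega>)\<^sup>2 \<le> W i * W k * E (2 * s) i k \<omega>"
        using gram_entry_power2_le[of s \<rho> I "\<lambda>k. \<theta> k \<omega>" i k] by (simp add: ennreal_mult)
      also have "\<dots> \<le> W i * W k * (ennreal D * E (3 * s / 2) i k \<omega>)" by (intro mult_left_mono edge) simp
      finally show ?thesis by (simp only: mult.assoc)
    qed
    have "(G j k \<omega>)\<^sup>2 * (G m k \<omega>)\<^sup>2 \<le> (W j * W k * ennreal D * E (3 * s / 2) j k \<omega>) * (W m * W k * ennreal D * E (3 * s / 2) m k \<omega>)"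
      by (intro mult_mono le) auto
    also have "E (3 * s / 2) m k \<omega> = E (3 * s / 2) k m \<omega>"
      unfolding edge_weight_commute[of _ _ "\<theta> m \<omega>"] by (simp only: mult.commute)
    finally show "(G j k \<omega>)\<^sup>2 * (G m k \<omega>)\<^sup>2 \<le> (W j * W k * ennreal D * (W m * W k * ennreal D)) * (E (3 * s / 2) j k \<omega> * E (3 * s / 2) k m \<omega>)"
      by (simp only: mult_ac)
  qed
  also have "\<dots> = (W j * W k * ennreal D * (W m * W k * ennreal D)) * (\<integral>\<^sup>+\<omega>. E (3 * s / 2) j k \<omega> * E (3 * s / 2) k m \<omega> \<partial>M)"
    by (rule nn_integral_cmult) measurable
  also have "\<dots> \<le> (W j * W k * ennreal D * (W m * W k * ennreal D)) * (ennreal (edge_bound 0 (3 * s / 2)) * ennreal (edge_bound 0 (3 * s / 2)))"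
    by (intro mult_left_mono path2_expectation_le) (use d s s2 in auto)
  also have "\<dots> = ennreal (4 * (edge_bound 0 (3 * s / 2))\<^sup>2) * (W k * (W j * W m))"
  proof -
    define w where "w i = (radial_weight s \<rho> I i)\<^sup>2" for i
    define b where "b = edge_bound 0 (3 * s / 2)"
    have b: "0 \<le> b" using s2 by (simp add: b_def edge_bound_def)
    have w: "0 \<le> w i" for i by (simp add: w_def)
    have DD: "(w k)\<^sup>2 * D\<^sup>2 = 4 * w k"
    proof -
      have "D\<^sup>2 = 4 * (1 - (\<rho> k)\<^sup>2) powr (- s)"
        by (simp add: D_def power2_eq_square powr_add[symmetric])
      then show ?thesis using radial_weight_cancel[of k] by (simp add: w_def)
    qed
    have "(w j * w k * D * (w m * w k * D)) * (b * b) = ((w k)\<^sup>2 * D\<^sup>2) * (b\<^sup>2 * (w j * w m))"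
      by (simp add: power2_eq_square mult_ac)
    also have "\<dots> = (4 * b\<^sup>2) * (w k * (w j * w m))" unfolding DD by (simp add: mult_ac)
    finally have "ennreal ((w j * w k * D * (w m * w k * D)) * (b * b)) = ennreal ((4 * b\<^sup>2) * (w k * (w j * w m)))" by (rule arg_cong)
    moreover have "0 \<le> 4 * b\<^sup>2" by simp
    ultimately show ?thesis unfolding w_def[symmetric] b_def[symmetric]
      using b w D0 by (simp only: ennreal_mult mult_nonneg_nonneg)
  qed
  finally show ?thesis .
qed

text \<open>Degenerate 4-cycle that collapses to a single edge with exponent \<open>4 * s\<close>, which
  may lie on either side of \<open>1\<close>. Comparing with exponent \<open>2\<close> avoids the case distinction: with \<open>m = 1 - \<rho> j * \<rho> k\<close>
  and \<open>x\<close> the modulus of \<open>1 - \<rho> j * \<rho> k * cis u\<close>, the number \<open>x powr (- 4 * s)\<close> is at most \<open>m powr (1 - 2 * s) * x powr -2\<close> if \<open>x\<^sup>2 \<le> m\<close> and at most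
  \<open>m powr (- 2 * s)\<close> otherwise. The expectation of \<open>x powr -2\<close> is at most \<open>100 / m\<close>, and trading \<open>m\<close> for the two
  numbers \<open>1 - (\<rho> i)\<^sup>2\<close> costs a factor \<open>4\<close>, whence \<open>404 = 4 * 101\<close>.\<close>

lemma edge_fourth_expectation_le:
  assumes d: "j \<noteq> k" and s2: "s \<le> 1/2"
  shows "(\<integral>\<^sup>+\<omega>. ((G j k \<omega>)\<^sup>2)\<^sup>2 \<partial>M) \<le> ennreal 404 * (W j * W k)"
proof -
  define w where "w i = (radial_weight s \<rho> I i)\<^sup>2" for i
  have w: "0 \<le> w i" for i by (simp add: w_def)
  define m where "m = 1 - \<rho> j * \<rho> k"
  have m: "m > 0" using radii_prod(2) by (simp add: m_def)
  have edge: "E (4 * s) j k \<omega> \<le> ennreal (m powr (1 - 2 * s)) * E 2 j k \<omega> + ennreal (m powr (- (2 * s)))" for \<omega>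
  proof -
    define x where "x = norm (1 - complex_of_real (\<rho> j * \<rho> k) * cis (\<theta> j \<omega> - \<theta> k \<omega>))"
    have x: "x > 0" unfolding x_def by (rule edge_norm_pos)
    have "x powr (- (4 * s)) \<le> m powr (1 - 2 * s) * x powr (- 2) + m powr (- (2 * s))"
    proof (cases "x powr 2 \<le> m")
      case True
      have "x powr (- (4 * s)) = (x powr 2) powr (1 - 2 * s) * x powr (- 2)"
        by (simp add: powr_powr powr_add[symmetric] algebra_simps)
      also have "\<dots> \<le> m powr (1 - 2 * s) * x powr (- 2)"
        using True s2 by (intro mult_right_mono powr_mono2) auto
      finally show ?thesis using powr_ge_zero[of m "- (2 * s)"] by linarith
    next
      case False
      have "x powr (- (4 * s)) = (x powr 2) powr (- (2 * s))" by (simp add: powr_powr)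
      also have "\<dots> \<le> m powr (- (2 * s))" using False s m by (intro powr_mono2') auto
      finally show ?thesis using mult_nonneg_nonneg[OF powr_ge_zero[of m "1 - 2 * s"] powr_ge_zero[of x "- 2"]] by linarith
    qed
    then show ?thesis unfolding edge_weight_def x_def[symmetric]
      by (simp add: ennreal_mult[symmetric] ennreal_plus[symmetric] ennreal_leI del: ennreal_plus)
  qed
  have mb: "m powr (1 - 2 * s) * edge_bound (\<rho> j * \<rho> k) 2 + m powr (- (2 * s)) \<le> 404 * ((1 - (\<rho> j)\<^sup>2) powr (- s) * (1 - (\<rho> k)\<^sup>2) powr (- s))"
  proof -
    have "edge_bound (\<rho> j * \<rho> k) 2 = 100 * m powr (- 1)" by (simp add: edge_bound_def m_def)
    then have "m powr (1 - 2 * s) * edge_bound (\<rho> j * \<rho> k) 2 = 100 * (m powr (1 - 2 * s) * m powr (- 1))" by simp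
    also have "m powr (1 - 2 * s) * m powr (- 1) = m powr (- (2 * s))" by (simp only: powr_add[symmetric]) simp
    finally have "m powr (1 - 2 * s) * edge_bound (\<rho> j * \<rho> k) 2 + m powr (- (2 * s)) = 101 * (m powr (- s) * m powr (- s))"
      by (simp add: powr_add[symmetric])
    also have "\<dots> \<le> 101 * ((2 * (1 - (\<rho> j)\<^sup>2) powr (- s)) * (2 * (1 - (\<rho> k)\<^sup>2) powr (- s)))"
    proof -
      have half: "m powr (- s) \<le> 2 * y powr (- s)" if y: "0 < y" "y / 2 \<le> m" for y
      proof -
        have "m powr (- s) \<le> (y / 2) powr (- s)" using y s by (intro powr_mono2') auto
        also have "\<dots> = 2 powr s * y powr (- s)" using y by (simp add: powr_divide powr_minus_divide)
        also have "\<dots> \<le> 2 powr 1 * y powr (- s)" using s2 by (intro mult_right_mono powr_mono) auto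
        finally show ?thesis by simp
      qed
      have "(1 - (\<rho> j)\<^sup>2) / 2 \<le> m" "(1 - (\<rho> k)\<^sup>2) / 2 \<le> m"
        using gap_ge_half[of j k] gap_ge_half[of k j] by (simp_all add: m_def mult.commute)
      then show ?thesis
        by (intro mult_left_mono mult_mono half one_minus_radius_sq_pos) auto
    qed
    finally show ?thesis by simp
  qed
  have "(\<integral>\<^sup>+\<omega>. ((G j k \<omega>)\<^sup>2)\<^sup>2 \<partial>M) \<le> (\<integral>\<^sup>+\<omega>. ennreal ((w j * w k)\<^sup>2) * E (4 * s) j k \<omega> \<partial>M)"
  proof (rule nn_integral_mono)
    fix \<omega>
    have "((G j k \<omega>)\<^sup>2)\<^sup>2 \<le> (ennreal (w j * w k) * E (2 * s) j k \<omega>)\<^sup>2"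
      unfolding w_def by (intro power_mono gram_entry_power2_le) simp
    also have "\<dots> = ennreal ((w j * w k)\<^sup>2) * E (2 * (2 * s)) j k \<omega>"
      unfolding power_mult_distrib edge_weight_power2 using w
      by (subst ennreal_power) (simp_all add: power_mult_distrib)
    finally show "((G j k \<omega>)\<^sup>2)\<^sup>2 \<le> ennreal ((w j * w k)\<^sup>2) * E (4 * s) j k \<omega>" by simp
  qed
  also have "\<dots> = ennreal ((w j * w k)\<^sup>2) * (\<integral>\<^sup>+\<omega>. E (4 * s) j k \<omega> \<partial>M)"
    by (rule nn_integral_cmult) measurable
  also have "(\<integral>\<^sup>+\<omega>. E (4 * s) j k \<omega> \<partial>M) \<le> (\<integral>\<^sup>+\<omega>. ennreal (m powr (1 - 2 * s)) * E 2 j k \<omega> + ennreal (m powr (- (2 * s))) \<partial>M)"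
    by (intro nn_integral_mono edge)
  also have "\<dots> = ennreal (m powr (1 - 2 * s)) * (\<integral>\<^sup>+\<omega>. E 2 j k \<omega> \<partial>M) + ennreal (m powr (- (2 * s)))"
  proof -
    interpret prob_space M using \<theta> by (simp add: uniform_angles_def)
    have "(\<integral>\<^sup>+\<omega>. ennreal (m powr (1 - 2 * s)) * E 2 j k \<omega> + ennreal (m powr (- (2 * s))) \<partial>M)
      = (\<integral>\<^sup>+\<omega>. ennreal (m powr (1 - 2 * s)) * E 2 j k \<omega> \<partial>M) + (\<integral>\<^sup>+\<omega>. ennreal (m powr (- (2 * s))) \<partial>M)"
      by (rule nn_integral_add) measurable
    also have "(\<integral>\<^sup>+\<omega>. ennreal (m powr (1 - 2 * s)) * E 2 j k \<omega> \<partial>M) = ennreal (m powr (1 - 2 * s)) * (\<integral>\<^sup>+\<omega>. E 2 j k \<omega> \<partial>M)"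
      by (rule nn_integral_cmult) measurable
    finally show ?thesis by (simp add: emeasure_space_1)
  qed
  also have "\<dots> \<le> ennreal (m powr (1 - 2 * s)) * ennreal (edge_bound (\<rho> j * \<rho> k) 2) + ennreal (m powr (- (2 * s)))"
    by (intro add_right_mono mult_left_mono edge_expectation_le[OF d]) auto
  also have "\<dots> = ennreal (m powr (1 - 2 * s) * edge_bound (\<rho> j * \<rho> k) 2 + m powr (- (2 * s)))"
  proof -
    have "0 \<le> edge_bound (\<rho> j * \<rho> k) 2" by (simp add: edge_bound_def)
    then show ?thesis by (simp only: ennreal_plus ennreal_mult powr_ge_zero mult_nonneg_nonneg)
  qed
  also have "\<dots> \<le> ennreal (404 * ((1 - (\<rho> j)\<^sup>2) powr (- s) * (1 - (\<rho> k)\<^sup>2) powr (- s)))"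
    by (rule ennreal_leI[OF mb])
  also have "ennreal ((w j * w k)\<^sup>2) * ennreal (404 * ((1 - (\<rho> j)\<^sup>2) powr (- s) * (1 - (\<rho> k)\<^sup>2) powr (- s))) = ennreal (404 * (w j * w k))"
  proof -
    have "(w j * w k)\<^sup>2 * (404 * ((1 - (\<rho> j)\<^sup>2) powr (- s) * (1 - (\<rho> k)\<^sup>2) powr (- s)))
      = 404 * (((w j)\<^sup>2 * (1 - (\<rho> j)\<^sup>2) powr (- s)) * ((w k)\<^sup>2 * (1 - (\<rho> k)\<^sup>2) powr (- s)))"
      by (simp only: power_mult_distrib mult_ac)
    also have "\<dots> = 404 * (w j * w k)" unfolding w_def radial_weight_cancel ..
    finally have e: "(w j * w k)\<^sup>2 * (404 * ((1 - (\<rho> j)\<^sup>2) powr (- s) * (1 - (\<rho> k)\<^sup>2) powr (- s))) = 404 * (w j * w k)" .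
    have "ennreal ((w j * w k)\<^sup>2) * ennreal (404 * ((1 - (\<rho> j)\<^sup>2) powr (- s) * (1 - (\<rho> k)\<^sup>2) powr (- s)))
      = ennreal ((w j * w k)\<^sup>2 * (404 * ((1 - (\<rho> j)\<^sup>2) powr (- s) * (1 - (\<rho> k)\<^sup>2) powr (- s))))"
      by (rule ennreal_mult[symmetric]) simp_all
    then show ?thesis unfolding e .
  qed
  also have "ennreal (404 * (w j * w k)) = ennreal 404 * (W j * W k)"
    using w by (simp only: ennreal_mult mult_nonneg_nonneg w_def[symmetric] zero_le_numeral)
  finally show ?thesis by (simp add: mult_left_mono)
qed

text \<open>Each vertex of a 4-cycle has degree two, so the radial weights combine to one
  factor \<open>W\<close> for each vertex.\<close>

lemma cycle_expectation_le:
  assumes d: "distinct [k, j, l, m]" and s2: "s \<le> 1/2"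
  shows "(\<integral>\<^sup>+\<omega>. G j k \<omega> * G j l \<omega> * (G m k \<omega> * G m l \<omega>) \<partial>M)
    \<le> ennreal (4 * (edge_bound 0 (4 * s / 3)) ^ 3) * (W k * (W l * (W j * W m)))"
proof -
  define U where "U i = radial_weight s \<rho> I i" for i
  have U: "0 \<le> U i" for i by (simp add: U_def)
  define p where "p = 4 * s / 3"
  have p: "0 < p" "p < 1" using s s2 by (auto simp: p_def)
  define b where "b = ennreal (edge_bound 0 p)"
  define V where "V = ennreal ((U j * U k) * (U j * U l) * ((U m * U k) * (U m * U l)))"
  have "(\<integral>\<^sup>+\<omega>. G j k \<omega> * G j l \<omega> * (G m k \<omega> * G m l \<omega>) \<partial>M) \<le>
    (\<integral>\<^sup>+\<omega>. V * (E p j l \<omega> * (E p l m \<omega> * E p m k \<omega>) + E p l m \<omega> * (E p m k \<omega> * E p k j \<omega>)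
      + E p m k \<omega> * (E p k j \<omega> * E p j l \<omega>) + E p k j \<omega> * (E p j l \<omega> * E p l m \<omega>)) \<partial>M)"
  proof (rule nn_integral_mono)
    fix \<omega>
    have ne: "j \<noteq> k" "j \<noteq> l" "m \<noteq> k" "m \<noteq> l" using d by auto
    have "G j k \<omega> * G j l \<omega> * (G m k \<omega> * G m l \<omega>) = V * (E s j k \<omega> * E s j l \<omega> * E s m l \<omega> * E s m k \<omega>)"
      unfolding gram_entry_eq_edge_weight[OF ne(1)] gram_entry_eq_edge_weight[OF ne(2)]
        gram_entry_eq_edge_weight[OF ne(3)] gram_entry_eq_edge_weight[OF ne(4)] V_def U_def[symmetric]
      using U by (simp only: ennreal_mult mult_nonneg_nonneg mult_ac)
    also have "\<dots> \<le> V * (E p j l \<omega> * (E p l m \<omega> * E p m k \<omega>) + E p l m \<omega> * (E p m k \<omega> * E p k j \<omega>)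
      + E p m k \<omega> * (E p k j \<omega> * E p j l \<omega>) + E p k j \<omega> * (E p j l \<omega> * E p l m \<omega>))"
      unfolding p_def by (intro mult_left_mono four_edges_le) simp
    finally show "G j k \<omega> * G j l \<omega> * (G m k \<omega> * G m l \<omega>) \<le> V * (E p j l \<omega> * (E p l m \<omega> * E p m k \<omega>) + E p l m \<omega> * (E p m k \<omega> * E p k j \<omega>)
      + E p m k \<omega> * (E p k j \<omega> * E p j l \<omega>) + E p k j \<omega> * (E p j l \<omega> * E p l m \<omega>))" .
  qed
  also have "\<dots> = V * (\<integral>\<^sup>+\<omega>. E p j l \<omega> * (E p l m \<omega> * E p m k \<omega>) + E p l m \<omega> * (E p m k \<omega> * E p k j \<omega>)
      + E p m k \<omega> * (E p k j \<omega> * E p j l \<omega>) + E p k j \<omega> * (E p j l \<omega> * E p l m \<omega>) \<partial>M)"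
    by (rule nn_integral_cmult) measurable
  also have "(\<integral>\<^sup>+\<omega>. E p j l \<omega> * (E p l m \<omega> * E p m k \<omega>) + E p l m \<omega> * (E p m k \<omega> * E p k j \<omega>)
      + E p m k \<omega> * (E p k j \<omega> * E p j l \<omega>) + E p k j \<omega> * (E p j l \<omega> * E p l m \<omega>) \<partial>M)
    = (\<integral>\<^sup>+\<omega>. E p j l \<omega> * (E p l m \<omega> * E p m k \<omega>) \<partial>M) + (\<integral>\<^sup>+\<omega>. E p l m \<omega> * (E p m k \<omega> * E p k j \<omega>) \<partial>M)
      + (\<integral>\<^sup>+\<omega>. E p m k \<omega> * (E p k j \<omega> * E p j l \<omega>) \<partial>M) + (\<integral>\<^sup>+\<omega>. E p k j \<omega> * (E p j l \<omega> * E p l m \<omega>) \<partial>M)"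
    by (subst nn_integral_add, measurable)+
  also have "\<dots> \<le> b * (b * b) + b * (b * b) + b * (b * b) + b * (b * b)"
    unfolding b_def by (intro add_mono path3_expectation_le p) (use d in auto)
  also have "b * (b * b) + b * (b * b) + b * (b * b) + b * (b * b) = ennreal (4 * (edge_bound 0 p) ^ 3)"
  proof -
    have b0: "0 \<le> edge_bound 0 p" using p by (simp add: edge_bound_def)
    have "4 * (edge_bound 0 p) ^ 3 = edge_bound 0 p * (edge_bound 0 p * edge_bound 0 p) + edge_bound 0 p * (edge_bound 0 p * edge_bound 0 p)
       + edge_bound 0 p * (edge_bound 0 p * edge_bound 0 p) + edge_bound 0 p * (edge_bound 0 p * edge_bound 0 p)"
      by (simp add: power3_eq_cube)
    then show ?thesis
      unfolding b_def using b0 by (simp only: ennreal_plus ennreal_mult mult_nonneg_nonneg add_nonneg_nonneg)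
  qed
  also have "V * ennreal (4 * (edge_bound 0 p) ^ 3) = ennreal (4 * (edge_bound 0 p) ^ 3) * (W k * (W l * (W j * W m)))"
  proof -
    have "V = W k * (W l * (W j * W m))"
      unfolding V_def U_def[symmetric] power2_eq_square using U by (simp only: ennreal_mult mult_nonneg_nonneg mult_ac)
    then show ?thesis by (simp only: mult.commute)
  qed
  finally show ?thesis unfolding p_def by (simp add: mult_left_mono)
qed

text \<open>The squared Hilbert-Schmidt norm of \<open>G\<^sup>T G\<close> is a sum over closed walks of length four. Its
  expectation splits into 4-cycles, stars and single edges, bounded by \<open>S\<^sup>4\<close>, \<open>S\<^sup>3\<close> and \<open>S\<^sup>2\<close> respectively, where
  \<open>S = \<Sum>k. W k\<close>. At \<open>s = 1/2\<close> the second moment of \<open>G\<close> itself contains a logarithm and need not be summable.\<close>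

lemma AE_gram_square_finite_of_summable:
  assumes s2: "s \<le> 1/2" and fin: "(\<Sum>k. W k) < \<infinity>"
  shows "AE \<omega> in M. (\<Sum>k. \<Sum>l. (\<Sum>j. G j k \<omega> * G j l \<omega>)\<^sup>2) < \<infinity>"
proof -
  define c1 where "c1 = ennreal (4 * (edge_bound 0 (4 * s / 3)) ^ 3)"
  define c2 where "c2 = ennreal (4 * (edge_bound 0 (3 * s / 2))\<^sup>2)"
  define C where "C = c1 + c2 + ennreal 404"
  have Cle: "c1 \<le> C" "c2 \<le> C" "ennreal 404 \<le> C"
    unfolding C_def
    using add_mono[OF add_mono[OF order_refl zero_le] zero_le, of c1 c2 "ennreal 404"]
      add_mono[OF add_mono[OF zero_le order_refl] zero_le, of c2 c1 "ennreal 404"]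
      add_mono[OF zero_le order_refl, of "ennreal 404" "c1 + c2"]
    by (simp_all only: add_0_left add_0_right)
  have Cfin: "C < \<infinity>" unfolding C_def c1_def c2_def by (simp del: ennreal_numeral)
  define \<delta> where "\<delta> k l = (if k = l then 1 else 0 :: ennreal)" for k l :: nat
  have \<delta>1: "(\<Sum>l. \<delta> k l) = 1" for k
    using suminf_finite[of "{k}" "\<lambda>l. \<delta> k l"] by (simp add: \<delta>_def)
  \<comment> \<open>The four terms belong to the 4-cycles, the two kinds of star (\<open>k = l\<close> or \<open>j = m\<close>) and the single edges.\<close>
  define Z where "Z k l j m = W k * (W l * (W j * W m)) + \<delta> k l * (W k * (W j * W m))
    + \<delta> j m * (W j * (W k * W l)) + \<delta> k l * (\<delta> j m * (W j * W k))" for k l j m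
  have bound: "(\<integral>\<^sup>+\<omega>. G j k \<omega> * G j l \<omega> * (G m k \<omega> * G m l \<omega>) \<partial>M) \<le> C * Z k l j m" for k l j m
  proof (cases "j = k \<or> j = l \<or> m = k \<or> m = l")
    case True
    then have "(\<lambda>\<omega>. G j k \<omega> * G j l \<omega> * (G m k \<omega> * G m l \<omega>)) = (\<lambda>\<omega>. 0)" by auto
    then show ?thesis by simp
  next
    case ne: False
    consider "k \<noteq> l" "j \<noteq> m" | "k = l" "j \<noteq> m" | "k \<noteq> l" "j = m" | "k = l" "j = m" by blast
    then show ?thesis
    proof cases
      case 1
      have "(\<integral>\<^sup>+\<omega>. G j k \<omega> * G j l \<omega> * (G m k \<omega> * G m l \<omega>) \<partial>M) \<le> c1 * (W k * (W l * (W j * W m)))"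
        unfolding c1_def by (rule cycle_expectation_le) (use 1 ne s2 in auto)
      also have "\<dots> \<le> C * (W k * (W l * (W j * W m)))" by (rule mult_right_mono[OF Cle(1)]) simp
      also have "\<dots> = C * Z k l j m" using 1 by (simp add: Z_def \<delta>_def)
      finally show ?thesis .
    next
      case 2
      have "(\<integral>\<^sup>+\<omega>. G j k \<omega> * G j l \<omega> * (G m k \<omega> * G m l \<omega>) \<partial>M) = (\<integral>\<^sup>+\<omega>. (G j k \<omega>)\<^sup>2 * (G m k \<omega>)\<^sup>2 \<partial>M)"
        using 2 by (simp add: power2_eq_square)
      also have "\<dots> \<le> c2 * (W k * (W j * W m))"
        unfolding c2_def by (rule star_expectation_le) (use 2 ne s2 in auto)
      also have "\<dots> \<le> C * (W k * (W j * W m))" by (rule mult_right_mono[OF Cle(2)]) simp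
      also have "\<dots> \<le> C * Z k l j m"
      proof (rule mult_left_mono)
        have "Z k l j m = W k * (W l * (W j * W m)) + W k * (W j * W m)" using 2 by (simp add: Z_def \<delta>_def)
        then show "W k * (W j * W m) \<le> Z k l j m"
          using add_mono[OF zero_le order_refl, of "W k * (W j * W m)" "W k * (W l * (W j * W m))"] by (simp only: add_0_left)
      qed simp
      finally show ?thesis .
    next
      case 3
      have "(\<integral>\<^sup>+\<omega>. G j k \<omega> * G j l \<omega> * (G m k \<omega> * G m l \<omega>) \<partial>M) = (\<integral>\<^sup>+\<omega>. (G k j \<omega>)\<^sup>2 * (G l j \<omega>)\<^sup>2 \<partial>M)"
      proof (rule nn_integral_cong)
        fix \<omega>
        have "G j k \<omega> = G k j \<omega>" "G j l \<omega> = G l j \<omega>" by (rule gram_entry_commute)+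
        then show "G j k \<omega> * G j l \<omega> * (G m k \<omega> * G m l \<omega>) = (G k j \<omega>)\<^sup>2 * (G l j \<omega>)\<^sup>2"
          using 3 by (simp add: power2_eq_square mult_ac)
      qed
      also have "\<dots> \<le> c2 * (W j * (W k * W l))"
        unfolding c2_def by (rule star_expectation_le) (use 3 ne s2 in auto)
      also have "\<dots> \<le> C * (W j * (W k * W l))" by (rule mult_right_mono[OF Cle(2)]) simp
      also have "\<dots> \<le> C * Z k l j m"
      proof (rule mult_left_mono)
        have "Z k l j m = W k * (W l * (W j * W m)) + W j * (W k * W l)" using 3 by (simp add: Z_def \<delta>_def)
        then show "W j * (W k * W l) \<le> Z k l j m"
          using add_mono[OF zero_le order_refl, of "W j * (W k * W l)" "W k * (W l * (W j * W m))"] by (simp only: add_0_left)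
      qed simp
      finally show ?thesis .
    next
      case 4
      have "(\<integral>\<^sup>+\<omega>. G j k \<omega> * G j l \<omega> * (G m k \<omega> * G m l \<omega>) \<partial>M) = (\<integral>\<^sup>+\<omega>. ((G j k \<omega>)\<^sup>2)\<^sup>2 \<partial>M)"
        using 4 by (simp add: power2_eq_square)
      also have "\<dots> \<le> ennreal 404 * (W j * W k)"
        by (rule edge_fourth_expectation_le) (use 4 ne s2 in auto)
      also have "\<dots> \<le> C * (W j * W k)" by (rule mult_right_mono[OF Cle(3)]) simp
      also have "\<dots> \<le> C * Z k l j m"
      proof (rule mult_left_mono)
        have "Z k l j m = (W k * (W l * (W j * W m)) + W k * (W j * W m) + W j * (W k * W l)) + W j * W k"
          using 4 by (simp add: Z_def \<delta>_def)
        then show "W j * W k \<le> Z k l j m"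
          using add_mono[OF zero_le order_refl, of "W j * W k" "W k * (W l * (W j * W m)) + W k * (W j * W m) + W j * (W k * W l)"]
          by (simp only: add_0_left)
      qed simp
      finally show ?thesis .
    qed
  qed
  define S where "S = (\<Sum>k. W k)"
  have sums: "(\<Sum>k. \<Sum>l. \<Sum>j. \<Sum>m. Z k l j m) = S * (S * (S * S)) + S * (S * S) + S * (S * S) + S * S"
  proof -
    have add: "(\<Sum>i. f i + g i) = (\<Sum>i. f i) + (\<Sum>i. g i)" for f g :: "nat \<Rightarrow> ennreal"
      by (rule suminf_add[symmetric]) (rule summableI)+
    show ?thesis
      unfolding Z_def
      by (simp only: add ennreal_suminf_cmult ennreal_suminf_multc \<delta>1 mult_1_left S_def[symmetric] mult_ac)
  qed
  have eq: "(\<Sum>k. \<Sum>l. (\<Sum>j. G j k \<omega> * G j l \<omega>)\<^sup>2) = (\<Sum>k. \<Sum>l. \<Sum>j. \<Sum>m. G j k \<omega> * G j l \<omega> * (G m k \<omega> * G m l \<omega>))" for \<omega>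
    unfolding power2_eq_square ennreal_suminf_cmult ennreal_suminf_multc ..
  have "(\<integral>\<^sup>+\<omega>. (\<Sum>k. \<Sum>l. (\<Sum>j. G j k \<omega> * G j l \<omega>)\<^sup>2) \<partial>M)
     = (\<Sum>k. \<Sum>l. \<Sum>j. \<Sum>m. \<integral>\<^sup>+\<omega>. G j k \<omega> * G j l \<omega> * (G m k \<omega> * G m l \<omega>) \<partial>M)"
    unfolding eq by (subst nn_integral_suminf, measurable)+
  also have "\<dots> \<le> (\<Sum>k. \<Sum>l. \<Sum>j. \<Sum>m. C * Z k l j m)"
    by (intro suminf_le allI bound) auto
  also have "\<dots> = C * (S * (S * (S * S)) + S * (S * S) + S * (S * S) + S * S)"
    unfolding ennreal_suminf_cmult sums ..
  also have "\<dots> < \<infinity>"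
    using fin Cfin unfolding S_def[symmetric] by (simp add: ennreal_mult_less_top)
  finally have "(\<integral>\<^sup>+\<omega>. (\<Sum>k. \<Sum>l. (\<Sum>j. G j k \<omega> * G j l \<omega>)\<^sup>2) \<partial>M) \<noteq> \<infinity>" by simp
  then have "AE \<omega> in M. (\<Sum>k. \<Sum>l. (\<Sum>j. G j k \<omega> * G j l \<omega>)\<^sup>2) \<noteq> \<infinity>"
    by (intro nn_integral_PInf_AE) measurable
  then show ?thesis by eventually_elim (simp add: less_top)
qed

end

section \<open>Dyadic shells and their counting sums\<close>

text \<open>The index of the dyadic shell containing \<open>r\<close>, for \<open>0 \<le> r < 1\<close>.\<close>

definition shell_index :: "real \<Rightarrow> nat" where
  "shell_index r = (LEAST n. r < 1 - (1/2) ^ Suc n)"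

lemma mem_dyadic_shell_iff:
  assumes r: "0 \<le> r" "r < 1"
  shows "r \<in> dyadic_shell n \<longleftrightarrow> shell_index r = n"
proof -
  obtain N where "(1/2 :: real) ^ N < 1 - r" using real_arch_pow_inv[of "1 - r" "1/2"] r by auto
  moreover have "(1/2 :: real) ^ Suc N \<le> (1/2) ^ N" by (rule power_decreasing) auto
  ultimately have ex: "r < 1 - (1/2) ^ Suc N" by linarith
  have up: "r < 1 - (1/2) ^ Suc (shell_index r)" unfolding shell_index_def by (rule LeastI[of _ N]) (rule ex)
  have low: "1 - (1/2) ^ shell_index r \<le> r"
  proof (cases "shell_index r")
    case 0
    then show ?thesis using r by simp
  next
    case (Suc m)
    then have "\<not> r < 1 - (1/2) ^ Suc m" using not_less_Least[of m "\<lambda>n. r < 1 - (1/2) ^ Suc n"] by (simp add: shell_index_def)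
    then show ?thesis using Suc by simp
  qed
  show ?thesis
  proof
    assume mem: "r \<in> dyadic_shell n"
    show "shell_index r = n"
      unfolding shell_index_def
    proof (rule Least_equality)
      show "r < 1 - (1/2) ^ Suc n" using mem by (simp add: dyadic_shell_def)
      fix m assume m: "r < 1 - (1/2) ^ Suc m"
      show "n \<le> m"
      proof (rule ccontr)
        assume "\<not> n \<le> m"
        then have "(1/2 :: real) ^ n \<le> (1/2) ^ Suc m" by (intro power_decreasing) auto
        moreover have "1 - (1/2) ^ n \<le> r" using mem by (simp add: dyadic_shell_def)
        ultimately show False using m by linarith
      qed
    qed
  next
    assume "shell_index r = n"
    then show "r \<in> dyadic_shell n" using up low by (auto simp: dyadic_shell_def)
  qed
qed

lemma shell_index_bounds:
  assumes r: "0 \<le> r" "r < 1"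
  shows "(1/2) ^ Suc (shell_index r) < 1 - r" "1 - r \<le> (1/2) ^ shell_index r"
proof -
  have "r \<in> dyadic_shell (shell_index r)" using mem_dyadic_shell_iff[OF r] by blast
  then show "(1/2) ^ Suc (shell_index r) < 1 - r" "1 - r \<le> (1/2) ^ shell_index r"
    by (auto simp: dyadic_shell_def)
qed

text \<open>All points with radius \<open>0\<close> coincide with the origin, so only the first index with radius \<open>0\<close> is kept; the
  remaining points are almost surely distinct.\<close>

definition essential_indices :: "(nat \<Rightarrow> real) \<Rightarrow> nat set" where
  "essential_indices \<rho> = {k. \<rho> k = 0 \<longrightarrow> (\<forall>j<k. \<rho> j \<noteq> 0)}"

text \<open>Group the indices by shells.\<close>

lemma suminf_shell:
  fixes h :: "nat \<Rightarrow> ennreal"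
  assumes \<rho>: "\<And>k. \<rho> k \<in> {0..<1}"
  shows "(\<Sum>k. if k \<in> essential_indices \<rho> then h (shell_index (\<rho> k)) else 0) = (\<Sum>n. h n * radial_count \<rho> n)"
proof -
  define J where "J n = {k. \<rho> k \<in> dyadic_shell n \<and> (\<rho> k = 0 \<longrightarrow> (\<forall>j<k. \<rho> j \<noteq> 0))}" for n
  have J: "k \<in> J n \<longleftrightarrow> k \<in> essential_indices \<rho> \<and> shell_index (\<rho> k) = n" for k n
    using mem_dyadic_shell_iff[of "\<rho> k" n] \<rho>[of k] by (auto simp: J_def essential_indices_def)
  have rc: "radial_count \<rho> n = (\<Sum>k. indicator (J n) k)" for n
  proof -
    have "radial_count \<rho> n = (\<integral>\<^sup>+k. indicator (J n) k \<partial>count_space UNIV)"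
      unfolding radial_count_def J_def by (rule nn_integral_indicator[symmetric]) simp
    also have "\<dots> = (\<Sum>k. indicator (J n) k)" by (rule nn_integral_count_space_nat)
    finally show ?thesis .
  qed
  have "(\<Sum>n. h n * radial_count \<rho> n) = (\<Sum>n. \<Sum>k. h n * indicator (J n) k)"
    unfolding rc ennreal_suminf_cmult ..
  also have "\<dots> = (\<Sum>k. \<Sum>n. h n * indicator (J n) k)" by (rule suminf_swap_ennreal)
  also have "\<dots> = (\<Sum>k. if k \<in> essential_indices \<rho> then h (shell_index (\<rho> k)) else 0)"
  proof (rule suminf_cong)
    fix k
    have "(\<Sum>n. h n * indicator (J n) k) = (\<Sum>n\<in>{shell_index (\<rho> k)}. h n * indicator (J n) k)"
      by (rule suminf_finite) (auto simp: indicator_def J)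
    then show "(\<Sum>n. h n * indicator (J n) k) = (if k \<in> essential_indices \<rho> then h (shell_index (\<rho> k)) else 0)"
      by (simp add: indicator_def J)
  qed
  finally show ?thesis ..
qed

text \<open>Schur's test: \<open>b n * b m \<le> (b n)\<^sup>2 + (b m)\<^sup>2\<close>, and the kernel \<open>q ^ |n - m|\<close> has bounded row sums.\<close>

lemma suminf_pair_decay_le:
  fixes b :: "nat \<Rightarrow> ennreal" and q :: real
  assumes q: "0 \<le> q" "q < 1"
  shows "(\<Sum>n. \<Sum>m. b n * b m * ennreal (q ^ (max n m - min n m)))
    \<le> 4 * (\<Sum>i. ennreal (q ^ i)) * (\<Sum>n. (b n)\<^sup>2)"
proof -
  define g where "g n m = ennreal (q ^ (max n m - min n m))" for n m :: nat
  define S where "S = (\<Sum>i. ennreal (q ^ i))"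
  have gc: "g n m = g m n" for n m by (simp add: g_def max.commute min.commute)
  have gS: "(\<Sum>m. g n m) \<le> 2 * S" for n
  proof -
    have "(\<Sum>m. g n m) = (\<Sum>j. g n (j + n)) + (\<Sum>m<n. g n m)"
      by (rule suminf_offset) (rule summableI)
    also have "(\<Sum>j. g n (j + n)) = S" unfolding S_def g_def by simp
    also have "(\<Sum>m<n. g n m) = (\<Sum>m<n. ennreal (q ^ (n - m)))"
      unfolding g_def by (intro sum.cong refl) (simp add: max_absorb1 min_absorb2)
    also have "\<dots> = (\<Sum>i<n. ennreal (q ^ Suc i))"
      by (subst sum.nat_diff_reindex[symmetric]) (auto intro!: sum.cong)
    also have "\<dots> \<le> (\<Sum>i<n. ennreal (q ^ i))"
    proof (intro sum_mono ennreal_leI)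
      fix i
      have "q * q ^ i \<le> 1 * q ^ i" using q by (intro mult_right_mono) auto
      then show "q ^ Suc i \<le> q ^ i" by simp
    qed
    also have "\<dots> \<le> S" unfolding S_def by (rule sum_le_suminf) auto
    finally show ?thesis by (simp add: mult_2)
  qed
  have am: "a * c \<le> a\<^sup>2 + c\<^sup>2" for a c :: ennreal
  proof (cases "a \<le> c")
    case True
    then have "a * c \<le> c * c" by (rule mult_right_mono) simp
    then show ?thesis using add_mono[OF zero_le[of "a\<^sup>2"], of "a * c" "c * c"] by (simp add: power2_eq_square)
  next
    case False
    then have "a * c \<le> a * a" by (intro mult_left_mono) auto
    then show ?thesis using add_mono[OF _ zero_le[of "c\<^sup>2"], of "a * c" "a * a"] by (simp add: power2_eq_square)
  qed
  have half: "(\<Sum>n. \<Sum>m. (b n)\<^sup>2 * g n m) \<le> (\<Sum>n. (b n)\<^sup>2) * (2 * S)"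
    unfolding ennreal_suminf_cmult ennreal_suminf_multc[symmetric]
    by (intro suminf_le allI mult_left_mono gS) auto
  have "(\<Sum>n. \<Sum>m. b n * b m * g n m) \<le> (\<Sum>n. \<Sum>m. (b n)\<^sup>2 * g n m + (b m)\<^sup>2 * g n m)"
    unfolding distrib_right[symmetric] by (intro suminf_le allI mult_right_mono am) auto
  also have "\<dots> = (\<Sum>n. \<Sum>m. (b n)\<^sup>2 * g n m) + (\<Sum>n. \<Sum>m. (b m)\<^sup>2 * g n m)"
    by (simp add: suminf_add[symmetric])
  also have "(\<Sum>n. \<Sum>m. (b m)\<^sup>2 * g n m) = (\<Sum>n. \<Sum>m. (b n)\<^sup>2 * g n m)"
    by (subst suminf_swap_ennreal) (simp only: gc)
  also have "(\<Sum>n. \<Sum>m. (b n)\<^sup>2 * g n m) + (\<Sum>n. \<Sum>m. (b n)\<^sup>2 * g n m) \<le> (\<Sum>n. (b n)\<^sup>2) * (2 * S) + (\<Sum>n. (b n)\<^sup>2) * (2 * S)"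
    by (intro add_mono half)
  also have "\<dots> = 4 * S * (\<Sum>n. (b n)\<^sup>2)"
  proof -
    have "(\<Sum>n. (b n)\<^sup>2) * (2 * S) + (\<Sum>n. (b n)\<^sup>2) * (2 * S) = (2 * 2) * ((\<Sum>n. (b n)\<^sup>2) * S)"
      by (simp only: mult_2 distrib_left distrib_right add.assoc mult_ac)
    then show ?thesis by (simp add: mult_ac)
  qed
  finally show ?thesis unfolding g_def S_def .
qed

text \<open>In shell \<open>n\<close> the number \<open>1 - \<rho>\<^sup>2\<close> lies between \<open>2 powr -n / 2\<close> and \<open>2 * 2 powr -n\<close>.\<close>

lemma radial_weight_sq_bounds:
  assumes \<rho>: "0 \<le> \<rho> k" "\<rho> k < 1" and s: "0 < s" "s \<le> 1" and k: "k \<in> I"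
  shows "(radial_weight s \<rho> I k)\<^sup>2 \<le> 2 * 2 powr (- s * real (shell_index (\<rho> k)))"
    and "2 powr (- s * real (shell_index (\<rho> k))) \<le> 2 * (radial_weight s \<rho> I k)\<^sup>2"
proof -
  define n where "n = shell_index (\<rho> k)"
  define d where "d = 1 - (\<rho> k)\<^sup>2"
  have d: "d = (1 - \<rho> k) * (1 + \<rho> k)" by (simp add: d_def power2_eq_square algebra_simps)
  have "(1 - \<rho> k) * 1 \<le> d" unfolding d using \<rho> by (intro mult_left_mono) simp_all
  moreover have "d \<le> (1 - \<rho> k) * 2" unfolding d using \<rho> by (intro mult_left_mono) simp_all
  moreover have p: "(1/2 :: real) ^ n = 2 powr (- real n)" by (simp add: powr_minus powr_realpow power_one_over inverse_eq_divide)
  ultimately have lo: "2 powr (- real n) / 2 \<le> d" and hi: "d \<le> 2 * 2 powr (- real n)"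
    using shell_index_bounds[OF \<rho>] unfolding n_def[symmetric] by (simp_all add: p[symmetric])
  have w: "(radial_weight s \<rho> I k)\<^sup>2 = d powr s"
    using k by (simp add: radial_weight_def d_def power2_eq_square powr_add[symmetric])
  have two: "2 powr s \<le> (2 :: real)" using powr_mono[of s 1 "2::real"] s by simp
  have e: "(2 powr (- real n)) powr s = 2 powr (- s * real n)" by (simp add: powr_powr mult.commute)
  have "d powr s \<le> (2 * 2 powr (- real n)) powr s" using hi lo s by (intro powr_mono2) (auto intro: order_trans[OF _ lo])
  also have "\<dots> = 2 powr s * 2 powr (- s * real n)" by (simp add: powr_mult e)
  also have "\<dots> \<le> 2 * 2 powr (- s * real n)" using two by (rule mult_right_mono) simp
  finally show "(radial_weight s \<rho> I k)\<^sup>2 \<le> 2 * 2 powr (- s * real (shell_index (\<rho> k)))" unfolding w n_def .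
  have "(2 powr (- real n) / 2) powr s \<le> d powr s" using lo s by (intro powr_mono2) auto
  then have "2 powr (- s * real n) / 2 powr s \<le> d powr s" by (simp add: powr_divide e)
  then have "2 powr (- s * real n) \<le> 2 powr s * d powr s" by (simp add: pos_divide_le_eq mult.commute)
  also have "\<dots> \<le> 2 * d powr s" using two by (rule mult_right_mono) simp
  finally show "2 powr (- s * real (shell_index (\<rho> k))) \<le> 2 * (radial_weight s \<rho> I k)\<^sup>2" unfolding w n_def .
qed

lemma suminf_radial_weight_iff:
  assumes \<rho>: "\<And>k. \<rho> k \<in> {0..<1}" and s: "0 < s" "s \<le> 1"
  shows "(\<Sum>k. ennreal ((radial_weight s \<rho> (essential_indices \<rho>) k)\<^sup>2)) < \<infinity> \<longleftrightarrow>
    (\<Sum>n. ennreal (2 powr (- s * real n)) * radial_count \<rho> n) < \<infinity>"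
proof -
  let ?J = "essential_indices \<rho>"
  let ?h = "\<lambda>n. ennreal (2 powr (- s * real n))"
  define W where "W k = ennreal ((radial_weight s \<rho> ?J k)\<^sup>2)" for k
  have \<rho>': "0 \<le> \<rho> k" "\<rho> k < 1" for k using \<rho>[of k] by auto
  note b = radial_weight_sq_bounds[OF \<rho>' s, of _ ?J]
  have up: "W k \<le> ennreal 2 * (if k \<in> ?J then ?h (shell_index (\<rho> k)) else 0)" for k
  proof (cases "k \<in> ?J")
    case True
    then show ?thesis unfolding W_def using b(1)[OF True] by (simp add: ennreal_mult'[symmetric] ennreal_leI del: ennreal_numeral)
  qed (simp add: W_def radial_weight_def)
  have lo: "(if k \<in> ?J then ?h (shell_index (\<rho> k)) else 0) \<le> ennreal 2 * W k" for k
  proof (cases "k \<in> ?J")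
    case True
    then show ?thesis unfolding W_def using b(2)[OF True] by (simp add: ennreal_mult'[symmetric] ennreal_leI del: ennreal_numeral)
  qed simp
  have "(\<Sum>k. W k) \<le> ennreal 2 * (\<Sum>n. ?h n * radial_count \<rho> n)"
    unfolding suminf_shell[OF \<rho>, symmetric] ennreal_suminf_cmult[symmetric] by (intro suminf_le allI up) auto
  moreover have "(\<Sum>n. ?h n * radial_count \<rho> n) \<le> ennreal 2 * (\<Sum>k. W k)"
    unfolding suminf_shell[OF \<rho>, symmetric] ennreal_suminf_cmult[symmetric] by (intro suminf_le allI lo) auto
  ultimately show ?thesis
    unfolding W_def[symmetric]
    by (meson ennreal_mult_less_infinity le_less_trans ennreal_less_top[folded infinity_ennreal_def])
qed

text \<open>Cauchy-Schwarz; the geometric series that appears converges exactly because \<open>s > 1/2\<close>.\<close>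

lemma suminf_weighted_count_of_square:
  assumes fin: "(\<Sum>n. ennreal (2 powr (- real n)) * (N n)\<^sup>2) < \<infinity>" and s: "1/2 < s"
  shows "(\<Sum>n. ennreal (2 powr (- s * real n)) * N n) < \<infinity>"
proof -
  define q where "q = (2 :: real) powr (- (2 * s - 1))"
  have q: "0 \<le> q" "q < 1" using s powr_less_mono[of "- (2 * s - 1)" 0 "2::real"] by (auto simp: q_def)
  have "(\<Sum>n. ennreal (2 powr (- s * real n)) * N n)
     = (\<Sum>n. ennreal (2 powr (- (s - 1/2) * real n)) * (ennreal (2 powr (- real n / 2)) * N n))"
  proof (rule suminf_cong)
    fix n
    have "2 powr (- s * real n) = 2 powr (- (s - 1/2) * real n) * (2 :: real) powr (- real n / 2)"
      by (simp add: powr_add[symmetric] algebra_simps)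
    then show "ennreal (2 powr (- s * real n)) * N n = ennreal (2 powr (- (s - 1/2) * real n)) * (ennreal (2 powr (- real n / 2)) * N n)"
      by (simp only: ennreal_mult powr_ge_zero mult.assoc)
  qed
  also have "\<dots>\<^sup>2 \<le> (\<Sum>n. (ennreal (2 powr (- (s - 1/2) * real n)))\<^sup>2) * (\<Sum>n. (ennreal (2 powr (- real n / 2)) * N n)\<^sup>2)"
    by (rule Cauchy_Schwarz_suminf_ennreal)
  also have "(\<Sum>n. (ennreal (2 powr (- (s - 1/2) * real n)))\<^sup>2) = (\<Sum>n. ennreal (q ^ n))"
  proof (rule suminf_cong)
    fix n
    have "(2 powr (- (s - 1/2) * real n))\<^sup>2 = q ^ n"
      unfolding q_def power2_eq_square powr_add[symmetric] powr_realpow[OF powr_gt_zero[THEN iffD2], symmetric]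
      by (simp add: powr_powr powr_realpow[symmetric] algebra_simps)
    then show "(ennreal (2 powr (- (s - 1/2) * real n)))\<^sup>2 = ennreal (q ^ n)" by (subst ennreal_power) simp_all
  qed
  also have "(\<Sum>n. (ennreal (2 powr (- real n / 2)) * N n)\<^sup>2) = (\<Sum>n. ennreal (2 powr (- real n)) * (N n)\<^sup>2)"
  proof (rule suminf_cong)
    fix n
    have "(2 powr (- real n / 2))\<^sup>2 = (2 :: real) powr (- real n)"
      by (simp add: power2_eq_square powr_add[symmetric])
    then have "(ennreal (2 powr (- real n / 2)))\<^sup>2 = ennreal (2 powr (- real n))" by (subst ennreal_power) simp_all
    then show "(ennreal (2 powr (- real n / 2)) * N n)\<^sup>2 = ennreal (2 powr (- real n)) * (N n)\<^sup>2"
      by (simp only: power_mult_distrib)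
  qed
  also have "(\<Sum>n. ennreal (q ^ n)) * (\<Sum>n. ennreal (2 powr (- real n)) * (N n)\<^sup>2) < \<infinity>"
    by (intro ennreal_mult_less_infinity suminf_ennreal_geometric_less_top q fin)
  finally show ?thesis by (simp only: infinity_ennreal_def power_less_top_ennreal) simp
qed

text \<open>For indices in shells \<open>n\<close> and \<open>m\<close> the expected squared entry is at most a constant times
  \<open>2 powr (- s * (n + m)) * 2 powr ((2 * s - 1) * min n m)\<close>, that is
  \<open>2 powr (- n / 2) * 2 powr (- m / 2) * 2 powr (- (s - 1/2) * |n - m|)\<close>. The sum over pairs is therefore nearly diagonal
  and comparable to \<open>\<Sum>n. 2 powr -n * (N n)\<^sup>2\<close>; this is where the criterion comes from.\<close>

lemma hilbert_schmidt_sum_finite: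
  assumes \<rho>: "\<And>k. \<rho> k \<in> {0..<1}" and s: "1/2 < s" "s \<le> 1"
    and fin: "(\<Sum>n. ennreal (2 powr (- real n)) * (radial_count \<rho> n)\<^sup>2) < \<infinity>"
  shows "(\<Sum>k. \<Sum>j. ennreal ((radial_weight s \<rho> (essential_indices \<rho>) j)\<^sup>2) *
      ennreal ((radial_weight s \<rho> (essential_indices \<rho>) k)\<^sup>2) * ennreal (edge_bound (\<rho> j * \<rho> k) (2 * s))) < \<infinity>"
proof -
  let ?J = "essential_indices \<rho>"
  define w where "w k = (radial_weight s \<rho> ?J k)\<^sup>2" for k
  define sh where "sh k = shell_index (\<rho> k)" for k
  define q where "q = (2 :: real) powr (- (s - 1/2))"
  have q: "0 \<le> q" "q < 1" using s powr_less_mono[of "- (s - 1/2)" 0 "2::real"] by (auto simp: q_def)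
  define K where "K = 8 * (10 powr (2 * s) / (2 * s - 1))"
  have K: "0 \<le> K" using s by (simp add: K_def)
  have \<rho>': "0 \<le> \<rho> k" "\<rho> k < 1" for k using \<rho>[of k] by auto
  \<comment> \<open>The shell indices enter through their minimum \<open>m\<close> and their difference \<open>D\<close>: the gap \<open>1 - \<rho> j * \<rho> k\<close> is at least \<open>2 powr - (m + 1)\<close>.\<close>
  have point: "w j * w k * edge_bound (\<rho> j * \<rho> k) (2 * s)
      \<le> K * (2 powr (- real (sh k) / 2) * 2 powr (- real (sh j) / 2) * q ^ (max (sh k) (sh j) - min (sh k) (sh j)))"
    if jk: "j \<in> ?J" "k \<in> ?J" for j k
  proof -
    define m where "m = min (sh k) (sh j)"
    define D where "D = max (sh k) (sh j) - m"
    have sum: "real (sh k) + real (sh j) = 2 * real m + real D" by (auto simp: m_def D_def max_def min_def)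
    define g where "g = 1 - \<rho> j * \<rho> k"
    have gap: "1 - \<rho> k \<le> g" "1 - \<rho> j \<le> g"
    proof -
      have "\<rho> j * \<rho> k \<le> 1 * \<rho> k" using \<rho>'[of j] \<rho>'[of k] by (intro mult_right_mono) auto
      moreover have "\<rho> j * \<rho> k \<le> \<rho> j * 1" using \<rho>'[of j] \<rho>'[of k] by (intro mult_left_mono) auto
      ultimately show "1 - \<rho> k \<le> g" "1 - \<rho> j \<le> g" by (simp_all add: g_def)
    qed
    have gm: "(1/2) ^ Suc m \<le> g"
      using shell_index_bounds(1)[OF \<rho>', of k] shell_index_bounds(1)[OF \<rho>', of j] gap
      unfolding m_def min_def sh_def by (auto split: if_splits)
    have pm: "(1/2 :: real) ^ Suc m = 2 powr (- (real m + 1))"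
    proof -
      have "(1/2 :: real) ^ Suc m = 2 powr (- real (Suc m))"
        by (simp only: powr_minus powr_realpow[OF zero_less_numeral] power_one_over inverse_eq_divide)
      then show ?thesis by (simp only: of_nat_Suc add.commute)
    qed
    have "g powr (1 - 2 * s) \<le> ((1/2) ^ Suc m) powr (1 - 2 * s)"
      using gm s by (intro powr_mono2') auto
    also have "\<dots> = 2 powr ((real m + 1) * (2 * s - 1))"
      unfolding pm powr_powr by (simp add: algebra_simps)
    also have "\<dots> = 2 powr (2 * s - 1) * 2 powr (real m * (2 * s - 1))"
      by (simp add: powr_add[symmetric] algebra_simps)
    also have "\<dots> \<le> 2 powr 1 * 2 powr (real m * (2 * s - 1))"
      using s by (intro mult_right_mono powr_mono) auto
    finally have gb: "g powr (1 - 2 * s) \<le> 2 * 2 powr (real m * (2 * s - 1))" by simp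
    have eb: "edge_bound (\<rho> j * \<rho> k) (2 * s) = 10 powr (2 * s) / (2 * s - 1) * g powr (1 - 2 * s)"
      using s by (simp add: edge_bound_def g_def)
    have "w j * w k * edge_bound (\<rho> j * \<rho> k) (2 * s)
      \<le> (2 * 2 powr (- s * real (sh j))) * (2 * 2 powr (- s * real (sh k))) * (10 powr (2 * s) / (2 * s - 1) * (2 * 2 powr (real m * (2 * s - 1))))"
      unfolding eb w_def sh_def
      by (intro mult_mono radial_weight_sq_bounds gb[unfolded sh_def] \<rho>' jk) (use s in auto)
    also have "\<dots> = K * (2 powr (- s * real (sh j)) * 2 powr (- s * real (sh k)) * 2 powr (real m * (2 * s - 1)))"
      by (simp add: K_def)
    also have "2 powr (- s * real (sh j)) * 2 powr (- s * real (sh k)) * 2 powr (real m * (2 * s - 1))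
      = (2 :: real) powr (- s * (real (sh k) + real (sh j)) + real m * (2 * s - 1))"
      unfolding powr_add[symmetric] by (simp add: algebra_simps)
    also have "- s * (real (sh k) + real (sh j)) + real m * (2 * s - 1) = - (real (sh k) + real (sh j)) / 2 + - (s - 1/2) * real D"
      unfolding sum by (simp add: algebra_simps add_divide_distrib diff_divide_distrib)
    also have "(2 :: real) powr (- (real (sh k) + real (sh j)) / 2 + - (s - 1/2) * real D)
      = 2 powr (- real (sh k) / 2) * 2 powr (- real (sh j) / 2) * q ^ D"
    proof -
      have "q ^ D = 2 powr (- (s - 1/2) * real D)"
        unfolding q_def by (simp add: powr_powr powr_realpow[symmetric])
      moreover have "- (real (sh k) + real (sh j)) / 2 + - (s - 1/2) * real D = - real (sh k) / 2 + - real (sh j) / 2 + - (s - 1/2) * real D"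
        by (simp add: add_divide_distrib)
      ultimately show ?thesis by (simp only: powr_add)
    qed
    finally show ?thesis by (simp only: D_def m_def)
  qed
  define H where "H n m = ennreal K * (ennreal (2 powr (- real n / 2)) * ennreal (2 powr (- real m / 2)) * ennreal (q ^ (max n m - min n m)))" for n m
  define N where "N = radial_count \<rho>"
  define b where "b n = ennreal (2 powr (- real n / 2)) * N n" for n
  have "(\<Sum>k. \<Sum>j. ennreal (w j) * ennreal (w k) * ennreal (edge_bound (\<rho> j * \<rho> k) (2 * s)))
    \<le> (\<Sum>k. if k \<in> ?J then (\<Sum>j. if j \<in> ?J then H (sh k) (sh j) else 0) else 0)"
  proof (intro suminf_le allI)
    fix k
    show "(\<Sum>j. ennreal (w j) * ennreal (w k) * ennreal (edge_bound (\<rho> j * \<rho> k) (2 * s)))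
      \<le> (if k \<in> ?J then (\<Sum>j. if j \<in> ?J then H (sh k) (sh j) else 0) else 0)"
    proof (cases "k \<in> ?J")
      case k: True
      have "ennreal (w j) * ennreal (w k) * ennreal (edge_bound (\<rho> j * \<rho> k) (2 * s)) \<le> (if j \<in> ?J then H (sh k) (sh j) else 0)" for j
      proof (cases "j \<in> ?J")
        case j: True
        have w0: "0 \<le> w i" for i by (simp add: w_def)
        have e0: "0 \<le> edge_bound (\<rho> j * \<rho> k) (2 * s)" using s by (simp add: edge_bound_def)
        have "ennreal (w j) * ennreal (w k) * ennreal (edge_bound (\<rho> j * \<rho> k) (2 * s)) = ennreal (w j * w k * edge_bound (\<rho> j * \<rho> k) (2 * s))"
          using w0 e0 by (simp only: ennreal_mult mult_nonneg_nonneg)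
        also have "\<dots> \<le> ennreal (K * (2 powr (- real (sh k) / 2) * 2 powr (- real (sh j) / 2) * q ^ (max (sh k) (sh j) - min (sh k) (sh j))))"
          by (intro ennreal_leI point j k)
        also have "\<dots> = H (sh k) (sh j)"
          unfolding H_def using K q by (simp only: ennreal_mult mult_nonneg_nonneg powr_ge_zero zero_le_power)
        finally show ?thesis using j by simp
      qed (simp add: w_def radial_weight_def)
      then show ?thesis using k by (simp add: suminf_le)
    qed (simp add: w_def radial_weight_def)
  qed auto
  also have "(\<Sum>k. if k \<in> ?J then (\<Sum>j. if j \<in> ?J then H (sh k) (sh j) else 0) else 0) = (\<Sum>n. (\<Sum>m. H n m * N m) * N n)"
  proof -
    have inner: "(\<Sum>j. if j \<in> ?J then H n (shell_index (\<rho> j)) else 0) = (\<Sum>m. H n m * radial_count \<rho> m)" for n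
      by (rule suminf_shell[where \<rho> = \<rho> and h = "H n", OF \<rho>])
    show ?thesis
      unfolding sh_def N_def inner
      by (rule suminf_shell[where \<rho> = \<rho> and h = "\<lambda>n. \<Sum>m. H n m * radial_count \<rho> m", OF \<rho>])
  qed
  also have "\<dots> = ennreal K * (\<Sum>n. \<Sum>m. b n * b m * ennreal (q ^ (max n m - min n m)))"
    unfolding ennreal_suminf_cmult[symmetric] ennreal_suminf_multc[symmetric] H_def b_def by (simp only: mult_ac)
  also have "\<dots> \<le> ennreal K * (4 * (\<Sum>i. ennreal (q ^ i)) * (\<Sum>n. (b n)\<^sup>2))"
    by (intro mult_left_mono suminf_pair_decay_le q) simp
  also have "(\<Sum>n. (b n)\<^sup>2) = (\<Sum>n. ennreal (2 powr (- real n)) * (N n)\<^sup>2)"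
  proof (rule suminf_cong)
    fix n
    have "(2 powr (- real n / 2))\<^sup>2 = (2 :: real) powr (- real n)"
      by (simp add: power2_eq_square powr_add[symmetric])
    then have "(ennreal (2 powr (- real n / 2)))\<^sup>2 = ennreal (2 powr (- real n))" by (subst ennreal_power) simp_all
    then show "(b n)\<^sup>2 = ennreal (2 powr (- real n)) * (N n)\<^sup>2"
      by (simp only: b_def power_mult_distrib)
  qed
  also have "ennreal K * (4 * (\<Sum>i. ennreal (q ^ i)) * (\<Sum>n. ennreal (2 powr (- real n)) * (N n)\<^sup>2)) < \<infinity>"
    unfolding N_def
    by (intro ennreal_mult_less_infinity suminf_ennreal_geometric_less_top q fin)
       (simp_all add: less_top[symmetric])
  finally show ?thesis unfolding w_def by (simp add: mult_left_mono)
qed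

section \<open>A second-moment Borel-Cantelli argument\<close>

text \<open>Chebyshev's inequality: the variance of the number \<open>X\<close> of events that occur is at most its mean \<open>m\<close>, and
  \<open>X = 0\<close> is a deviation by \<open>m\<close>.\<close>

lemma (in prob_space) pairwise_independent_avoid_prob_le:
  fixes A :: "'q \<Rightarrow> 'a set" and p :: "'q \<Rightarrow> real"
  assumes F: "finite F" and A: "\<And>q. q \<in> F \<Longrightarrow> A q \<in> events"
    and p: "\<And>q. q \<in> F \<Longrightarrow> prob (A q) = p q"
    and pp: "\<And>q q'. q \<in> F \<Longrightarrow> q' \<in> F \<Longrightarrow> q \<noteq> q' \<Longrightarrow> prob (A q \<inter> A q') \<le> p q * p q'"
    and m: "0 < sum p F"
  shows "prob {\<omega> \<in> space M. \<forall>q\<in>F. \<omega> \<notin> A q} \<le> 1 / sum p F"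
proof -
  define m where "m = sum p F"
  define N where "N = {\<omega> \<in> space M. \<forall>q\<in>F. \<omega> \<notin> A q}"
  define X where "X \<omega> = (\<Sum>q\<in>F. indicator (A q) \<omega> :: real)" for \<omega>
  have N: "N \<in> events"
  proof -
    have "N = space M - (\<Union>q\<in>F. A q)" by (auto simp: N_def)
    then show ?thesis using A F by (auto intro!: sets.finite_UN)
  qed
  have iA: "integrable M (indicator (B) :: 'a \<Rightarrow> real)" if "B \<in> events" for B
    using that by (simp add: integrable_indicator_iff emeasure_eq_measure)
  have sq: "(X \<omega> - m)\<^sup>2 = (\<Sum>q\<in>F. \<Sum>q'\<in>F. indicator (A q \<inter> A q') \<omega>) - 2 * m * (\<Sum>q\<in>F. indicator (A q) \<omega>) + m\<^sup>2" for \<omega>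
    unfolding power2_diff X_def by (simp add: power2_eq_square sum_product indicator_inter_arith)
  have int: "integrable M (\<lambda>\<omega>. (X \<omega> - m)\<^sup>2)"
    unfolding sq by (intro Bochner_Integration.integrable_add Bochner_Integration.integrable_diff
      Bochner_Integration.integrable_sum integrable_mult_right iA integrable_const) (use A in auto)
  have "(\<integral>\<omega>. (X \<omega> - m)\<^sup>2 \<partial>M) = (\<Sum>q\<in>F. \<Sum>q'\<in>F. prob (A q \<inter> A q')) - 2 * m * (\<Sum>q\<in>F. prob (A q)) + m\<^sup>2"
  proof -
    have 1: "(\<integral>\<omega>. (\<Sum>q\<in>F. \<Sum>q'\<in>F. indicator (A q \<inter> A q') \<omega>) \<partial>M) = (\<Sum>q\<in>F. \<Sum>q'\<in>F. prob (A q \<inter> A q'))"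
    proof -
      have inner: "(\<integral>\<omega>. (\<Sum>q'\<in>F. indicator (A q \<inter> A q') \<omega> :: real) \<partial>M) = (\<Sum>q'\<in>F. prob (A q \<inter> A q'))" if q: "q \<in> F" for q
      proof -
        have "(\<integral>\<omega>. (\<Sum>q'\<in>F. indicator (A q \<inter> A q') \<omega> :: real) \<partial>M) = (\<Sum>q'\<in>F. (\<integral>\<omega>. indicator (A q \<inter> A q') \<omega> \<partial>M))"
          by (intro Bochner_Integration.integral_sum iA) (use A q in auto)
        also have "\<dots> = (\<Sum>q'\<in>F. prob (A q \<inter> A q'))"
          using A q by (intro sum.cong refl) (simp add: sets.Int_space_eq2 sets.Int)
        finally show ?thesis .
      qed
      have "(\<integral>\<omega>. (\<Sum>q\<in>F. \<Sum>q'\<in>F. indicator (A q \<inter> A q') \<omega> :: real) \<partial>M) = (\<Sum>q\<in>F. (\<integral>\<omega>. (\<Sum>q'\<in>F. indicator (A q \<inter> A q') \<omega>) \<partial>M))"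
        by (intro Bochner_Integration.integral_sum Bochner_Integration.integrable_sum iA) (use A in auto)
      also have "\<dots> = (\<Sum>q\<in>F. \<Sum>q'\<in>F. prob (A q \<inter> A q'))"
        by (intro sum.cong refl inner)
      finally show ?thesis .
    qed
    have 2: "(\<integral>\<omega>. (\<Sum>q\<in>F. indicator (A q) \<omega>) \<partial>M) = (\<Sum>q\<in>F. prob (A q))"
    proof -
      have "(\<integral>\<omega>. (\<Sum>q\<in>F. indicator (A q) \<omega> :: real) \<partial>M) = (\<Sum>q\<in>F. (\<integral>\<omega>. indicator (A q) \<omega> \<partial>M))"
        by (intro Bochner_Integration.integral_sum iA) (use A in auto)
      also have "\<dots> = (\<Sum>q\<in>F. prob (A q))"
        using A by (intro sum.cong refl) (simp add: sets.Int_space_eq2)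
      finally show ?thesis .
    qed
    have i1: "integrable M (\<lambda>\<omega>. \<Sum>q\<in>F. \<Sum>q'\<in>F. indicator (A q \<inter> A q') \<omega> :: real)"
      by (intro Bochner_Integration.integrable_sum iA) (use A in auto)
    have i2: "integrable M (\<lambda>\<omega>. 2 * m * (\<Sum>q\<in>F. indicator (A q) \<omega> :: real))"
      by (intro integrable_mult_right Bochner_Integration.integrable_sum iA) (use A in auto)
    have "(\<integral>\<omega>. (X \<omega> - m)\<^sup>2 \<partial>M) = (\<integral>\<omega>. (\<Sum>q\<in>F. \<Sum>q'\<in>F. indicator (A q \<inter> A q') \<omega>) - 2 * m * (\<Sum>q\<in>F. indicator (A q) \<omega>) \<partial>M) + (\<integral>\<omega>. m\<^sup>2 \<partial>M)"
      unfolding sq by (intro Bochner_Integration.integral_add Bochner_Integration.integrable_diff i1 i2) simp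
    also have "(\<integral>\<omega>. (\<Sum>q\<in>F. \<Sum>q'\<in>F. indicator (A q \<inter> A q') \<omega>) - 2 * m * (\<Sum>q\<in>F. indicator (A q) \<omega>) \<partial>M)
      = (\<integral>\<omega>. (\<Sum>q\<in>F. \<Sum>q'\<in>F. indicator (A q \<inter> A q') \<omega>) \<partial>M) - (\<integral>\<omega>. 2 * m * (\<Sum>q\<in>F. indicator (A q) \<omega>) \<partial>M)"
      by (intro Bochner_Integration.integral_diff i1 i2)
    finally show ?thesis using 1 2 by (simp add: prob_space)
  qed
  also have "(\<Sum>q\<in>F. prob (A q)) = m" unfolding m_def by (intro sum.cong refl p)
  also have "(\<Sum>q\<in>F. \<Sum>q'\<in>F. prob (A q \<inter> A q')) \<le> (\<Sum>q\<in>F. \<Sum>q'\<in>F. p q * p q' + (if q' = q then p q else 0))"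
  proof (intro sum_mono)
    fix q q' assume q: "q \<in> F" "q' \<in> F"
    have "0 \<le> p q" "0 \<le> p q'" using p[OF q(1)] p[OF q(2)] measure_nonneg by metis+
    then show "prob (A q \<inter> A q') \<le> p q * p q' + (if q' = q then p q else 0)"
      using pp[OF q] p[OF q(1)] by (cases "q' = q") auto
  qed
  also have "\<dots> = m * m + m"
    unfolding sum.distrib m_def sum_product using F by simp
  finally have var: "(\<integral>\<omega>. (X \<omega> - m)\<^sup>2 \<partial>M) \<le> m" by (simp add: power2_eq_square)
  have "m\<^sup>2 * prob N = (\<integral>\<omega>. m\<^sup>2 * indicator N \<omega> \<partial>M)"
    using N by (simp add: sets.Int_space_eq2)
  also have "\<dots> \<le> (\<integral>\<omega>. (X \<omega> - m)\<^sup>2 \<partial>M)"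
  proof (rule integral_mono)
    show "integrable M (\<lambda>\<omega>. m\<^sup>2 * indicator N \<omega>)" by (intro integrable_mult_right iA N)
    show "m\<^sup>2 * indicator N \<omega> \<le> (X \<omega> - m)\<^sup>2" for \<omega>
    proof (cases "\<omega> \<in> N")
      case True
      then have "X \<omega> = 0" by (simp add: X_def N_def)
      then show ?thesis using True by simp
    qed simp
  qed (rule int)
  also note var
  finally have "m * (m * prob N) \<le> m * 1" by (simp add: power2_eq_square mult.assoc)
  then have "m * prob N \<le> 1" using m unfolding m_def[symmetric] by (simp only: mult_le_cancel_left_pos)
  then show ?thesis using m unfolding m_def[symmetric] N_def[symmetric] by (simp add: pos_le_divide_eq mult.commute)
qed

text \<open>The part of the second Borel-Cantelli lemma that survives for merely pairwise independent events.\<close>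

lemma (in prob_space) pairwise_independent_AE_exists:
  fixes A :: "'q \<Rightarrow> 'a set" and p :: "'q \<Rightarrow> real"
  assumes A: "\<And>q. q \<in> Q \<Longrightarrow> A q \<in> events"
    and p: "\<And>q. q \<in> Q \<Longrightarrow> prob (A q) = p q"
    and pp: "\<And>q q'. q \<in> Q \<Longrightarrow> q' \<in> Q \<Longrightarrow> q \<noteq> q' \<Longrightarrow> prob (A q \<inter> A q') \<le> p q * p q'"
    and div: "\<And>R. \<exists>F\<subseteq>Q. finite F \<and> R < sum p F"
  shows "AE \<omega> in M. \<exists>q\<in>Q. \<omega> \<in> A q"
proof -
  have "\<exists>F\<subseteq>Q. finite F \<and> real (Suc n) < sum p F" for n by (rule div)
  then obtain F where F: "\<And>n. F n \<subseteq> Q" "\<And>n. finite (F n)" "\<And>n. real (Suc n) < sum p (F n)" by metis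
  define N where "N n = {\<omega> \<in> space M. \<forall>q\<in>F n. \<omega> \<notin> A q}" for n
  have Nev: "N n \<in> events" for n
  proof -
    have "N n = space M - (\<Union>q\<in>F n. A q)" by (auto simp: N_def)
    moreover have "(\<Union>q\<in>F n. A q) \<in> events" using A F(1,2) by (intro sets.finite_UN) auto
    ultimately show ?thesis by auto
  qed
  have Np: "prob (N n) \<le> 1 / real (Suc n)" for n
  proof -
    have "prob (N n) \<le> 1 / sum p (F n)"
      unfolding N_def
      by (rule pairwise_independent_avoid_prob_le[OF F(2)]) (use A p pp F(1)[of n] F(3)[of n] in \<open>auto simp: subset_iff\<close>)
    also have "\<dots> \<le> 1 / real (Suc n)" using F(3)[of n] by (intro divide_left_mono mult_pos_pos) auto
    finally show ?thesis .
  qed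
  define Z where "Z = (\<Inter>n. N n)"
  have Zev: "Z \<in> events" unfolding Z_def using Nev by auto
  have "prob Z \<le> 1 / real (Suc n)" for n
  proof -
    have "prob Z \<le> prob (N n)" by (rule finite_measure_mono) (auto simp: Z_def Nev)
    then show ?thesis using Np[of n] by linarith
  qed
  then have "prob Z \<le> 0"
    by (intro LIMSEQ_le_const[OF LIMSEQ_inverse_real_of_nat]) (auto simp: inverse_eq_divide)
  then have "prob Z = 0" using measure_nonneg[of M Z] by linarith
  then have "Z \<in> null_sets M" using Zev by (simp add: null_setsI emeasure_eq_measure)
  then show ?thesis
  proof (rule AE_I')
    show "{\<omega> \<in> space M. \<not> (\<exists>q\<in>Q. \<omega> \<in> A q)} \<subseteq> Z"
      using F(1) by (auto simp: Z_def N_def subset_iff)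
  qed
qed

section \<open>Collisions in polar boxes\<close>

definition bucket :: "nat \<Rightarrow> real \<Rightarrow> int" where
  "bucket B t = \<lfloor>t * real B / (2 * pi)\<rfloor>"

text \<open>Two angles are called close when they fall into the same of \<open>B\<close> equal arcs, and not when their distance is
  small: with a fixed partition the collision probability is exactly \<open>1 / B\<close> whatever the second angle is, which makes
  the collision events of different pairs pairwise independent even when the pairs share an index.\<close>

definition same_bucket :: "nat \<Rightarrow> real \<Rightarrow> real \<Rightarrow> ennreal" where
  "same_bucket B t t' = (if bucket B t = bucket B t' then 1 else 0)"

lemma same_bucket_measurable [measurable]:
  "(\<lambda>(t, t'). same_bucket B t t') \<in> borel_measurable (borel \<Otimes>\<^sub>M borel)"
  unfolding same_bucket_def bucket_def by measurable

lemma same_bucket_integral: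
  assumes B: "B > 0" and t': "0 \<le> t'" "t' < 2 * pi"
  shows "(\<integral>\<^sup>+t\<in>{0..2*pi}. same_bucket B t t' \<partial>lborel) * ennreal (1 / (2 * pi)) = ennreal (1 / real B)"
proof -
  define b where "b = bucket B t'"
  define L where "L = 2 * pi / real B"
  have L: "L > 0" using B by (simp add: L_def)
  have buck: "bucket B t = b \<longleftrightarrow> of_int b * L \<le> t \<and> t < (of_int b + 1) * L" for t
  proof -
    have "t * real B / (2 * pi) = t / L" using B by (simp add: L_def)
    then have "bucket B t = b \<longleftrightarrow> of_int b \<le> t / L \<and> t / L < of_int b + 1"
      unfolding bucket_def by (simp add: floor_eq_iff)
    then show ?thesis using L by (simp add: pos_le_divide_eq pos_divide_less_eq)
  qed
  have b0: "0 \<le> b" unfolding b_def bucket_def using t' by simp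
  have b1: "(of_int b + 1) * L \<le> 2 * pi"
  proof -
    have "of_int b * L \<le> t'" using buck[of t'] by (simp add: b_def)
    then have "of_int b * L < real B * L" using t' B by (simp add: L_def)
    then have "real_of_int b < real_of_int (int B)" using L by simp
    then have "b + 1 \<le> int B" unfolding of_int_less_iff by simp
    then have "real_of_int (b + 1) \<le> real_of_int (int B)" by (simp only: of_int_le_iff)
    then have "(of_int b + 1) * L \<le> real B * L" using L by (intro mult_right_mono) auto
    then show ?thesis using B by (simp add: L_def)
  qed
  have "(\<integral>\<^sup>+t\<in>{0..2*pi}. same_bucket B t t' \<partial>lborel) = (\<integral>\<^sup>+t. indicator {of_int b * L..<(of_int b + 1) * L} t \<partial>lborel)"
  proof (rule nn_integral_cong)
    fix t
    have "0 \<le> of_int b * L" using b0 L by simp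
    then show "same_bucket B t t' * indicator {0..2*pi} t = indicator {of_int b * L..<(of_int b + 1) * L} t"
      using buck[of t] b1 by (auto simp: same_bucket_def b_def[symmetric] indicator_def)
  qed
  also have "\<dots> = ennreal L"
    using L by (simp add: algebra_simps)
  finally show ?thesis using B by (simp add: L_def ennreal_mult'[symmetric])
qed

lemma same_bucket_close:
  assumes "B > 0" "bucket B t = bucket B t'"
  shows "\<bar>t - t'\<bar> \<le> 2 * pi / real B"
proof -
  have "\<bar>t * real B / (2 * pi) - t' * real B / (2 * pi)\<bar> < 1"
    using assms(2) unfolding bucket_def by linarith
  moreover have "t * real B / (2 * pi) - t' * real B / (2 * pi) = (t - t') * (real B / (2 * pi))"
    by (simp add: left_diff_distrib diff_divide_distrib)
  ultimately have "\<bar>t - t'\<bar> * (real B / (2 * pi)) \<le> 1" using assms(1) by (simp add: abs_mult)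
  then show ?thesis using assms(1) by (simp add: pos_le_divide_eq divide_le_eq mult.commute)
qed

lemma norm_cis_diff_le: "norm (cis a - cis b) \<le> \<bar>a - b\<bar>"
proof (rule power2_le_imp_le)
  have "cis a - cis b = - cis b * (1 - complex_of_real 1 * cis (a - b))"
    by (simp add: right_diff_distrib cis_mult)
  then have "norm (cis a - cis b) = norm (1 - complex_of_real 1 * cis (a - b))" by (simp only: norm_mult norm_minus_cancel norm_cis mult_1_left)
  then have "(norm (cis a - cis b))\<^sup>2 = 4 * \<bar>sin ((a - b) / 2)\<bar>\<^sup>2"
    by (simp only: norm_one_minus_cis_sq) simp
  also have "\<dots> \<le> 4 * \<bar>(a - b) / 2\<bar>\<^sup>2"
    by (intro mult_left_mono power_mono abs_sin_x_le_abs_x) auto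
  also have "\<dots> = \<bar>a - b\<bar>\<^sup>2" by (simp add: power_divide)
  finally show "(norm (cis a - cis b))\<^sup>2 \<le> \<bar>a - b\<bar>\<^sup>2" .
qed simp

lemma same_bucket_integrate_out:
  assumes \<theta>: "uniform_angles M \<theta>" and l: "l \<notin> J" and k: "k \<in> J"
    and F: "F \<in> borel_measurable (PiM J (\<lambda>_. borel))" and B: "B > 0"
  shows "(\<integral>\<^sup>+\<omega>. same_bucket B (\<theta> l \<omega>) (\<theta> k \<omega>) * F (\<lambda>i\<in>J. \<theta> i \<omega>) \<partial>M)
    = ennreal (1 / real B) * (\<integral>\<^sup>+\<omega>. F (\<lambda>i\<in>J. \<theta> i \<omega>) \<partial>M)"
proof -
  note [measurable] = uniform_angles_measurable[OF \<theta>] F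
  have "(\<integral>\<^sup>+\<omega>. same_bucket B (\<theta> l \<omega>) (\<theta> k \<omega>) * F (\<lambda>i\<in>J. \<theta> i \<omega>) \<partial>M)
      = (\<integral>\<^sup>+\<omega>. ennreal (1 / real B) * F (\<lambda>i\<in>J. \<theta> i \<omega>) \<partial>M)"
    unfolding uniform_angles_integrate_out[OF \<theta> l k F same_bucket_measurable]
  proof (rule nn_integral_cong_AE)
    show "AE \<omega> in M. ((\<integral>\<^sup>+t\<in>{0..2*pi}. same_bucket B t (\<theta> k \<omega>) \<partial>lborel) * ennreal (1 / (2 * pi))) * F (\<lambda>i\<in>J. \<theta> i \<omega>)
        = ennreal (1 / real B) * F (\<lambda>i\<in>J. \<theta> i \<omega>)"
      using uniform_angles_AE_range[OF \<theta>, of k] by eventually_elim (simp only: same_bucket_integral[OF B])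
  qed
  also have "\<dots> = ennreal (1 / real B) * (\<integral>\<^sup>+\<omega>. F (\<lambda>i\<in>J. \<theta> i \<omega>) \<partial>M)"
    by (rule nn_integral_cmult) measurable
  finally show ?thesis .
qed

lemma same_bucket_commute: "same_bucket B t t' = same_bucket B t' t"
  by (simp add: same_bucket_def eq_commute)

text \<open>Two distinct pairs differ in an index of the first, whose angle can be integrated
  out; by the exactness of the collision probability the result is a constant.\<close>

lemma collision_probability:
  assumes \<theta>: "uniform_angles M \<theta>"
  shows "j \<noteq> k \<Longrightarrow> B > 0 \<Longrightarrow> (\<integral>\<^sup>+\<omega>. same_bucket B (\<theta> j \<omega>) (\<theta> k \<omega>) \<partial>M) = ennreal (1 / real B)"
    and "j < k \<Longrightarrow> l < m \<Longrightarrow> (j, k) \<noteq> (l, m) \<Longrightarrow> B > 0 \<Longrightarrow> B' > 0 \<Longrightarrow>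
      (\<integral>\<^sup>+\<omega>. same_bucket B (\<theta> j \<omega>) (\<theta> k \<omega>) * same_bucket B' (\<theta> l \<omega>) (\<theta> m \<omega>) \<partial>M) = ennreal (1 / real B) * ennreal (1 / real B')"
proof -
  interpret prob_space M using \<theta> by (simp add: uniform_angles_def)
  show one: "(\<integral>\<^sup>+\<omega>. same_bucket B (\<theta> j \<omega>) (\<theta> k \<omega>) \<partial>M) = ennreal (1 / real B)" if "j \<noteq> k" "B > 0" for j k B
    using same_bucket_integrate_out[OF \<theta>, of j "{k}" k "\<lambda>_. 1" B] that by (simp add: emeasure_space_1)
  have two: "(\<integral>\<^sup>+\<omega>. same_bucket B (\<theta> x \<omega>) (\<theta> y \<omega>) * same_bucket B' (\<theta> l \<omega>) (\<theta> m \<omega>) \<partial>M) = ennreal (1 / real B) * ennreal (1 / real B')"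
    if "x \<notin> {y, l, m}" "l \<noteq> m" "B > 0" "B' > 0" for x y l m B B'
  proof -
    let ?J = "{y, l, m}"
    have c: "(\<lambda>v. v i) \<in> borel_measurable (PiM ?J (\<lambda>_. borel :: real measure))" if "i \<in> ?J" for i
      using that by (rule measurable_component_singleton)
    have "(\<lambda>v. same_bucket B' (v l) (v m)) \<in> borel_measurable (PiM ?J (\<lambda>_. borel :: real measure))"
      using measurable_compose[OF measurable_Pair[OF c[of l] c[of m]] same_bucket_measurable[of B']] by simp
    from same_bucket_integrate_out[OF \<theta> that(1) _ this that(3), of y]
    have "(\<integral>\<^sup>+\<omega>. same_bucket B (\<theta> x \<omega>) (\<theta> y \<omega>) * same_bucket B' ((\<lambda>i\<in>?J. \<theta> i \<omega>) l) ((\<lambda>i\<in>?J. \<theta> i \<omega>) m) \<partial>M)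
      = ennreal (1 / real B) * (\<integral>\<^sup>+\<omega>. same_bucket B' ((\<lambda>i\<in>?J. \<theta> i \<omega>) l) ((\<lambda>i\<in>?J. \<theta> i \<omega>) m) \<partial>M)"
      by blast
    moreover have "(\<lambda>i\<in>?J. \<theta> i \<omega>) l = \<theta> l \<omega>" "(\<lambda>i\<in>?J. \<theta> i \<omega>) m = \<theta> m \<omega>" for \<omega> by simp_all
    ultimately show ?thesis by (simp only: one[OF that(2,4)])
  qed
  show "(\<integral>\<^sup>+\<omega>. same_bucket B (\<theta> j \<omega>) (\<theta> k \<omega>) * same_bucket B' (\<theta> l \<omega>) (\<theta> m \<omega>) \<partial>M) = ennreal (1 / real B) * ennreal (1 / real B')"
    if a: "j < k" "l < m" "(j, k) \<noteq> (l, m)" "B > 0" "B' > 0"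
  \<comment> \<open>As both pairs are increasing and distinct, \<open>j\<close> or \<open>k\<close> does not occur in the second pair.\<close>
  proof (cases "k \<in> {l, m}")
    case False
    show ?thesis
      unfolding same_bucket_commute[of B "\<theta> j _"] by (rule two) (use a False in auto)
  next
    case True
    then have "j \<notin> {k, l, m}" using a by auto
    then show ?thesis by (intro two) (use a in auto)
  qed
qed

text \<open>Divides each shell into \<open>K\<close> subshells of equal thickness, numbered from the inside.\<close>

definition radial_label :: "nat \<Rightarrow> real \<Rightarrow> nat" where
  "radial_label K r = nat \<lfloor>real K * (1 - 2 ^ shell_index r * (1 - r))\<rfloor>"

lemma shell_scaled_gap:
  assumes r: "0 \<le> r" "r < 1"
  shows "0 < 2 ^ shell_index r * (1 - r)" "2 ^ shell_index r * (1 - r) \<le> 1"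
proof -
  show "0 < 2 ^ shell_index r * (1 - r)" using r by simp
  have "2 ^ shell_index r * (1 - r) \<le> 2 ^ shell_index r * (1/2) ^ shell_index r"
    using shell_index_bounds(2)[OF r] by (intro mult_left_mono) auto
  then show "2 ^ shell_index r * (1 - r) \<le> 1" by (simp add: power_mult_distrib[symmetric])
qed

lemma radial_label_less:
  assumes r: "0 \<le> r" "r < 1" and K: "K > 0"
  shows "radial_label K r < K"
proof -
  have "real K * (1 - 2 ^ shell_index r * (1 - r)) < real K * 1"
    using shell_scaled_gap[OF r] K by (intro mult_strict_left_mono) auto
  then have "\<lfloor>real K * (1 - 2 ^ shell_index r * (1 - r))\<rfloor> < int K" by (simp add: floor_less_iff)
  then show ?thesis using K by (simp add: radial_label_def)
qed

lemma radial_label_close: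
  assumes r: "0 \<le> r" "r < 1" "0 \<le> r'" "r' < 1" and K: "K > 0"
    and same: "shell_index r = shell_index r'" "radial_label K r = radial_label K r'"
  shows "\<bar>r - r'\<bar> \<le> (1/2) ^ shell_index r / real K"
proof -
  define n where "n = shell_index r"
  define a where "a = real K * (1 - 2 ^ n * (1 - r))"
  define a' where "a' = real K * (1 - 2 ^ n * (1 - r'))"
  have "0 \<le> a" "0 \<le> a'"
    using shell_scaled_gap[OF r(1,2)] shell_scaled_gap[OF r(3,4)] same(1) by (auto simp: a_def a'_def n_def)
  then have "0 \<le> \<lfloor>a\<rfloor>" "0 \<le> \<lfloor>a'\<rfloor>" by simp_all
  moreover have "nat \<lfloor>a\<rfloor> = nat \<lfloor>a'\<rfloor>" using same by (simp add: radial_label_def a_def a'_def n_def)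
  ultimately have "\<lfloor>a\<rfloor> = \<lfloor>a'\<rfloor>" by (rule eq_nat_nat_iff[THEN iffD1])
  then have "\<bar>a - a'\<bar> \<le> 1" by linarith
  moreover have "a - a' = real K * 2 ^ n * (r - r')" by (simp add: a_def a'_def algebra_simps)
  ultimately have "(real K * 2 ^ n) * \<bar>r - r'\<bar> \<le> 1" by (simp add: abs_mult)
  then have "\<bar>r - r'\<bar> \<le> 1 / (real K * 2 ^ n)" using K by (simp add: pos_le_divide_eq mult.commute)
  also have "\<dots> = (1/2) ^ n / real K" by (simp only: power_one_over divide_divide_eq_left mult.commute)
  finally show ?thesis unfolding n_def .
qed

context
  fixes \<rho> :: "nat \<Rightarrow> real" and K n\<^sub>0 :: nat
  assumes \<rho>: "\<And>k. \<rho> k \<in> {0..<1}" and K: "K > 0"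
begin

abbreviation "J \<equiv> essential_indices \<rho>"
abbreviation "sh k \<equiv> shell_index (\<rho> k)"
abbreviation "lab k \<equiv> radial_label K (\<rho> k)"

text \<open>The collision probability of \<open>j\<close> and \<open>k\<close> in the partition of shell \<open>n\<close> into \<open>K\<close> subshells and \<open>K * 2\<^sup>n\<close> arcs,
  provided the radii lie in the same subshell; the boxes of this partition have diameter comparable to \<open>2 powr -n / K\<close>.\<close>

definition box_weight :: "nat \<Rightarrow> nat \<Rightarrow> ennreal" where
  "box_weight j k = (if j \<in> J \<and> k \<in> J \<and> sh j = sh k \<and> n\<^sub>0 \<le> sh j \<and> lab j = lab k
     then ennreal (1 / real (K * 2 ^ sh j)) else 0)"

definition box_pairs :: "(nat \<times> nat) set" where
  "box_pairs = {(j, k). j < k \<and> j \<in> J \<and> k \<in> J \<and> sh j = sh k \<and> n\<^sub>0 \<le> sh j \<and> lab j = lab k}"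

text \<open>Cauchy-Schwarz over the \<open>K\<close> subshells: if subshell \<open>l\<close> contains \<open>x l\<close> of the \<open>N\<close> points, then
  \<open>N\<^sup>2 \<le> K * (\<Sum>l. (x l)\<^sup>2)\<close>, and the last sum counts pairs with equal labels.\<close>

lemma square_count_le_box_weight:
  "(\<Sum>n. (if n\<^sub>0 \<le> n then ennreal (2 powr (- real n)) else 0) * (radial_count \<rho> n)\<^sup>2)
    \<le> ennreal ((real K)\<^sup>2) * (\<Sum>j. \<Sum>k. box_weight j k)"
proof -
  define i where "i j n l = (if j \<in> J \<and> sh j = n \<and> lab j = l then 1 else 0 :: ennreal)" for j n l
  define x where "x n l = (\<Sum>j. i j n l)" for n l
  define c where "c n = (if n\<^sub>0 \<le> n then ennreal (1 / real (K * 2 ^ n)) else 0)" for n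
  have \<rho>': "0 \<le> \<rho> k" "\<rho> k < 1" for k using \<rho>[of k] by auto
  have N: "radial_count \<rho> n = (\<Sum>l. (if l < K then 1 else 0) * x n l)" for n
  proof -
    have "radial_count \<rho> n = (\<Sum>m\<in>{n}. (if m = n then 1 else 0) * radial_count \<rho> m)" by simp
    also have "\<dots> = (\<Sum>m. (if m = n then 1 else 0) * radial_count \<rho> m)"
      by (rule suminf_finite[symmetric]) auto
    also have "\<dots> = (\<Sum>k. if k \<in> J then (if sh k = n then 1 else 0) else 0)"
      by (rule suminf_shell[where \<rho> = \<rho> and h = "\<lambda>m. if m = n then 1 else 0", OF \<rho>, symmetric])
    also have "\<dots> = (\<Sum>k. \<Sum>l. (if l < K then 1 else 0) * i k n l)"
    proof (rule suminf_cong)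
      fix k
      have "(\<Sum>l. (if l < K then 1 else 0) * i k n l) = (\<Sum>l\<in>{lab k}. (if l < K then 1 else 0) * i k n l)"
        by (rule suminf_finite) (auto simp: i_def)
      then show "(if k \<in> J then (if sh k = n then 1 else 0) else 0) = (\<Sum>l. (if l < K then 1 else 0) * i k n l)"
        using radial_label_less[OF \<rho>' K, of k] by (simp add: i_def)
    qed
    also have "\<dots> = (\<Sum>l. (if l < K then 1 else 0) * x n l)"
      unfolding x_def by (subst suminf_swap_ennreal) (simp only: ennreal_suminf_cmult)
    finally show ?thesis .
  qed
  have N2: "(radial_count \<rho> n)\<^sup>2 \<le> ennreal (real K) * (\<Sum>l. (x n l)\<^sup>2)" for n
  proof -
    have "(radial_count \<rho> n)\<^sup>2 \<le> (\<Sum>l. (if l < K then 1 else 0 :: ennreal)\<^sup>2) * (\<Sum>l. (x n l)\<^sup>2)"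
      unfolding N by (rule Cauchy_Schwarz_suminf_ennreal)
    also have "(\<Sum>l. (if l < K then 1 else 0 :: ennreal)\<^sup>2) = (\<Sum>l<K. (if l < K then 1 else 0 :: ennreal)\<^sup>2)"
      by (rule suminf_finite) auto
    also have "\<dots> = ennreal (real K)" by (simp add: ennreal_of_nat_eq_real_of_nat)
    finally show ?thesis .
  qed
  have box: "box_weight j k = (\<Sum>n. \<Sum>l. c n * (i j n l * i k n l))" for j k
  proof -
    have "(\<Sum>n. \<Sum>l. c n * (i j n l * i k n l)) = (\<Sum>n\<in>{sh j}. \<Sum>l. c n * (i j n l * i k n l))"
      by (rule suminf_finite) (auto simp: i_def)
    also have "\<dots> = (\<Sum>l\<in>{lab j}. c (sh j) * (i j (sh j) l * i k (sh j) l))"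
      by (simp, subst suminf_finite[of "{lab j}"]) (auto simp: i_def)
    also have "\<dots> = box_weight j k" by (auto simp: i_def c_def box_weight_def)
    finally show ?thesis ..
  qed
  have "(\<Sum>n. (if n\<^sub>0 \<le> n then ennreal (2 powr (- real n)) else 0) * (radial_count \<rho> n)\<^sup>2)
     \<le> (\<Sum>n. ennreal ((real K)\<^sup>2) * (c n * (\<Sum>l. (x n l)\<^sup>2)))"
  proof (intro suminf_le allI)
    fix n
    have e: "(if n\<^sub>0 \<le> n then ennreal (2 powr (- real n)) else 0) = ennreal (real K) * c n"
    proof -
      have "real K * (1 / real (K * 2 ^ n)) = 2 powr (- real n)"
        using K by (simp add: powr_minus powr_realpow inverse_eq_divide)
      then show ?thesis by (simp add: c_def ennreal_mult'[symmetric])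
    qed
    have "(if n\<^sub>0 \<le> n then ennreal (2 powr (- real n)) else 0) * (radial_count \<rho> n)\<^sup>2
      \<le> (ennreal (real K) * c n) * (ennreal (real K) * (\<Sum>l. (x n l)\<^sup>2))"
      unfolding e by (intro mult_left_mono N2) simp
    also have "\<dots> = (ennreal (real K) * ennreal (real K)) * (c n * (\<Sum>l. (x n l)\<^sup>2))" by (simp only: mult_ac)
    also have "ennreal (real K) * ennreal (real K) = ennreal ((real K)\<^sup>2)"
      unfolding power2_eq_square by (rule ennreal_mult[symmetric]) simp_all
    finally show "(if n\<^sub>0 \<le> n then ennreal (2 powr (- real n)) else 0) * (radial_count \<rho> n)\<^sup>2
      \<le> ennreal ((real K)\<^sup>2) * (c n * (\<Sum>l. (x n l)\<^sup>2))" .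
  qed auto
  also have "\<dots> = ennreal ((real K)\<^sup>2) * (\<Sum>n. \<Sum>l. \<Sum>j. \<Sum>k. c n * (i j n l * i k n l))"
    unfolding x_def power2_eq_square ennreal_suminf_cmult ennreal_suminf_multc ..
  also have "(\<Sum>n. \<Sum>l. \<Sum>j. \<Sum>k. c n * (i j n l * i k n l)) = (\<Sum>n. \<Sum>j. \<Sum>k. \<Sum>l. c n * (i j n l * i k n l))"
  proof (rule suminf_cong)
    fix n
    have "(\<Sum>l. \<Sum>j. \<Sum>k. c n * (i j n l * i k n l)) = (\<Sum>j. \<Sum>l. \<Sum>k. c n * (i j n l * i k n l))"
      by (rule suminf_swap_ennreal)
    also have "\<dots> = (\<Sum>j. \<Sum>k. \<Sum>l. c n * (i j n l * i k n l))"
      by (rule suminf_cong) (rule suminf_swap_ennreal)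
    finally show "(\<Sum>l. \<Sum>j. \<Sum>k. c n * (i j n l * i k n l)) = (\<Sum>j. \<Sum>k. \<Sum>l. c n * (i j n l * i k n l))" .
  qed
  also have "\<dots> = (\<Sum>j. \<Sum>n. \<Sum>k. \<Sum>l. c n * (i j n l * i k n l))" by (rule suminf_swap_ennreal)
  also have "\<dots> = (\<Sum>j. \<Sum>k. \<Sum>n. \<Sum>l. c n * (i j n l * i k n l))"
    by (rule suminf_cong) (rule suminf_swap_ennreal)
  also have "\<dots> = (\<Sum>j. \<Sum>k. box_weight j k)" unfolding box ..
  finally show ?thesis .
qed

text \<open>The diagonal pairs contribute \<open>\<Sum>n. 2 powr -n * N n\<close>, which is finite, and so do finitely many shells; hence the
  divergence comes from the pairs \<open>j < k\<close>.\<close>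

lemma box_pairs_diverge:
  assumes inf: "(\<Sum>n. ennreal (2 powr (- real n)) * (radial_count \<rho> n)\<^sup>2) = \<infinity>"
    and fin: "(\<Sum>n. ennreal (2 powr (- real n)) * radial_count \<rho> n) < \<infinity>"
  shows "\<exists>F\<subseteq>box_pairs. finite F \<and> R < (\<Sum>(j, k)\<in>F. 1 / real (K * 2 ^ sh j))"
proof (rule ccontr)
  assume "\<not> ?thesis"
  then have bd: "(\<Sum>(j, k)\<in>F. 1 / real (K * 2 ^ sh j)) \<le> R" if "F \<subseteq> box_pairs" "finite F" for F
    using that by (meson not_le)
  define g where "g j k = (if (j, k) \<in> box_pairs then ennreal (1 / real (K * 2 ^ sh j)) else 0)" for j k
  define h where "h j = (if j \<in> J then ennreal (2 powr (- real (sh j))) else 0)" for j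
  have T: "(\<Sum>j. \<Sum>k. g j k) \<le> ennreal R"
  proof (rule suminf_le_const[OF summableI])
    fix a
    have "(\<Sum>j<a. \<Sum>k. g j k) = (\<Sum>k. \<Sum>j<a. g j k)"
      by (rule suminf_sum[symmetric]) (rule summableI)
    also have "\<dots> \<le> ennreal R"
    proof (rule suminf_le_const[OF summableI])
      fix b
      define F where "F = box_pairs \<inter> ({..<a} \<times> {..<b})"
      have fF: "finite F" by (simp add: F_def)
      have "(\<Sum>k<b. \<Sum>j<a. g j k) = (\<Sum>j<a. \<Sum>k<b. g j k)" by (rule sum.swap)
      also have "\<dots> = (\<Sum>q\<in>{..<a} \<times> {..<b}. g (fst q) (snd q))"
        by (simp add: sum.cartesian_product case_prod_beta')
      also have "\<dots> = (\<Sum>q\<in>F. g (fst q) (snd q))"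
        by (rule sum.mono_neutral_right) (auto simp: F_def g_def)
      also have "\<dots> = (\<Sum>q\<in>F. ennreal (1 / real (K * 2 ^ sh (fst q))))"
        by (rule sum.cong) (auto simp: F_def g_def)
      also have "\<dots> = ennreal (\<Sum>q\<in>F. 1 / real (K * 2 ^ sh (fst q)))" by (rule sum_ennreal) simp
      also have "\<dots> \<le> ennreal R"
        using bd[of F] fF by (intro ennreal_leI) (simp add: F_def case_prod_beta')
      finally show "(\<Sum>k<b. \<Sum>j<a. g j k) \<le> ennreal R" .
    qed
    finally show "(\<Sum>j<a. \<Sum>k. g j k) \<le> ennreal R" .
  qed
  have pt: "box_weight j k \<le> g j k + g k j + (if k = j then 1 else 0) * h j" for j k
  proof (cases "j \<in> J \<and> k \<in> J \<and> sh j = sh k \<and> n\<^sub>0 \<le> sh j \<and> lab j = lab k")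
    case True
    consider "j < k" | "k < j" | "j = k" by linarith
    then show ?thesis
    proof cases
      case 1
      then show ?thesis using True by (simp add: box_weight_def g_def box_pairs_def)
    next
      case 2
      then show ?thesis using True by (simp add: box_weight_def g_def box_pairs_def)
    next
      case 3
      have "1 / real (K * 2 ^ sh j) \<le> 1 / 2 ^ sh j" using K by (intro divide_left_mono) auto
      also have "\<dots> = 2 powr (- real (sh j))" by (simp add: powr_minus powr_realpow inverse_eq_divide)
      finally have "ennreal (1 / real (K * 2 ^ sh j)) \<le> h j" using True by (simp only: h_def if_True ennreal_leI)
      then show ?thesis using 3 True by (simp add: box_weight_def g_def box_pairs_def)
    qed
  next
    case False
    then show ?thesis by (simp only: box_weight_def if_False zero_le)
  qed
  have "(\<Sum>j. \<Sum>k. box_weight j k) \<le> (\<Sum>j. \<Sum>k. g j k + g k j + (if k = j then 1 else 0) * h j)"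
    by (intro suminf_le allI pt) auto
  also have "\<dots> = (\<Sum>j. \<Sum>k. g j k) + (\<Sum>j. \<Sum>k. g k j) + (\<Sum>j. \<Sum>k. (if k = j then 1 else 0) * h j)"
    by (simp add: suminf_add[symmetric])
  also have "(\<Sum>j. \<Sum>k. g k j) = (\<Sum>j. \<Sum>k. g j k)" by (rule suminf_swap_ennreal)
  also have "(\<Sum>j. \<Sum>k. (if k = j then 1 else 0) * h j) = (\<Sum>j. h j)"
  proof (rule suminf_cong)
    fix j
    have "(\<Sum>k. (if k = j then 1 else 0) * h j) = (\<Sum>k\<in>{j}. (if k = j then 1 else 0) * h j)"
      by (rule suminf_finite) auto
    then show "(\<Sum>k. (if k = j then 1 else 0) * h j) = h j" by simp
  qed
  also have "(\<Sum>j. h j) = (\<Sum>n. ennreal (2 powr (- real n)) * radial_count \<rho> n)"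
    unfolding h_def by (rule suminf_shell[where \<rho> = \<rho> and h = "\<lambda>n. ennreal (2 powr (- real n))", OF \<rho>])
  finally have "(\<Sum>j. \<Sum>k. box_weight j k) \<le> (\<Sum>j. \<Sum>k. g j k) + (\<Sum>j. \<Sum>k. g j k) + (\<Sum>n. ennreal (2 powr (- real n)) * radial_count \<rho> n)" .
  also have "\<dots> \<le> ennreal R + ennreal R + (\<Sum>n. ennreal (2 powr (- real n)) * radial_count \<rho> n)"
    by (intro add_mono T order_refl)
  also have "\<dots> < \<infinity>" using fin by (simp only: infinity_ennreal_def ennreal_add_less_top ennreal_less_top)
  finally have bw: "(\<Sum>j. \<Sum>k. box_weight j k) < \<infinity>" .
  let ?t = "\<lambda>n. ennreal (2 powr (- real n)) * (radial_count \<rho> n)\<^sup>2"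
  have tail: "(\<Sum>n. (if n\<^sub>0 \<le> n then ennreal (2 powr (- real n)) else 0) * (radial_count \<rho> n)\<^sup>2) < \<infinity>"
    by (rule le_less_trans[OF square_count_le_box_weight])
       (intro ennreal_mult_less_infinity bw, simp)
  have Nfin: "radial_count \<rho> n < \<infinity>" for n
  proof (rule ccontr)
    assume "\<not> radial_count \<rho> n < \<infinity>"
    then have "radial_count \<rho> n = top" by (simp add: less_top[symmetric])
    then have "ennreal (2 powr (- real n)) * radial_count \<rho> n = top" by (simp add: ennreal_mult_top)
    moreover have "ennreal (2 powr (- real n)) * radial_count \<rho> n < \<infinity>"
      using suminf_ennreal_member_le fin by (rule le_less_trans)
    ultimately show False by simp
  qed
  have "(\<Sum>n. ?t n) = (\<Sum>n. (if n\<^sub>0 \<le> n then ennreal (2 powr (- real n)) else 0) * (radial_count \<rho> n)\<^sup>2 + (if n < n\<^sub>0 then ?t n else 0))"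
    by (rule suminf_cong) auto
  also have "\<dots> = (\<Sum>n. (if n\<^sub>0 \<le> n then ennreal (2 powr (- real n)) else 0) * (radial_count \<rho> n)\<^sup>2) + (\<Sum>n. if n < n\<^sub>0 then ?t n else 0)"
    by (rule suminf_add[symmetric]) (rule summableI)+
  also have "(\<Sum>n. if n < n\<^sub>0 then ?t n else 0) = (\<Sum>n<n\<^sub>0. if n < n\<^sub>0 then ?t n else 0)"
    by (rule suminf_finite) auto
  finally have "(\<Sum>n. ?t n) = (\<Sum>n. (if n\<^sub>0 \<le> n then ennreal (2 powr (- real n)) else 0) * (radial_count \<rho> n)\<^sup>2) + (\<Sum>n<n\<^sub>0. if n < n\<^sub>0 then ?t n else 0)" .
  moreover have "(\<Sum>n<n\<^sub>0. if n < n\<^sub>0 then ?t n else 0) < \<infinity>"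
  proof -
    have "?t n < top" for n
    proof -
      have "(radial_count \<rho> n)\<^sup>2 < \<infinity>" unfolding power2_eq_square by (intro ennreal_mult_less_infinity Nfin)
      then show ?thesis unfolding infinity_ennreal_def[symmetric] by (intro ennreal_mult_less_infinity) simp_all
    qed
    then show ?thesis by (simp add: infinity_ennreal_def)
  qed
  ultimately have "(\<Sum>n. ?t n) < \<infinity>" using tail by (simp only: infinity_ennreal_def ennreal_add_less_top)
  with inf show False by simp
qed

text \<open>The expected number of collisions in polar boxes is infinite and the collisions are pairwise
  independent, so one of them occurs; colliding points are as close as the size of their box.\<close>

lemma AE_close_pair:
  fixes M :: "'a measure" and \<theta> :: "nat \<Rightarrow> 'a \<Rightarrow> real"
  assumes \<theta>: "uniform_angles M \<theta>"
    and inf: "(\<Sum>n. ennreal (2 powr (- real n)) * (radial_count \<rho> n)\<^sup>2) = \<infinity>"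
    and fin: "(\<Sum>n. ennreal (2 powr (- real n)) * radial_count \<rho> n) < \<infinity>"
  shows "AE \<omega> in M. \<exists>j k. j \<noteq> k \<and> j \<in> J \<and> k \<in> J \<and> sh j = sh k \<and> n\<^sub>0 \<le> sh j \<and>
    norm (of_real (\<rho> j) * cis (\<theta> j \<omega>) - of_real (\<rho> k) * cis (\<theta> k \<omega>)) \<le> 8 / real K * (1/2) ^ sh j"
proof -
  interpret prob_space M using \<theta> by (simp add: uniform_angles_def)
  note [measurable] = uniform_angles_measurable[OF \<theta>]
  have \<rho>': "0 \<le> \<rho> k" "\<rho> k < 1" for k using \<rho>[of k] by auto
  define B where "B q = K * 2 ^ sh (fst q)" for q :: "nat \<times> nat"
  have B: "B q > 0" for q using K by (simp add: B_def)
  define b where "b q \<omega> = same_bucket (B q) (\<theta> (fst q) \<omega>) (\<theta> (snd q) \<omega>)" for q \<omega>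
  have bm[measurable]: "b q \<in> borel_measurable M" for q
  proof -
    have "(\<lambda>\<omega>. (\<theta> (fst q) \<omega>, \<theta> (snd q) \<omega>)) \<in> measurable M (borel \<Otimes>\<^sub>M borel)" by measurable
    from measurable_compose[OF this same_bucket_measurable[of "B q"]] show ?thesis by (simp add: b_def[abs_def])
  qed
  define A where "A q = {\<omega> \<in> space M. b q \<omega> = 1}" for q
  have b01: "b q \<omega> = indicator (A q) \<omega>" if "\<omega> \<in> space M" for q \<omega>
    using that by (simp add: A_def b_def same_bucket_def indicator_def)
  have Aev: "A q \<in> events" for q unfolding A_def by measurable
  have "AE \<omega> in M. \<exists>q\<in>box_pairs. \<omega> \<in> A q"
  proof (rule pairwise_independent_AE_exists[where p = "\<lambda>q. 1 / real (B q)"])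
    show "A q \<in> events" for q by (rule Aev)
    show "prob (A q) = 1 / real (B q)" if q: "q \<in> box_pairs" for q
    proof -
      have "emeasure M (A q) = (\<integral>\<^sup>+\<omega>. indicator (A q) \<omega> \<partial>M)" by (rule nn_integral_indicator[OF Aev, symmetric])
      also have "\<dots> = (\<integral>\<^sup>+\<omega>. b q \<omega> \<partial>M)" by (rule nn_integral_cong) (simp add: b01)
      also have "\<dots> = ennreal (1 / real (B q))"
        unfolding b_def by (rule collision_probability(1)[OF \<theta> _ B]) (use q in \<open>auto simp: box_pairs_def\<close>)
      finally show ?thesis by (simp add: measure_def)
    qed
    show "prob (A q \<inter> A q') \<le> 1 / real (B q) * (1 / real (B q'))" if q: "q \<in> box_pairs" "q' \<in> box_pairs" "q \<noteq> q'" for q q'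
    proof -
      have "emeasure M (A q \<inter> A q') = (\<integral>\<^sup>+\<omega>. indicator (A q \<inter> A q') \<omega> \<partial>M)"
        by (rule nn_integral_indicator[symmetric]) (intro sets.Int Aev)
      also have "\<dots> = (\<integral>\<^sup>+\<omega>. b q \<omega> * b q' \<omega> \<partial>M)"
        by (rule nn_integral_cong) (simp add: b01 indicator_inter_arith)
      also have "\<dots> = ennreal (1 / real (B q)) * ennreal (1 / real (B q'))"
        unfolding b_def
        by (rule collision_probability(2)[OF \<theta> _ _ _ B B]) (use q in \<open>auto simp: box_pairs_def\<close>)
      also have "\<dots> = ennreal (1 / real (B q) * (1 / real (B q')))" by (rule ennreal_mult[symmetric]) simp_all
      finally show ?thesis by (simp add: measure_def)
    qed
    show "\<exists>F\<subseteq>box_pairs. finite F \<and> R < (\<Sum>q\<in>F. 1 / real (B q))" for R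
      using box_pairs_diverge[OF inf fin, of R] by (simp add: B_def case_prod_beta')
  qed
  then show ?thesis
  proof eventually_elim
    fix \<omega> assume "\<exists>q\<in>box_pairs. \<omega> \<in> A q"
    then obtain j k where q: "(j, k) \<in> box_pairs" "\<omega> \<in> A (j, k)" by auto
    have jk: "j < k" "j \<in> J" "k \<in> J" "sh j = sh k" "n\<^sub>0 \<le> sh j" "lab j = lab k"
      using q(1) by (auto simp: box_pairs_def)
    have buck: "bucket (B (j, k)) (\<theta> j \<omega>) = bucket (B (j, k)) (\<theta> k \<omega>)"
      using q(2) by (auto simp: A_def b_def same_bucket_def split: if_splits)
    have "\<bar>\<theta> j \<omega> - \<theta> k \<omega>\<bar> \<le> 2 * pi / real (B (j, k))" by (rule same_bucket_close[OF B buck])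
    also have "real (B (j, k)) = real K * 2 ^ sh j" by (simp only: B_def fst_conv of_nat_mult of_nat_power of_nat_numeral)
    also have "2 * pi / (real K * 2 ^ sh j) = (2 * pi / real K) * (1/2) ^ sh j"
      unfolding power_one_over times_divide_times_eq by (simp only: mult_1_right)
    also have "\<dots> \<le> (7 / real K) * (1/2) ^ sh j"
      using pi_approx by (intro mult_right_mono divide_right_mono) auto
    finally have ang: "\<bar>\<theta> j \<omega> - \<theta> k \<omega>\<bar> \<le> (7 / real K) * (1/2) ^ sh j" .
    have rad: "\<bar>\<rho> j - \<rho> k\<bar> \<le> (1/2) ^ sh j / real K"
      by (rule radial_label_close[OF \<rho>' \<rho>' K jk(4,6)])
    have "of_real (\<rho> j) * cis (\<theta> j \<omega>) - of_real (\<rho> k) * cis (\<theta> k \<omega>)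
      = of_real (\<rho> j - \<rho> k) * cis (\<theta> j \<omega>) + of_real (\<rho> k) * (cis (\<theta> j \<omega>) - cis (\<theta> k \<omega>))"
      by (simp add: algebra_simps)
    then have "norm (of_real (\<rho> j) * cis (\<theta> j \<omega>) - of_real (\<rho> k) * cis (\<theta> k \<omega>))
      \<le> norm (of_real (\<rho> j - \<rho> k) * cis (\<theta> j \<omega>)) + norm (of_real (\<rho> k) * (cis (\<theta> j \<omega>) - cis (\<theta> k \<omega>)))"
      by (simp only: norm_triangle_ineq)
    also have "\<dots> = \<bar>\<rho> j - \<rho> k\<bar> + \<rho> k * norm (cis (\<theta> j \<omega>) - cis (\<theta> k \<omega>))"
      using \<rho>'(1)[of k] by (simp only: norm_mult norm_cis norm_of_real abs_of_nonneg mult_1_right)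
    also have "\<dots> \<le> (1/2) ^ sh j / real K + 1 * ((7 / real K) * (1/2) ^ sh j)"
      using \<rho>'[of k] by (intro add_mono rad mult_mono order_trans[OF norm_cis_diff_le ang]) auto
    also have "\<dots> = 8 / real K * (1/2) ^ sh j"
    proof -
      have "y / real K + 1 * ((7 / real K) * y) = 8 / real K * y" for y
        using K by (simp add: field_simps)
      then show ?thesis .
    qed
    finally have close: "norm (of_real (\<rho> j) * cis (\<theta> j \<omega>) - of_real (\<rho> k) * cis (\<theta> k \<omega>)) \<le> 8 / real K * (1/2) ^ sh j" .
    have "j \<noteq> k" using jk(1) by simp
    then show "\<exists>j k. j \<noteq> k \<and> j \<in> J \<and> k \<in> J \<and> sh j = sh k \<and> n\<^sub>0 \<le> sh j \<and>
      norm (of_real (\<rho> j) * cis (\<theta> j \<omega>) - of_real (\<rho> k) * cis (\<theta> k \<omega>)) \<le> 8 / real K * (1/2) ^ sh j"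
      using jk(2-5) close by (intro exI[of _ j] exI[of _ k] conjI)
  qed
qed

end

section \<open>The zero-one dichotomy\<close>

text \<open>Almost surely the angles are distinct modulo \<open>2 * pi\<close>, so points can only coincide at the origin.\<close>

lemma AE_random_set_eq_image:
  assumes \<theta>: "uniform_angles M \<theta>" and \<rho>: "\<And>k. \<rho> k \<in> {0..<1}"
  shows "AE \<omega> in M. random_set \<rho> \<theta> \<omega> = (\<lambda>k. complex_of_real (\<rho> k) * cis (\<theta> k \<omega>)) ` essential_indices \<rho> \<and>
    inj_on (\<lambda>k. complex_of_real (\<rho> k) * cis (\<theta> k \<omega>)) (essential_indices \<rho>)"
proof -
  interpret prob_space M using \<theta> by (simp add: uniform_angles_def)
  have indep: "indep_vars (\<lambda>_. borel) \<theta> UNIV" using \<theta> by (simp add: uniform_angles_def)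
  have unif: "distributed M lborel (\<theta> k) (\<lambda>x. indicator {0..2*pi} x / measure lborel {0..2*pi})" for k
    using \<theta> by (simp add: uniform_angles_def)
  have "AE \<omega> in M. \<forall>j k. j \<noteq> k \<longrightarrow> cis (\<theta> k \<omega>) \<noteq> cis (\<theta> j \<omega>)"
    unfolding AE_all_countable using AE_cis_neq[OF indep unif] by auto
  then show ?thesis
  proof eventually_elim
    fix \<omega> assume neq: "\<forall>j k. j \<noteq> k \<longrightarrow> cis (\<theta> k \<omega>) \<noteq> cis (\<theta> j \<omega>)"
    define p where "p k = complex_of_real (\<rho> k) * cis (\<theta> k \<omega>)" for k
    let ?J = "essential_indices \<rho>"
    have np: "norm (p k) = \<rho> k" for k using \<rho>[of k] by (simp add: p_def norm_mult)
    have inj: "inj_on p ?J"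
    proof (rule inj_onI)
      fix j k assume jk: "j \<in> ?J" "k \<in> ?J" "p j = p k"
      then have r: "\<rho> j = \<rho> k" by (metis np)
      show "j = k"
      proof (cases "\<rho> k = 0")
        case True
        then have "\<not> j < k" "\<not> k < j" using jk r by (auto simp: essential_indices_def)
        then show ?thesis by simp
      next
        case False
        then have "cis (\<theta> j \<omega>) = cis (\<theta> k \<omega>)" using jk(3) r by (simp add: p_def)
        then show ?thesis using neq by metis
      qed
    qed
    have "range p = p ` ?J"
    proof
      show "range p \<subseteq> p ` ?J"
      proof
        fix x assume "x \<in> range p"
        then obtain k where k: "x = p k" by auto
        show "x \<in> p ` ?J"
        proof (cases "\<rho> k = 0")
          case True
          define m where "m = (LEAST m. \<rho> m = 0)"
          have m: "\<rho> m = 0" unfolding m_def using True by (rule LeastI)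
          have "\<forall>j<m. \<rho> j \<noteq> 0" unfolding m_def using not_less_Least by blast
          then have "m \<in> ?J" by (simp add: essential_indices_def)
          moreover have "x = p m" using k m True by (simp add: p_def)
          ultimately show ?thesis by blast
        next
          case False
          then show ?thesis using k by (auto simp: essential_indices_def)
        qed
      qed
    qed auto
    then show "random_set \<rho> \<theta> \<omega> = (\<lambda>k. complex_of_real (\<rho> k) * cis (\<theta> k \<omega>)) ` ?J \<and>
      inj_on (\<lambda>k. complex_of_real (\<rho> k) * cis (\<theta> k \<omega>)) ?J"
      using inj unfolding random_set_def p_def[abs_def] by blast
  qed
qed

lemma AE_interpolating_of_gram_square:
  assumes \<theta>: "uniform_angles M \<theta>" and \<rho>: "\<And>k. \<rho> k \<in> {0..<1}" and \<alpha>: "0 < \<alpha>" "\<alpha> < 1"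
    and w: "(\<Sum>k. ennreal ((radial_weight (1 - \<alpha>) \<rho> (essential_indices \<rho>) k)\<^sup>2)) < \<infinity>"
    and gram: "AE \<omega> in M. (\<Sum>k. \<Sum>l. (\<Sum>j. gram_entry (1 - \<alpha>) \<rho> (essential_indices \<rho>) (\<lambda>k. \<theta> k \<omega>) j k
      * gram_entry (1 - \<alpha>) \<rho> (essential_indices \<rho>) (\<lambda>k. \<theta> k \<omega>) j l)\<^sup>2) < \<infinity>"
  shows "AE \<omega> in M. interpolating \<alpha> (random_set \<rho> \<theta> \<omega>)"
  using AE_random_set_eq_image[OF \<theta> \<rho>] gram
proof eventually_elim
  fix \<omega>
  let ?J = "essential_indices \<rho>"
  define z where "z = (\<lambda>k. complex_of_real (\<rho> k) * cis (\<theta> k \<omega>))"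
  assume im: "random_set \<rho> \<theta> \<omega> = (\<lambda>k. complex_of_real (\<rho> k) * cis (\<theta> k \<omega>)) ` ?J \<and>
    inj_on (\<lambda>k. complex_of_real (\<rho> k) * cis (\<theta> k \<omega>)) ?J"
  assume fin: "(\<Sum>k. \<Sum>l. (\<Sum>j. gram_entry (1 - \<alpha>) \<rho> ?J (\<lambda>k. \<theta> k \<omega>) j k
      * gram_entry (1 - \<alpha>) \<rho> ?J (\<lambda>k. \<theta> k \<omega>) j l)\<^sup>2) < \<infinity>"
  have nz: "norm (z k) = \<rho> k" for k using \<rho>[of k] by (simp add: z_def norm_mult)
  have u: "(\<lambda>k. if k \<in> ?J then (1 - (norm (z k))\<^sup>2) powr ((1 - \<alpha>) / 2) else 0) = radial_weight (1 - \<alpha>) \<rho> ?J"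
    by (simp add: fun_eq_iff radial_weight_def nz)
  have "interpolating \<alpha> (z ` ?J)"
  proof (rule interpolating_of_gram_square_summable)
    show "norm (z k) < 1" for k using \<rho>[of k] by (simp add: nz)
    show "inj_on z ?J" using im by (simp add: z_def)
    show "summable (\<lambda>k. (if k \<in> ?J then (1 - (norm (z k))\<^sup>2) powr ((1 - \<alpha>) / 2) else 0)\<^sup>2)"
      unfolding fun_cong[OF u] by (rule suminf_ennreal_lt_top_iff[THEN iffD1, OF _ w]) simp
    show "(\<Sum>k. \<Sum>l. (\<Sum>j. ennreal (if j = k then 0 else gram_weight (1 - \<alpha>)
        (\<lambda>k. if k \<in> ?J then (1 - (norm (z k))\<^sup>2) powr ((1 - \<alpha>) / 2) else 0) z j k)
      * ennreal (if j = l then 0 else gram_weight (1 - \<alpha>)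
        (\<lambda>k. if k \<in> ?J then (1 - (norm (z k))\<^sup>2) powr ((1 - \<alpha>) / 2) else 0) z j l))\<^sup>2) < \<infinity>"
      using fin unfolding u gram_entry_def z_def[symmetric] .
  qed (use \<alpha> in auto)
  then show "interpolating \<alpha> (random_set \<rho> \<theta> \<omega>)" using im by (simp add: z_def)
qed

lemma AE_not_interpolating_of_weights_divergent:
  assumes \<theta>: "uniform_angles M \<theta>" and \<rho>: "\<And>k. \<rho> k \<in> {0..<1}" and \<alpha>: "0 < \<alpha>" "\<alpha> < 1"
    and inf: "(\<Sum>n. ennreal (2 powr (- (1 - \<alpha>) * real n)) * radial_count \<rho> n) = \<infinity>"
  shows "AE \<omega> in M. \<not> interpolating \<alpha> (random_set \<rho> \<theta> \<omega>)"
  using AE_random_set_eq_image[OF \<theta> \<rho>]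
proof eventually_elim
  fix \<omega>
  let ?J = "essential_indices \<rho>"
  define z where "z = (\<lambda>k. complex_of_real (\<rho> k) * cis (\<theta> k \<omega>))"
  assume im: "random_set \<rho> \<theta> \<omega> = (\<lambda>k. complex_of_real (\<rho> k) * cis (\<theta> k \<omega>)) ` ?J \<and>
    inj_on (\<lambda>k. complex_of_real (\<rho> k) * cis (\<theta> k \<omega>)) ?J"
  have nz: "norm (z k) = \<rho> k" for k using \<rho>[of k] by (simp add: z_def norm_mult)
  show "\<not> interpolating \<alpha> (random_set \<rho> \<theta> \<omega>)"
  proof
    assume "interpolating \<alpha> (random_set \<rho> \<theta> \<omega>)"
    then have "interpolating \<alpha> (z ` ?J)" "inj_on z ?J" using im by (simp_all add: z_def)
    then have "summable (\<lambda>k. if k \<in> ?J then (1 - (norm (z k))\<^sup>2) powr (1 - \<alpha>) else 0)"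
      by (rule interpolating_imp_summable_weights)
    also have "(\<lambda>k. if k \<in> ?J then (1 - (norm (z k))\<^sup>2) powr (1 - \<alpha>) else 0) = (\<lambda>k. (radial_weight (1 - \<alpha>) \<rho> ?J k)\<^sup>2)"
      by (auto simp: fun_eq_iff radial_weight_def nz power2_eq_square powr_add[symmetric])
    finally have "(\<Sum>k. ennreal ((radial_weight (1 - \<alpha>) \<rho> ?J k)\<^sup>2)) < \<infinity>"
      by (rule suminf_ennreal_lt_top_iff[THEN iffD2, rotated]) simp
    then have "(\<Sum>n. ennreal (2 powr (- (1 - \<alpha>) * real n)) * radial_count \<rho> n) < \<infinity>"
      by (rule suminf_radial_weight_iff[THEN iffD1, rotated -1]) (use \<rho> \<alpha> in auto)
    then show False using inf by simp
  qed
qed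

text \<open>Almost surely there are close pairs for each of countably many tolerances \<open>2 powr -i\<close> and beyond each shell.
  Choosing them recursively in strictly increasing shells keeps the pairs disjoint, as both points
  of a pair lie in the same shell.\<close>

lemma AE_not_interpolating_of_square_divergent:
  assumes \<theta>: "uniform_angles M \<theta>" and \<rho>: "\<And>k. \<rho> k \<in> {0..<1}" and \<alpha>: "0 < \<alpha>" "\<alpha> < 1"
    and inf: "(\<Sum>n. ennreal (2 powr (- real n)) * (radial_count \<rho> n)\<^sup>2) = \<infinity>"
    and fin: "(\<Sum>n. ennreal (2 powr (- real n)) * radial_count \<rho> n) < \<infinity>"
  shows "AE \<omega> in M. \<not> interpolating \<alpha> (random_set \<rho> \<theta> \<omega>)"
proof -
  let ?J = "essential_indices \<rho>"
  let ?sh = "\<lambda>k. shell_index (\<rho> k)"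
  have \<rho>': "0 \<le> \<rho> k" "\<rho> k < 1" for k using \<rho>[of k] by auto
  \<comment> \<open>With \<open>64 * 2\<^sup>i\<close> subshells the distance \<open>8 / (64 * 2\<^sup>i) * 2 powr -n\<close> is \<open>2 powr -i\<close> times an eighth of \<open>2 powr -n\<close>, and
    \<open>1 - \<rho> \<ge> 2 powr -n / 2\<close> in shell \<open>n\<close>; this is the tolerance that excludes interpolation.\<close>
  have "AE \<omega> in M. \<forall>i n. \<exists>j k. j \<noteq> k \<and> j \<in> ?J \<and> k \<in> ?J \<and> ?sh j = ?sh k \<and> n \<le> ?sh j \<and>
    norm (of_real (\<rho> j) * cis (\<theta> j \<omega>) - of_real (\<rho> k) * cis (\<theta> k \<omega>)) \<le> 8 / real (64 * 2 ^ i) * (1/2) ^ ?sh j"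
    unfolding AE_all_countable by (intro allI AE_close_pair[OF \<rho> _ \<theta> inf fin]) simp
  with AE_random_set_eq_image[OF \<theta> \<rho>] show ?thesis
  proof eventually_elim
    fix \<omega>
    define z where "z = (\<lambda>k. complex_of_real (\<rho> k) * cis (\<theta> k \<omega>))"
    assume im: "random_set \<rho> \<theta> \<omega> = (\<lambda>k. complex_of_real (\<rho> k) * cis (\<theta> k \<omega>)) ` ?J \<and>
      inj_on (\<lambda>k. complex_of_real (\<rho> k) * cis (\<theta> k \<omega>)) ?J"
    assume ex: "\<forall>i n. \<exists>j k. j \<noteq> k \<and> j \<in> ?J \<and> k \<in> ?J \<and> ?sh j = ?sh k \<and> n \<le> ?sh j \<and>
      norm (of_real (\<rho> j) * cis (\<theta> j \<omega>) - of_real (\<rho> k) * cis (\<theta> k \<omega>)) \<le> 8 / real (64 * 2 ^ i) * (1/2) ^ ?sh j"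
    define P where "P i q \<longleftrightarrow> fst q \<noteq> snd q \<and> fst q \<in> ?J \<and> snd q \<in> ?J \<and> ?sh (fst q) = ?sh (snd q) \<and>
      norm (z (fst q) - z (snd q)) \<le> 8 / real (64 * 2 ^ i) * (1/2) ^ ?sh (fst q)" for i :: nat and q :: "nat \<times> nat"
    have ex': "\<exists>q. P i q \<and> n \<le> ?sh (fst q)" for i n
    proof -
      from ex obtain j k where "j \<noteq> k \<and> j \<in> ?J \<and> k \<in> ?J \<and> ?sh j = ?sh k \<and> n \<le> ?sh j \<and>
        norm (of_real (\<rho> j) * cis (\<theta> j \<omega>) - of_real (\<rho> k) * cis (\<theta> k \<omega>)) \<le> 8 / real (64 * 2 ^ i) * (1/2) ^ ?sh j"
        by (elim allE[where x = i] allE[where x = n] exE)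
      then show ?thesis unfolding P_def z_def by (intro exI[of _ "(j, k)"]) (unfold fst_conv snd_conv, blast)
    qed
    have "\<exists>q. \<forall>i. P i (q i) \<and> ?sh (fst (q i)) < ?sh (fst (q (Suc i)))"
    proof (rule dependent_nat_choice)
      show "\<exists>q. P 0 q" using ex' by blast
      show "\<exists>q'. P (Suc i) q' \<and> ?sh (fst q) < ?sh (fst q')" if "P i q" for q i
        using ex'[of "Suc i" "Suc (?sh (fst q))"] by (auto simp: Suc_le_eq)
    qed
    then obtain q where q: "\<And>i. P i (q i)" "\<And>i. ?sh (fst (q i)) < ?sh (fst (q (Suc i)))" by blast
    have mono: "strict_mono (\<lambda>i. ?sh (fst (q i)))" by (rule strict_monoI_Suc) (rule q(2))
    define a b where "a i = fst (q i)" and "b i = snd (q i)" for i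
    have ab: "a i \<noteq> b i" "a i \<in> ?J" "b i \<in> ?J" "?sh (a i) = ?sh (b i)"
      "norm (z (a i) - z (b i)) \<le> 8 / real (64 * 2 ^ i) * (1/2) ^ ?sh (a i)" for i
      using q(1)[of i] by (auto simp: P_def a_def b_def)
    have sep: "?sh (a i) = ?sh (a j) \<Longrightarrow> i = j" for i j
      using strict_mono_eq[OF mono, of i j] by (simp add: a_def)
    have nz: "norm (z k) = \<rho> k" for k using \<rho>'[of k] by (simp add: z_def norm_mult)
    have zinj: "inj_on z ?J" and zim: "random_set \<rho> \<theta> \<omega> = z ` ?J" using im by (simp_all add: z_def)
    show "\<not> interpolating \<alpha> (random_set \<rho> \<theta> \<omega>)"
      unfolding zim
    proof (rule not_interpolating_of_close_pairs[where p = "\<lambda>i. z (a i)" and q = "\<lambda>i. z (b i)"])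
      show "inj (\<lambda>i. z (a i))"
        by (rule injI) (metis nz sep)
      show "z (b i) \<noteq> z (a j)" for i j
      proof
        assume e: "z (b i) = z (a j)"
        then have "b i = a j" using zinj ab by (meson inj_onD)
        then have "?sh (a i) = ?sh (a j)" using ab(4)[of i] by simp
        then have "i = j" by (rule sep)
        then show False using \<open>b i = a j\<close> ab(1)[of i] by simp
      qed
      show "norm (z (a i) - z (b i)) \<le> (1/2) ^ i * (1 - norm (z (a i))) / 4" for i
      proof -
        define y where "y = (1/2 :: real) ^ ?sh (a i)"
        have y: "y / 2 \<le> 1 - \<rho> (a i)"
          using shell_index_bounds(1)[OF \<rho>', of "a i"] by (simp add: y_def)
        have "norm (z (a i) - z (b i)) \<le> 8 / real (64 * 2 ^ i) * y" using ab(5)[of i] by (simp only: y_def)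
        also have "8 / real (64 * 2 ^ i) * y = (1/2) ^ i * (y / 2) / 4"
          by (simp add: power_one_over)
        also have "\<dots> \<le> (1/2) ^ i * (1 - \<rho> (a i)) / 4"
          by (intro divide_right_mono mult_left_mono y) auto
        finally show ?thesis by (simp only: nz)
      qed
    qed (use ab \<alpha> in auto)
  qed
qed

theorem theorem1p5:
  fixes M :: "'a measure"
    and \<theta> :: "nat \<Rightarrow> 'a \<Rightarrow> real"
    and \<rho> :: "nat \<Rightarrow> real"
    and \<alpha> :: real
  assumes "prob_space M"
    and "prob_space.indep_vars M (\<lambda>_. borel) \<theta> UNIV"
    and "\<And>k. distributed M lborel (\<theta> k)
            (\<lambda>x. indicator {0..2*pi} x / measure lborel {0..2*pi})"
    and "\<And>k. \<rho> k \<in> {0..<1}"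
  shows "(0 < \<alpha> \<and> \<alpha> < 1/2 \<longrightarrow>
      ((AE \<omega> in M. interpolating \<alpha> (random_set \<rho> \<theta> \<omega>)) \<longleftrightarrow>
        (\<Sum>n. ennreal (2 powr (- real n)) * (radial_count \<rho> n)\<^sup>2) < \<infinity>) \<and>
      ((AE \<omega> in M. \<not> interpolating \<alpha> (random_set \<rho> \<theta> \<omega>)) \<longleftrightarrow>
        (\<Sum>n. ennreal (2 powr (- real n)) * (radial_count \<rho> n)\<^sup>2) = \<infinity>)) \<and>
    (1/2 \<le> \<alpha> \<and> \<alpha> < 1 \<longrightarrow>
      ((AE \<omega> in M. interpolating \<alpha> (random_set \<rho> \<theta> \<omega>)) \<longleftrightarrow>
        (\<Sum>n. ennreal (2 powr (- (1 - \<alpha>) * real n)) * radial_count \<rho> n) < \<infinity>) \<and>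
      ((AE \<omega> in M. \<not> interpolating \<alpha> (random_set \<rho> \<theta> \<omega>)) \<longleftrightarrow>
        (\<Sum>n. ennreal (2 powr (- (1 - \<alpha>) * real n)) * radial_count \<rho> n) = \<infinity>))"
proof -
  interpret prob_space M by (rule assms(1))
  have \<theta>: "uniform_angles M \<theta>" using assms by (simp add: uniform_angles_def)
  note \<rho> = assms(4)
  have \<rho>': "0 \<le> \<rho> k" "\<rho> k < 1" for k using \<rho>[of k] by auto
  let ?I = "\<lambda>\<omega>. interpolating \<alpha> (random_set \<rho> \<theta> \<omega>)"
  have dichotomy: "((AE \<omega> in M. ?I \<omega>) \<longleftrightarrow> S < \<infinity>) \<and> ((AE \<omega> in M. \<not> ?I \<omega>) \<longleftrightarrow> S = \<infinity>)"
    if yes: "S < \<infinity> \<Longrightarrow> AE \<omega> in M. ?I \<omega>" and no: "S = \<infinity> \<Longrightarrow> AE \<omega> in M. \<not> ?I \<omega>" for S :: ennreal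
  proof -
    have excl: False if "AE \<omega> in M. ?I \<omega>" "AE \<omega> in M. \<not> ?I \<omega>"
    proof -
      from that have "AE \<omega> in M. False" by eventually_elim (rule notE)
      then show False by simp
    qed
    show ?thesis
    proof (cases "S = \<infinity>")
      case True
      then show ?thesis using no excl by auto
    next
      case False
      then have "S < \<infinity>" by (simp add: less_top)
      then show ?thesis using yes excl by auto
    qed
  qed
  have case1: "((AE \<omega> in M. ?I \<omega>) \<longleftrightarrow> (\<Sum>n. ennreal (2 powr (- real n)) * (radial_count \<rho> n)\<^sup>2) < \<infinity>) \<and>
      ((AE \<omega> in M. \<not> ?I \<omega>) \<longleftrightarrow> (\<Sum>n. ennreal (2 powr (- real n)) * (radial_count \<rho> n)\<^sup>2) = \<infinity>)"
    if \<alpha>: "0 < \<alpha>" "\<alpha> < 1/2"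
  proof (rule dichotomy)
    assume fin: "(\<Sum>n. ennreal (2 powr (- real n)) * (radial_count \<rho> n)\<^sup>2) < \<infinity>"
    have s: "0 < 1 - \<alpha>" "1/2 < 1 - \<alpha>" "1 - \<alpha> \<le> 1" "2 * (1 - \<alpha>) \<noteq> 1" using \<alpha> by auto
    show "AE \<omega> in M. ?I \<omega>"
    proof (rule AE_interpolating_of_gram_square[OF \<theta> \<rho>])
      show "(\<Sum>k. ennreal ((radial_weight (1 - \<alpha>) \<rho> (essential_indices \<rho>) k)\<^sup>2)) < \<infinity>"
        by (rule suminf_radial_weight_iff[THEN iffD2, OF \<rho> s(1,3)])
           (rule suminf_weighted_count_of_square[OF fin s(2)])
      show "AE \<omega> in M. (\<Sum>k. \<Sum>l. (\<Sum>j. gram_entry (1 - \<alpha>) \<rho> (essential_indices \<rho>) (\<lambda>k. \<theta> k \<omega>) j k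
          * gram_entry (1 - \<alpha>) \<rho> (essential_indices \<rho>) (\<lambda>k. \<theta> k \<omega>) j l)\<^sup>2) < \<infinity>"
        by (rule AE_gram_square_finite_of_hilbert_schmidt[OF \<theta> \<rho>' s(1,4)])
           (rule hilbert_schmidt_sum_finite[OF \<rho> s(2,3) fin])
    qed (use \<alpha> in auto)
  next
    assume inf: "(\<Sum>n. ennreal (2 powr (- real n)) * (radial_count \<rho> n)\<^sup>2) = \<infinity>"
    show "AE \<omega> in M. \<not> ?I \<omega>"
    proof (cases "(\<Sum>n. ennreal (2 powr (- (1 - \<alpha>) * real n)) * radial_count \<rho> n) = \<infinity>")
      case True
      show ?thesis by (rule AE_not_interpolating_of_weights_divergent[OF \<theta> \<rho> _ _ True]) (use \<alpha> in auto)
    next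
      case False
      \<comment> \<open>The necessary condition on the weights may be assumed; it makes the diagonal pairs negligible.\<close>
      have "(\<Sum>n. ennreal (2 powr (- real n)) * radial_count \<rho> n) \<le> (\<Sum>n. ennreal (2 powr (- (1 - \<alpha>) * real n)) * radial_count \<rho> n)"
      proof (intro suminf_le allI mult_right_mono ennreal_leI powr_mono)
        fix n
        show "- real n \<le> - (1 - \<alpha>) * real n" using \<alpha> by (simp add: algebra_simps)
      qed auto
      also have "\<dots> < \<infinity>" using False by (simp add: less_top)
      finally have fin: "(\<Sum>n. ennreal (2 powr (- real n)) * radial_count \<rho> n) < \<infinity>" .
      show ?thesis by (rule AE_not_interpolating_of_square_divergent[OF \<theta> \<rho> _ _ inf fin]) (use \<alpha> in auto)
    qed
  qed
  have case2: "((AE \<omega> in M. ?I \<omega>) \<longleftrightarrow> (\<Sum>n. ennreal (2 powr (- (1 - \<alpha>) * real n)) * radial_count \<rho> n) < \<infinity>) \<and>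
      ((AE \<omega> in M. \<not> ?I \<omega>) \<longleftrightarrow> (\<Sum>n. ennreal (2 powr (- (1 - \<alpha>) * real n)) * radial_count \<rho> n) = \<infinity>)"
    if \<alpha>: "1/2 \<le> \<alpha>" "\<alpha> < 1"
  proof (rule dichotomy)
    assume fin: "(\<Sum>n. ennreal (2 powr (- (1 - \<alpha>) * real n)) * radial_count \<rho> n) < \<infinity>"
    have s: "0 < 1 - \<alpha>" "1 - \<alpha> \<le> 1/2" "1 - \<alpha> \<le> 1" using \<alpha> by auto
    have w: "(\<Sum>k. ennreal ((radial_weight (1 - \<alpha>) \<rho> (essential_indices \<rho>) k)\<^sup>2)) < \<infinity>"
      by (rule suminf_radial_weight_iff[THEN iffD2, OF \<rho> s(1,3) fin])
    show "AE \<omega> in M. ?I \<omega>"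
      by (rule AE_interpolating_of_gram_square[OF \<theta> \<rho> _ _ w AE_gram_square_finite_of_summable[OF \<theta> \<rho>' s(1,2) w]])
         (use \<alpha> in auto)
  next
    assume inf: "(\<Sum>n. ennreal (2 powr (- (1 - \<alpha>) * real n)) * radial_count \<rho> n) = \<infinity>"
    show "AE \<omega> in M. \<not> ?I \<omega>"
      by (rule AE_not_interpolating_of_weights_divergent[OF \<theta> \<rho> _ _ inf]) (use \<alpha> in auto)
  qed
  show ?thesis using case1 case2 by blast
qed

end
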